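(* Let $(\Lambda,d)$ be a finitely aligned $k$-graph, and let $\mathcal{E}$ be a subset of $\mathrm{FE}(\Lambda)$. Then $C^*(\Lambda;\mathcal{E})^\gamma$ is an AF algebra. If $\{t_\lambda:\lambda\in\Lambda\}$ is a relative Cuntz-Krieger $(\Lambda;\mathcal{E})$-family, then $\pi^{\mathcal{E}}_t$ is injective on $C^*(\Lambda;\mathcal{E})^\gamma$ if and only if, for every finite $E\subset\Lambda$ and every $(\lambda,\mu)\in\Pi E\times_{d,s}\Pi E$, $\Theta(t)^{\Pi E}_{\lambda,\mu}$ is nonzero whenever $\Theta(s_{\mathcal{E}})^{\Pi E}_{\lambda,\mu}$ is nonzero.
   Context: $k$-graphs. $\mathbb{N}$ contains $0$; $\mathbb{N}^k$ is ordered coordinatewise and $m\vee n$ is the coordinatewise maximum. For $k\in\mathbb{N}\setminus\{0\}$, a $k$-graph is a pair $(\Lambda,d)$ where $\Lambda$ is a countable category and $d:\Lambda\to\mathbb{N}^k$ is a functor satisfying the factorisation property: for every morphism $\lambda$ and all $m,n\in\mathbb{N}^k$ with $d(\lambda)=m+n$ there are unique morphisms $\mu,\nu$ with $d(\mu)=m$, $d(\nu)=n$, $\lambda=\mu\nu$. Write $\lambda\in\Lambda$ for morphisms ("paths"), $r,s$ for codomain and domain (so $\lambda\mu$ is defined when $s(\lambda)=r(\mu)$); objects ("vertices") are identified with the elements of $\Lambda^0=\{\lambda: d(\lambda)=0\}$. For $v\in\Lambda^0$, $v\Lambda=\{\lambda: r(\lambda)=v\}$. For $E\subset\Lambda$,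 $\lambda E=\{\lambda\mu:\mu\in E, r(\mu)=s(\lambda)\}$. For $l\le m\le d(\lambda)$, $\lambda(l,m)$ is the unique path of degree $m-l$ with $\lambda=\lambda(0,l)\lambda(l,m)\lambda(m,d(\lambda))$. Finite exhaustive sets. For $\mu,\nu\in\Lambda$, $\mathrm{MCE}(\mu,\nu)$ is the set of $\lambda$ with $d(\lambda)=d(\mu)\vee d(\nu)$, $\lambda(0,d(\mu))=\mu$, $\lambda(0,d(\nu))=\nu$; $\Lambda^{\min}(\mu,\nu)=\{(\alpha,\beta)\in \Lambda\times\Lambda:\mu\alpha=\nu\beta\in\mathrm{MCE}(\mu,\nu)\}$. $\Lambda$ is finitely aligned if every $\mathrm{MCE}(\mu,\nu)$ is finite (possibly empty). For $E\subset\Lambda$, $\mathrm{Ext}(\mu;E)=\{\alpha\in s(\mu)\Lambda:(\alpha,\beta)\in\Lambda^{\min}(\mu,\nu)\text{ for some }\nu\in E \text{ and some } \beta\}$. A set $E\subset v\Lambda$ is exhaustive if $\mathrm{Ext}(\lambda;E)\neq\emptyset$ for all $\lambda\in v\Lambda$. $\mathrm{FE}(\Lambda)=\bigcup_{v\in\Lambda^0}\{E\subset v\Lambda\setminus\{v\}: E\text{ finite and exhaustive}\}$; for $E\in\mathrm{FE}(\Lambda)$, $r(E)$ is the vertex $v$ with $E\subset v\Lambda$. Relative Cuntz-Krieger algebras. For $\mathcal{E}\subset\mathrm{FE}(\Lambda)$, a relative Cuntz-Krieger $(\Lambda;\mathcal{E})$-family is a collection $\{t_\lambda:\lambda\in\Lambda\}$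 of partial isometries in a $C^*$-algebra such that: (TCK1) $\{t_v:v\in\Lambda^0\}$ are mutually orthogonal projections; (TCK2) $t_\lambda t_\mu=t_{\lambda\mu}$ whenever $s(\lambda)=r(\mu)$; (TCK3) $t_\lambda^*t_\mu=\sum_{(\alpha,\beta)\in\Lambda^{\min}(\lambda,\mu)}t_\alpha t_\beta^*$ for all $\lambda,\mu$ (empty sum $=0$); (CK) $\prod_{\lambda\in E}(t_{r(E)}-t_\lambda t_\lambda^* )=0$ for all $E\in\mathcal{E}$. (By (TCK3) the projections $t_\lambda t_\lambda^*$ commute, so products are well defined.) $C^*(\Lambda;\mathcal{E})$ is the universal $C^*$-algebra generated by a relative Cuntz-Krieger $(\Lambda;\mathcal{E})$-family $\{s_{\mathcal{E}}(\lambda)\}$; given a relative Cuntz-Krieger $(\Lambda;\mathcal{E})$-family $\{t_\lambda\}$ in a $C^*$-algebra $B$, $\pi^{\mathcal{E}}_t:C^*(\Lambda;\mathcal{E})\to B$ is the unique homomorphism with $\pi^{\mathcal{E}}_t(s_{\mathcal{E}}(\lambda))=t_\lambda$. The gauge action $\gamma$ of $\mathbb{T}^k$ on $C^*(\Lambda;\mathcal{E})$ is the strongly continuous action with $\gamma_z(s_{\mathcal{E}}(\lambda))=z^{d(\lambda)}s_{\mathcal{E}}(\lambda)$, where $z^n=\prod_i z_i^{n_i}$; the core $C^*(\Lambda;\mathcal{E})^\gamma$ is its fixed-point algebra, which equals $\overline{\mathrm{span}}\{s_{\mathcal{E}}(\lambda)s_{\mathcal{E}}(\mu)^*:d(\lambda)=d(\mu)\}$.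 The sets $\Pi E$ and elements $\Theta$. For finite $E\subset\Lambda$, $\Pi E$ is the smallest subset $G$ of $\Lambda$ such that $E\subset G$ and such that $\lambda,\mu,\sigma\in G$ with $d(\lambda)=d(\mu)$ and $s(\lambda)=s(\mu)$ implies $\lambda\,\mathrm{Ext}(\mu;\{\sigma\})\subset G$. (It is known that $\Pi E$ is finite.) $\Pi E\times_{d,s}\Pi E=\{(\lambda,\mu)\in\Pi E\times\Pi E:d(\lambda)=d(\mu),s(\lambda)=s(\mu)\}$. For a relative Cuntz-Krieger $(\Lambda;\mathcal{E})$-family $\{t_\lambda\}$ and $(\lambda,\mu)\in\Pi E\times_{d,s}\Pi E$, $$\Theta(t)^{\Pi E}_{\lambda,\mu}=t_\lambda\Big(\prod_{\nu \in s(\lambda)\Lambda:\ \lambda\nu\in\Pi E\setminus\{\lambda\}}(t_{s(\lambda)}-t_\nu t_\nu^* )\Big)t_\mu^*,$$ with the empty product interpreted as the identity of the multiplier algebra. $\Theta(s_{\mathcal{E}})^{\Pi E}_{\lambda,\mu}$ is this element for the universal family. *)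

theory Defs
  imports "HOL-Analysis.Analysis" "HOL-Algebra.Module" "HOL-Library.Function_Algebras"
begin

section \<open>Higher-rank graphs\<close>

text \<open>
  Degrees live in \<^typ>\<open>'k \<Rightarrow> nat\<close> for a finite (automatically nonempty) index type, so \<open>k\<close> is the
  cardinality of \<^typ>\<open>'k\<close>; addition, order and join (\<^const>\<open>sup\<close>) are all pointwise.
  A category is given by its morphisms alone: objects are identified with identity morphisms,
  and \<open>rng\<close>, \<open>src\<close> return the identity at the codomain and at the domain.
\<close>

record ('p, 'k) kgraph =
  paths :: "'p set"
  rng :: "'p \<Rightarrow> 'p"
  src :: "'p \<Rightarrow> 'p"
  cmp :: "'p \<Rightarrow> 'p \<Rightarrow> 'p"  (infixl \<open>\<cdot>\<index>\<close> 70)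
  deg :: "'p \<Rightarrow> 'k \<Rightarrow> nat"

locale k_graph =
  fixes \<Lambda> :: "('p, 'k::finite) kgraph" (structure)
  assumes countable_paths: "countable (paths \<Lambda>)"
    and rng_closed: "\<mu> \<in> paths \<Lambda> \<Longrightarrow> rng \<Lambda> \<mu> \<in> paths \<Lambda>"
    and src_closed: "\<mu> \<in> paths \<Lambda> \<Longrightarrow> src \<Lambda> \<mu> \<in> paths \<Lambda>"
    and rng_rng: "\<mu> \<in> paths \<Lambda> \<Longrightarrow> rng \<Lambda> (rng \<Lambda> \<mu>) = rng \<Lambda> \<mu>"
    and src_rng: "\<mu> \<in> paths \<Lambda> \<Longrightarrow> src \<Lambda> (rng \<Lambda> \<mu>) = rng \<Lambda> \<mu>"
    and rng_src: "\<mu> \<in> paths \<Lambda> \<Longrightarrow> rng \<Lambda> (src \<Lambda> \<mu>) = src \<Lambda> \<mu>"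
    and src_src: "\<mu> \<in> paths \<Lambda> \<Longrightarrow> src \<Lambda> (src \<Lambda> \<mu>) = src \<Lambda> \<mu>"
    and cmp_closed: "\<lbrakk>\<mu> \<in> paths \<Lambda>; \<nu> \<in> paths \<Lambda>; src \<Lambda> \<mu> = rng \<Lambda> \<nu>\<rbrakk> \<Longrightarrow> \<mu> \<cdot> \<nu> \<in> paths \<Lambda>"
    and rng_cmp: "\<lbrakk>\<mu> \<in> paths \<Lambda>; \<nu> \<in> paths \<Lambda>; src \<Lambda> \<mu> = rng \<Lambda> \<nu>\<rbrakk> \<Longrightarrow> rng \<Lambda> (\<mu> \<cdot> \<nu>) = rng \<Lambda> \<mu>"
    and src_cmp: "\<lbrakk>\<mu> \<in> paths \<Lambda>; \<nu> \<in> paths \<Lambda>; src \<Lambda> \<mu> = rng \<Lambda> \<nu>\<rbrakk> \<Longrightarrow> src \<Lambda> (\<mu> \<cdot> \<nu>) = src \<Lambda> \<nu>"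
    and cmp_assoc: "\<lbrakk>\<mu> \<in> paths \<Lambda>; \<nu> \<in> paths \<Lambda>; \<sigma> \<in> paths \<Lambda>; src \<Lambda> \<mu> = rng \<Lambda> \<nu>; src \<Lambda> \<nu> = rng \<Lambda> \<sigma>\<rbrakk>
      \<Longrightarrow> (\<mu> \<cdot> \<nu>) \<cdot> \<sigma> = \<mu> \<cdot> (\<nu> \<cdot> \<sigma>)"
    and rng_id: "\<mu> \<in> paths \<Lambda> \<Longrightarrow> rng \<Lambda> \<mu> \<cdot> \<mu> = \<mu>"
    and src_id: "\<mu> \<in> paths \<Lambda> \<Longrightarrow> \<mu> \<cdot> src \<Lambda> \<mu> = \<mu>"
    and deg_id: "\<mu> \<in> paths \<Lambda> \<Longrightarrow> deg \<Lambda> (rng \<Lambda> \<mu>) = 0"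
    and deg_cmp: "\<lbrakk>\<mu> \<in> paths \<Lambda>; \<nu> \<in> paths \<Lambda>; src \<Lambda> \<mu> = rng \<Lambda> \<nu>\<rbrakk>
      \<Longrightarrow> deg \<Lambda> (\<mu> \<cdot> \<nu>) = deg \<Lambda> \<mu> + deg \<Lambda> \<nu>"
    and factorisation: "\<lbrakk>\<sigma> \<in> paths \<Lambda>; deg \<Lambda> \<sigma> = m + n\<rbrakk>
      \<Longrightarrow> \<exists>!(\<mu>, \<nu>). \<mu> \<in> paths \<Lambda> \<and> \<nu> \<in> paths \<Lambda> \<and> src \<Lambda> \<mu> = rng \<Lambda> \<nu>
             \<and> deg \<Lambda> \<mu> = m \<and> deg \<Lambda> \<nu> = n \<and> \<sigma> = \<mu> \<cdot> \<nu>"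

definition vertices :: "('p, 'k::finite) kgraph \<Rightarrow> 'p set" where
  "vertices \<Lambda> = {v \<in> paths \<Lambda>. deg \<Lambda> v = 0}"

definition paths_into :: "('p, 'k::finite) kgraph \<Rightarrow> 'p \<Rightarrow> 'p set" where
  "paths_into \<Lambda> v = {\<mu> \<in> paths \<Lambda>. rng \<Lambda> \<mu> = v}"

text \<open>The segment \<open>\<sigma>(l, m)\<close>, meaningful for \<open>l \<le> m \<le> deg \<Lambda> \<sigma>\<close>.\<close>

definition segment :: "('p, 'k::finite) kgraph \<Rightarrow> 'p \<Rightarrow> ('k \<Rightarrow> nat) \<Rightarrow> ('k \<Rightarrow> nat) \<Rightarrow> 'p" where
  "segment \<Lambda> \<sigma> l m = (THE \<nu>. \<nu> \<in> paths \<Lambda> \<and> deg \<Lambda> \<nu> = m - l \<and>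
     (\<exists>\<mu>\<in>paths \<Lambda>. \<exists>\<tau>\<in>paths \<Lambda>. deg \<Lambda> \<mu> = l \<and> deg \<Lambda> \<tau> = deg \<Lambda> \<sigma> - m \<and>
        src \<Lambda> \<mu> = rng \<Lambda> \<nu> \<and> src \<Lambda> \<nu> = rng \<Lambda> \<tau> \<and> \<sigma> = \<mu> \<cdot>\<^bsub>\<Lambda>\<^esub> \<nu> \<cdot>\<^bsub>\<Lambda>\<^esub> \<tau>))"

definition MCE :: "('p, 'k::finite) kgraph \<Rightarrow> 'p \<Rightarrow> 'p \<Rightarrow> 'p set" where
  "MCE \<Lambda> \<mu> \<nu> = {\<sigma> \<in> paths \<Lambda>. deg \<Lambda> \<sigma> = sup (deg \<Lambda> \<mu>) (deg \<Lambda> \<nu>) \<and>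
     segment \<Lambda> \<sigma> 0 (deg \<Lambda> \<mu>) = \<mu> \<and> segment \<Lambda> \<sigma> 0 (deg \<Lambda> \<nu>) = \<nu>}"

definition Lambda_min :: "('p, 'k::finite) kgraph \<Rightarrow> 'p \<Rightarrow> 'p \<Rightarrow> ('p \<times> 'p) set" where
  "Lambda_min \<Lambda> \<mu> \<nu> = {(\<alpha>, \<beta>). \<alpha> \<in> paths \<Lambda> \<and> \<beta> \<in> paths \<Lambda> \<and>
     src \<Lambda> \<mu> = rng \<Lambda> \<alpha> \<and> src \<Lambda> \<nu> = rng \<Lambda> \<beta> \<and>
     \<mu> \<cdot>\<^bsub>\<Lambda>\<^esub> \<alpha> = \<nu> \<cdot>\<^bsub>\<Lambda>\<^esub> \<beta> \<and> \<mu> \<cdot>\<^bsub>\<Lambda>\<^esub> \<alpha> \<in> MCE \<Lambda> \<mu> \<nu>}"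

definition finitely_aligned :: "('p, 'k::finite) kgraph \<Rightarrow> bool" where
  "finitely_aligned \<Lambda> \<longleftrightarrow> (\<forall>\<mu>\<in>paths \<Lambda>. \<forall>\<nu>\<in>paths \<Lambda>. finite (MCE \<Lambda> \<mu> \<nu>))"

definition Ext :: "('p, 'k::finite) kgraph \<Rightarrow> 'p \<Rightarrow> 'p set \<Rightarrow> 'p set" where
  "Ext \<Lambda> \<mu> E = {\<alpha> \<in> paths_into \<Lambda> (src \<Lambda> \<mu>). \<exists>\<nu>\<in>E. \<exists>\<beta>. (\<alpha>, \<beta>) \<in> Lambda_min \<Lambda> \<mu> \<nu>}"

definition exhaustive :: "('p, 'k::finite) kgraph \<Rightarrow> 'p \<Rightarrow> 'p set \<Rightarrow> bool" where
  "exhaustive \<Lambda> v E \<longleftrightarrow> E \<subseteq> paths_into \<Lambda> v \<and> (\<forall>\<mu>\<in>paths_into \<Lambda> v. Ext \<Lambda> \<mu> E \<noteq> {})"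

definition FE :: "('p, 'k::finite) kgraph \<Rightarrow> 'p set set" where
  "FE \<Lambda> = (\<Union>v\<in>vertices \<Lambda>. {E. E \<subseteq> paths_into \<Lambda> v - {v} \<and> finite E \<and> exhaustive \<Lambda> v E})"

definition rng_set :: "('p, 'k::finite) kgraph \<Rightarrow> 'p set \<Rightarrow> 'p" where
  "rng_set \<Lambda> E = (THE v. v \<in> vertices \<Lambda> \<and> E \<subseteq> paths_into \<Lambda> v)"

text \<open>The closure \<open>\<Pi>E\<close>.\<close>

inductive_set Pi_closure :: "('p, 'k::finite) kgraph \<Rightarrow> 'p set \<Rightarrow> 'p set"
  for \<Lambda> :: "('p, 'k::finite) kgraph" and E :: "'p set" where
  base: "\<mu> \<in> E \<Longrightarrow> \<mu> \<in> Pi_closure \<Lambda> E"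
| ext: "\<lbrakk>\<kappa> \<in> Pi_closure \<Lambda> E; \<mu> \<in> Pi_closure \<Lambda> E; \<sigma> \<in> Pi_closure \<Lambda> E;
         deg \<Lambda> \<kappa> = deg \<Lambda> \<mu>; src \<Lambda> \<kappa> = src \<Lambda> \<mu>; \<alpha> \<in> Ext \<Lambda> \<mu> {\<sigma>}\<rbrakk>
        \<Longrightarrow> \<kappa> \<cdot>\<^bsub>\<Lambda>\<^esub> \<alpha> \<in> Pi_closure \<Lambda> E"

definition Pi_pairs :: "('p, 'k::finite) kgraph \<Rightarrow> 'p set \<Rightarrow> ('p \<times> 'p) set" where
  "Pi_pairs \<Lambda> E = {(\<kappa>, \<mu>). \<kappa> \<in> Pi_closure \<Lambda> E \<and> \<mu> \<in> Pi_closure \<Lambda> E \<and>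
     deg \<Lambda> \<kappa> = deg \<Lambda> \<mu> \<and> src \<Lambda> \<kappa> = src \<Lambda> \<mu>}"


section \<open>C*-algebras\<close>

text \<open>
  C*-algebras need not be unital: the field \<^const>\<open>one\<close>, inherited from the record of rings,
  is not constrained and not used.
\<close>

record 'a cstar = "(complex, 'a) module" +
  adj :: "'a \<Rightarrow> 'a"
  nrm :: "'a \<Rightarrow> real"

definition complex_ring :: "complex ring" where
  "complex_ring = \<lparr>carrier = UNIV, mult = (*), one = 1, zero = 0, add = (+)\<rparr>"

text \<open>The cut-off outside the carrier is what the locale \<^locale>\<open>Metric_space\<close> requires of a metric.\<close>

definition cstar_dist :: "'a cstar \<Rightarrow> 'a \<Rightarrow> 'a \<Rightarrow> real" where
  "cstar_dist A x y = (if x \<in> carrier A \<and> y \<in> carrier A then nrm A (x \<ominus>\<^bsub>A\<^esub> y) else 0)"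

locale cstar_algebra = module complex_ring A for A :: "'a cstar" (structure) +
  assumes mult_closed: "\<lbrakk>x \<in> carrier A; y \<in> carrier A\<rbrakk> \<Longrightarrow> x \<otimes>\<^bsub>A\<^esub> y \<in> carrier A"
    and mult_assoc: "\<lbrakk>x \<in> carrier A; y \<in> carrier A; z \<in> carrier A\<rbrakk>
      \<Longrightarrow> (x \<otimes>\<^bsub>A\<^esub> y) \<otimes>\<^bsub>A\<^esub> z = x \<otimes>\<^bsub>A\<^esub> (y \<otimes>\<^bsub>A\<^esub> z)"
    and distrib_left: "\<lbrakk>x \<in> carrier A; y \<in> carrier A; z \<in> carrier A\<rbrakk>
      \<Longrightarrow> x \<otimes>\<^bsub>A\<^esub> (y \<oplus>\<^bsub>A\<^esub> z) = x \<otimes>\<^bsub>A\<^esub> y \<oplus>\<^bsub>A\<^esub> x \<otimes>\<^bsub>A\<^esub> z"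
    and distrib_right: "\<lbrakk>x \<in> carrier A; y \<in> carrier A; z \<in> carrier A\<rbrakk>
      \<Longrightarrow> (x \<oplus>\<^bsub>A\<^esub> y) \<otimes>\<^bsub>A\<^esub> z = x \<otimes>\<^bsub>A\<^esub> z \<oplus>\<^bsub>A\<^esub> y \<otimes>\<^bsub>A\<^esub> z"
    and smult_mult_left: "\<lbrakk>x \<in> carrier A; y \<in> carrier A\<rbrakk>
      \<Longrightarrow> (c \<odot>\<^bsub>A\<^esub> x) \<otimes>\<^bsub>A\<^esub> y = c \<odot>\<^bsub>A\<^esub> (x \<otimes>\<^bsub>A\<^esub> y)"
    and smult_mult_right: "\<lbrakk>x \<in> carrier A; y \<in> carrier A\<rbrakk>
      \<Longrightarrow> x \<otimes>\<^bsub>A\<^esub> (c \<odot>\<^bsub>A\<^esub> y) = c \<odot>\<^bsub>A\<^esub> (x \<otimes>\<^bsub>A\<^esub> y)"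
    and adj_closed: "x \<in> carrier A \<Longrightarrow> adj A x \<in> carrier A"
    and adj_adj: "x \<in> carrier A \<Longrightarrow> adj A (adj A x) = x"
    and adj_add: "\<lbrakk>x \<in> carrier A; y \<in> carrier A\<rbrakk> \<Longrightarrow> adj A (x \<oplus>\<^bsub>A\<^esub> y) = adj A x \<oplus>\<^bsub>A\<^esub> adj A y"
    and adj_smult: "x \<in> carrier A \<Longrightarrow> adj A (c \<odot>\<^bsub>A\<^esub> x) = cnj c \<odot>\<^bsub>A\<^esub> adj A x"
    and adj_mult: "\<lbrakk>x \<in> carrier A; y \<in> carrier A\<rbrakk> \<Longrightarrow> adj A (x \<otimes>\<^bsub>A\<^esub> y) = adj A y \<otimes>\<^bsub>A\<^esub> adj A x"
    and nrm_nonneg: "x \<in> carrier A \<Longrightarrow> 0 \<le> nrm A x"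
    and nrm_eq_0: "x \<in> carrier A \<Longrightarrow> nrm A x = 0 \<longleftrightarrow> x = \<zero>\<^bsub>A\<^esub>"
    and nrm_add: "\<lbrakk>x \<in> carrier A; y \<in> carrier A\<rbrakk> \<Longrightarrow> nrm A (x \<oplus>\<^bsub>A\<^esub> y) \<le> nrm A x + nrm A y"
    and nrm_smult: "x \<in> carrier A \<Longrightarrow> nrm A (c \<odot>\<^bsub>A\<^esub> x) = cmod c * nrm A x"
    and nrm_mult: "\<lbrakk>x \<in> carrier A; y \<in> carrier A\<rbrakk> \<Longrightarrow> nrm A (x \<otimes>\<^bsub>A\<^esub> y) \<le> nrm A x * nrm A y"
    and cstar_identity: "x \<in> carrier A \<Longrightarrow> nrm A (adj A x \<otimes>\<^bsub>A\<^esub> x) = (nrm A x)\<^sup>2"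
    and complete: "Metric_space.mcomplete (carrier A) (cstar_dist A)"

definition cstar_subalgebra :: "'a set \<Rightarrow> 'a cstar \<Rightarrow> bool" where
  "cstar_subalgebra S A \<longleftrightarrow> S \<subseteq> carrier A \<and> cstar_algebra (A\<lparr>carrier := S\<rparr>)"

definition cstar_generated :: "'a cstar \<Rightarrow> 'a set \<Rightarrow> 'a set" where
  "cstar_generated A X = \<Inter>{S. cstar_subalgebra S A \<and> X \<subseteq> S}"

text \<open>
  Homomorphisms are \<open>*\<close>-homomorphisms. They are taken to be extensional, so that uniqueness of a
  homomorphism refers only to its values on the carrier.
\<close>

definition cstar_hom :: "'a cstar \<Rightarrow> 'b cstar \<Rightarrow> ('a \<Rightarrow> 'b) set" where
  "cstar_hom A B = {\<phi> \<in> carrier A \<rightarrow>\<^sub>E carrier B.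
     (\<forall>x\<in>carrier A. \<forall>y\<in>carrier A. \<phi> (x \<oplus>\<^bsub>A\<^esub> y) = \<phi> x \<oplus>\<^bsub>B\<^esub> \<phi> y) \<and>
     (\<forall>c. \<forall>x\<in>carrier A. \<phi> (c \<odot>\<^bsub>A\<^esub> x) = c \<odot>\<^bsub>B\<^esub> \<phi> x) \<and>
     (\<forall>x\<in>carrier A. \<forall>y\<in>carrier A. \<phi> (x \<otimes>\<^bsub>A\<^esub> y) = \<phi> x \<otimes>\<^bsub>B\<^esub> \<phi> y) \<and>
     (\<forall>x\<in>carrier A. \<phi> (adj A x) = adj B (\<phi> x))}"

definition finite_dimensional :: "'a cstar \<Rightarrow> bool" where
  "finite_dimensional A \<longleftrightarrow> (\<exists>X. finite X \<and> X \<subseteq> carrier A \<and>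
     (\<forall>a\<in>carrier A. \<exists>c :: 'a \<Rightarrow> complex. a = (\<Oplus>\<^bsub>A\<^esub>x\<in>X. c x \<odot>\<^bsub>A\<^esub> x)))"

definition AF_algebra :: "'a cstar \<Rightarrow> bool" where
  "AF_algebra A \<longleftrightarrow> cstar_algebra A \<and>
     (\<exists>F :: nat \<Rightarrow> 'a set.
        (\<forall>n. cstar_subalgebra (F n) A \<and> finite_dimensional (A\<lparr>carrier := F n\<rparr>) \<and> F n \<subseteq> F (Suc n)) \<and>
        Metric_space.mtopology (carrier A) (cstar_dist A) closure_of (\<Union>n. F n) = carrier A)"

text \<open>
  The product over a finite set \<open>S\<close> of commuting elements \<open>f i\<close>, applied from the left to \<open>x\<close>.
  Thus the empty product acts as the identity of the multiplier algebra.
\<close>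

definition prod_act :: "'a cstar \<Rightarrow> ('i \<Rightarrow> 'a) \<Rightarrow> 'i set \<Rightarrow> 'a \<Rightarrow> 'a" where
  "prod_act A f S x = foldD (carrier A) (\<lambda>i y. f i \<otimes>\<^bsub>A\<^esub> y) x S"

definition projection :: "'a cstar \<Rightarrow> 'a \<Rightarrow> bool" where
  "projection A p \<longleftrightarrow> p \<in> carrier A \<and> adj A p = p \<and> p \<otimes>\<^bsub>A\<^esub> p = p"

definition partial_isometry :: "'a cstar \<Rightarrow> 'a \<Rightarrow> bool" where
  "partial_isometry A x \<longleftrightarrow> x \<in> carrier A \<and> x \<otimes>\<^bsub>A\<^esub> adj A x \<otimes>\<^bsub>A\<^esub> x = x"


section \<open>Relative Cuntz-Krieger algebras\<close>

text \<open>
  In the last clause every factor lies in the corner cut out by the projection \<open>t\<^sub>v\<close>, \<open>v = r(E)\<close>, so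
  letting the product act on \<open>t\<^sub>v\<close> yields the product itself (each \<open>E\<close> is nonempty).
\<close>

definition rel_CK_family ::
    "('p, 'k::finite) kgraph \<Rightarrow> 'p set set \<Rightarrow> 'a cstar \<Rightarrow> ('p \<Rightarrow> 'a) \<Rightarrow> bool" where
  "rel_CK_family \<Lambda> \<E> B t \<longleftrightarrow>
     (\<forall>\<mu>\<in>paths \<Lambda>. partial_isometry B (t \<mu>)) \<and>
     (\<forall>v\<in>vertices \<Lambda>. projection B (t v)) \<and>
     (\<forall>v\<in>vertices \<Lambda>. \<forall>w\<in>vertices \<Lambda>. v \<noteq> w \<longrightarrow> t v \<otimes>\<^bsub>B\<^esub> t w = \<zero>\<^bsub>B\<^esub>) \<and>
     (\<forall>\<mu>\<in>paths \<Lambda>. \<forall>\<nu>\<in>paths \<Lambda>. src \<Lambda> \<mu> = rng \<Lambda> \<nu> \<longrightarrow> t \<mu> \<otimes>\<^bsub>B\<^esub> t \<nu> = t (\<mu> \<cdot>\<^bsub>\<Lambda>\<^esub> \<nu>)) \<and>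
     (\<forall>\<mu>\<in>paths \<Lambda>. \<forall>\<nu>\<in>paths \<Lambda>. adj B (t \<mu>) \<otimes>\<^bsub>B\<^esub> t \<nu> =
        (\<Oplus>\<^bsub>B\<^esub>q\<in>Lambda_min \<Lambda> \<mu> \<nu>. t (fst q) \<otimes>\<^bsub>B\<^esub> adj B (t (snd q)))) \<and>
     (\<forall>E\<in>\<E>. prod_act B (\<lambda>\<mu>. t (rng_set \<Lambda> E) \<ominus>\<^bsub>B\<^esub> t \<mu> \<otimes>\<^bsub>B\<^esub> adj B (t \<mu>)) E (t (rng_set \<Lambda> E)) = \<zero>\<^bsub>B\<^esub>)"

text \<open>
  The pair \<open>(A, s)\<close> is the universal C*-algebra generated by a relative Cuntz-Krieger family.
  The type \<^typ>\<open>'a\<close> plays the role of a universe: the algebras \<open>B\<close> against which universality is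
  tested are all those with carrier contained in \<^typ>\<open>'a\<close>. This is universality with respect to all
  C*-algebras as soon as \<^typ>\<open>'a\<close> has at least continuum many elements, because a C*-algebra
  generated by a countable family has at most that many; on smaller types only the zero
  algebra exists.
\<close>

definition universal_CK_algebra ::
    "('p, 'k::finite) kgraph \<Rightarrow> 'p set set \<Rightarrow> 'a cstar \<Rightarrow> ('p \<Rightarrow> 'a) \<Rightarrow> bool" where
  "universal_CK_algebra \<Lambda> \<E> A s \<longleftrightarrow>
     cstar_algebra A \<and> rel_CK_family \<Lambda> \<E> A s \<and>
     cstar_generated A (s ` paths \<Lambda>) = carrier A \<and>
     (\<forall>(B :: 'a cstar) t. cstar_algebra B \<and> rel_CK_family \<Lambda> \<E> B t \<longrightarrow>
        (\<exists>!\<phi>. \<phi> \<in> cstar_hom A B \<and> (\<forall>\<mu>\<in>paths \<Lambda>. \<phi> (s \<mu>) = t \<mu>)))"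

text \<open>The homomorphism \<open>\<pi>\<^sub>t\<close> from \<open>(A, s)\<close> to \<open>B\<close>.\<close>

definition CK_hom ::
    "('p, 'k::finite) kgraph \<Rightarrow> 'a cstar \<Rightarrow> ('p \<Rightarrow> 'a) \<Rightarrow> 'b cstar \<Rightarrow> ('p \<Rightarrow> 'b) \<Rightarrow> 'a \<Rightarrow> 'b" where
  "CK_hom \<Lambda> A s B t = (THE \<phi>. \<phi> \<in> cstar_hom A B \<and> (\<forall>\<mu>\<in>paths \<Lambda>. \<phi> (s \<mu>) = t \<mu>))"

definition torus :: "('k::finite \<Rightarrow> complex) set" where
  "torus = {z. \<forall>i. cmod (z i) = 1}"

text \<open>
  The automorphism \<open>\<gamma>\<^sub>z\<close> is the unique homomorphism sending \<open>s \<mu>\<close> to \<open>z\<close> to the power \<open>deg \<Lambda> \<mu>\<close>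
  times \<open>s \<mu>\<close>.
\<close>

definition gauge_action ::
    "('p, 'k::finite) kgraph \<Rightarrow> 'a cstar \<Rightarrow> ('p \<Rightarrow> 'a) \<Rightarrow> ('k \<Rightarrow> complex) \<Rightarrow> 'a \<Rightarrow> 'a" where
  "gauge_action \<Lambda> A s z = CK_hom \<Lambda> A s A (\<lambda>\<mu>. (\<Prod>i\<in>UNIV. z i ^ deg \<Lambda> \<mu> i) \<odot>\<^bsub>A\<^esub> s \<mu>)"

definition core :: "('p, 'k::finite) kgraph \<Rightarrow> 'a cstar \<Rightarrow> ('p \<Rightarrow> 'a) \<Rightarrow> 'a cstar" where
  "core \<Lambda> A s = A\<lparr>carrier := {a \<in> carrier A. \<forall>z\<in>torus. gauge_action \<Lambda> A s z a = a}\<rparr>"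

definition Theta ::
    "('p, 'k::finite) kgraph \<Rightarrow> 'a cstar \<Rightarrow> ('p \<Rightarrow> 'a) \<Rightarrow> 'p set \<Rightarrow> 'p \<Rightarrow> 'p \<Rightarrow> 'a" where
  "Theta \<Lambda> B t E \<kappa> \<mu> = t \<kappa> \<otimes>\<^bsub>B\<^esub>
     prod_act B (\<lambda>\<nu>. t (src \<Lambda> \<kappa>) \<ominus>\<^bsub>B\<^esub> t \<nu> \<otimes>\<^bsub>B\<^esub> adj B (t \<nu>))
       {\<nu> \<in> paths_into \<Lambda> (src \<Lambda> \<kappa>). \<kappa> \<cdot>\<^bsub>\<Lambda>\<^esub> \<nu> \<in> Pi_closure \<Lambda> E - {\<kappa>}}
       (adj B (t \<mu>))"

end

theory Submission
  imports Defs
begin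

text \<open>
  For a finite set \<open>E\<close> of paths, the elements \<open>\<Theta>\<close> are matrix units. The closure property of \<open>\<Pi>E\<close> makes any two of
  its elements have their minimal common extensions in \<open>\<Pi>E\<close> again, so the product that defines \<open>\<Theta>\<close> removes
  every overlap between different elements (\<open>gap_star_t_gap\<close>, \<open>unit_mult\<close>). Conversely \<open>t\<^sub>\<kappa> t\<^sub>\<mu>\<^sup>*\<close> is the sum of
  the \<open>\<Theta>\<close> at the common tails of \<open>\<kappa>\<close> and \<open>\<mu>\<close> (\<open>generator_decomposition\<close>). This relation is
  triangular, so the \<open>\<Theta>\<close> for \<open>E\<close> span the same space as the \<open>t\<^sub>\<kappa> t\<^sub>\<mu>\<^sup>*\<close> with \<open>(\<kappa>, \<mu>)\<close> in \<open>Pi_pairs \<Lambda> E\<close>. As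
  \<open>\<Pi>E\<close> is finite (\<open>finite_Pi_closure\<close>), this space is a finite-dimensional C*-algebra, and it grows with \<open>E\<close>.

  The core is the closure of the union of these algebras. The elements \<open>s\<^sub>\<kappa> s\<^sub>\<mu>\<^sup>*\<close> span a dense subspace
  of the universal algebra, and an average over finitely many gauge automorphisms moves a linear combination
  into the span of those with \<open>deg \<Lambda> \<kappa> = deg \<Lambda> \<mu>\<close> without increasing its distance
  to a fixed point (\<open>fixed_eq_closure\<close>). Since there are countably many paths, the core is AF.

  A homomorphism is injective on the span of a system of matrix units if and only if it kills no nonzero unit,
  and then it is isometric there (\<open>hom_isometric_on_unit_span\<close>). If this holds for every \<open>E\<close>, the homomorphism
  \<open>\<pi>\<^sub>t\<close> is isometric on a dense subset of the core; being contractive, it is isometric on the core.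

  The averaging, the isometry on the finite-dimensional algebras and the passage to the closure all rest on
  the contractivity of star-homomorphisms (\<open>hom_contractive\<close>). Its proof writes a self-adjoint
  element \<open>a\<close> with \<open>\<parallel>a\<parallel> < 1\<close> as the real part of the unitary \<open>a + \<i> b\<close>, where \<open>b = sqrt (1 - a\<^sup>2)\<close>. This takes place
  in the unitisation, but \<open>1 - b\<close> lies in the algebra, as a norm limit of polynomials in \<open>a\<close>. A homomorphism
  preserves the algebraic relations between \<open>a\<close> and \<open>1 - b\<close>, so the image of \<open>a\<close> is again the real part of a unitary
  and has norm at most \<open>1\<close>.
\<close>

section \<open>Norm limits and closed subalgebras of a C*-algebra\<close>

lemma complex_ring_simps [simp]:
  "carrier complex_ring = UNIV" "add complex_ring = (+)" "mult complex_ring = (*)"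
  "zero complex_ring = 0" "one complex_ring = 1"
  by (simp_all add: complex_ring_def)

lemma cring_complex_ring: "cring complex_ring"
proof (rule cringI)
  show "abelian_group complex_ring"
    by (rule abelian_groupI) (auto simp: algebra_simps intro: exI[of _ "- x" for x])
  show "comm_monoid complex_ring"
    by (rule comm_monoidI) (auto simp: algebra_simps)
qed (auto simp: algebra_simps)

text \<open>
  Limits are taken along sequences in the carrier and refer to the norm directly; the lemma
  \<open>norm_limit_iff_limitin\<close> identifies them with limits in the metric topology of \<^const>\<open>cstar_dist\<close>.
\<close>

definition norm_limit :: "'a cstar \<Rightarrow> (nat \<Rightarrow> 'a) \<Rightarrow> 'a \<Rightarrow> bool" where
  "norm_limit A \<sigma> x \<longleftrightarrow> range \<sigma> \<subseteq> carrier A \<and> x \<in> carrier A \<and>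
     (\<lambda>n. nrm A (\<sigma> n \<ominus>\<^bsub>A\<^esub> x)) \<longlonglongrightarrow> 0"

definition norm_closed :: "'a cstar \<Rightarrow> 'a set \<Rightarrow> bool" where
  "norm_closed A S \<longleftrightarrow> S \<subseteq> carrier A \<and> (\<forall>\<sigma> x. range \<sigma> \<subseteq> S \<longrightarrow> norm_limit A \<sigma> x \<longrightarrow> x \<in> S)"

definition norm_closure :: "'a cstar \<Rightarrow> 'a set \<Rightarrow> 'a set" where
  "norm_closure A S = {x \<in> carrier A. \<forall>\<epsilon>>0. \<exists>y\<in>S. nrm A (y \<ominus>\<^bsub>A\<^esub> x) < \<epsilon>}"

definition star_subspace :: "'a cstar \<Rightarrow> 'a set \<Rightarrow> bool" where
  "star_subspace A S \<longleftrightarrow> S \<subseteq> carrier A \<and> \<zero>\<^bsub>A\<^esub> \<in> S \<and>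
     (\<forall>x\<in>S. \<forall>y\<in>S. x \<oplus>\<^bsub>A\<^esub> y \<in> S) \<and> (\<forall>c. \<forall>x\<in>S. c \<odot>\<^bsub>A\<^esub> x \<in> S) \<and> (\<forall>x\<in>S. adj A x \<in> S)"

definition mult_closed_set :: "'a cstar \<Rightarrow> 'a set \<Rightarrow> bool" where
  "mult_closed_set A S \<longleftrightarrow> (\<forall>x\<in>S. \<forall>y\<in>S. x \<otimes>\<^bsub>A\<^esub> y \<in> S)"

context cstar_algebra
begin

lemma closed [simp, intro]:
  "\<zero> \<in> carrier A"
  "\<lbrakk>x \<in> carrier A; y \<in> carrier A\<rbrakk> \<Longrightarrow> x \<oplus> y \<in> carrier A"
  "\<lbrakk>x \<in> carrier A; y \<in> carrier A\<rbrakk> \<Longrightarrow> x \<ominus> y \<in> carrier A"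
  "\<lbrakk>x \<in> carrier A; y \<in> carrier A\<rbrakk> \<Longrightarrow> x \<otimes> y \<in> carrier A"
  "x \<in> carrier A \<Longrightarrow> c \<odot> x \<in> carrier A"
  "x \<in> carrier A \<Longrightarrow> \<ominus> x \<in> carrier A"
  "x \<in> carrier A \<Longrightarrow> adj A x \<in> carrier A"
  using smult_closed[of c x] by (auto simp: mult_closed adj_closed)

lemma scale_simps:
  "x \<in> carrier A \<Longrightarrow> (a + b) \<odot> x = a \<odot> x \<oplus> b \<odot> x"
  "\<lbrakk>x \<in> carrier A; y \<in> carrier A\<rbrakk> \<Longrightarrow> a \<odot> (x \<oplus> y) = a \<odot> x \<oplus> a \<odot> y"
  "x \<in> carrier A \<Longrightarrow> a \<odot> (b \<odot> x) = (a * b) \<odot> x"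
  using smult_l_distr[of a b x] smult_r_distr[of a x y] smult_assoc1[of a b x] by auto

lemma scale_triv [simp]:
  "x \<in> carrier A \<Longrightarrow> 1 \<odot> x = x" "x \<in> carrier A \<Longrightarrow> 0 \<odot> x = \<zero>" "a \<odot> \<zero> = \<zero>"
  using smult_one[of x] smult_l_null[of x] smult_r_null[of a] by auto

lemma neg_eq_scale: "x \<in> carrier A \<Longrightarrow> \<ominus> x = (-1) \<odot> x"
proof -
  assume x: "x \<in> carrier A"
  have "(-1) \<odot> x \<oplus> x = (-1 + 1) \<odot> x" using x by (subst scale_simps) auto
  then show ?thesis using x by (intro M.minus_equality) auto
qed

lemma minus_eq_scale: "\<lbrakk>x \<in> carrier A; y \<in> carrier A\<rbrakk> \<Longrightarrow> x \<ominus> y = x \<oplus> (-1) \<odot> y"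
  by (simp add: a_minus_def neg_eq_scale)

lemma mult_zero [simp]:
  "x \<in> carrier A \<Longrightarrow> x \<otimes> \<zero> = \<zero>" "x \<in> carrier A \<Longrightarrow> \<zero> \<otimes> x = \<zero>"
  using smult_mult_right[of x "\<zero>" 0] smult_mult_left[of "\<zero>" x 0] by auto

lemma add_cancel_mid:
  "\<lbrakk>x \<in> carrier A; y \<in> carrier A\<rbrakk> \<Longrightarrow> x \<oplus> (-1) \<odot> y = \<zero> \<longleftrightarrow> x = y"
  by (metis M.minus_equality M.minus_minus M.r_neg closed(5) neg_eq_scale)

lemma minus_self [simp]: "x \<in> carrier A \<Longrightarrow> x \<ominus> x = \<zero>"
  by (simp add: a_minus_def M.r_neg)

lemma minus_eq_zero_iff: "\<lbrakk>x \<in> carrier A; y \<in> carrier A\<rbrakk> \<Longrightarrow> x \<ominus> y = \<zero> \<longleftrightarrow> x = y"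
  by (simp add: minus_eq_scale add_cancel_mid)

lemma minus_zero [simp]: "x \<in> carrier A \<Longrightarrow> x \<ominus> \<zero> = x"
  by (simp add: minus_eq_scale)

lemma minus_add_cancel: "\<lbrakk>x \<in> carrier A; y \<in> carrier A; z \<in> carrier A\<rbrakk> \<Longrightarrow>
   x \<ominus> z = (x \<ominus> y) \<oplus> (y \<ominus> z)"
  by (simp add: a_minus_def M.a_ac) (metis M.a_assoc M.a_comm M.a_inv_closed M.r_neg M.r_zero)

lemma minus_distrib:
  "\<lbrakk>x \<in> carrier A; y \<in> carrier A; z \<in> carrier A\<rbrakk> \<Longrightarrow> x \<otimes> (y \<ominus> z) = x \<otimes> y \<ominus> x \<otimes> z"
  "\<lbrakk>x \<in> carrier A; y \<in> carrier A; z \<in> carrier A\<rbrakk> \<Longrightarrow> (x \<ominus> y) \<otimes> z = x \<otimes> z \<ominus> y \<otimes> z"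
  by (simp_all add: minus_eq_scale distrib_left distrib_right smult_mult_left smult_mult_right)

lemma scale_minus:
  "\<lbrakk>x \<in> carrier A; y \<in> carrier A\<rbrakk> \<Longrightarrow> c \<odot> (x \<ominus> y) = c \<odot> x \<ominus> c \<odot> y"
  by (simp add: minus_eq_scale scale_simps)

lemma adj_zero [simp]: "adj A \<zero> = \<zero>"
  using adj_smult[of "\<zero>" 0] by simp

lemma adj_minus: "\<lbrakk>x \<in> carrier A; y \<in> carrier A\<rbrakk> \<Longrightarrow> adj A (x \<ominus> y) = adj A x \<ominus> adj A y"
  by (simp add: minus_eq_scale adj_add adj_smult)

lemma minus_add_add:
  "\<lbrakk>x \<in> carrier A; y \<in> carrier A; z \<in> carrier A; w \<in> carrier A\<rbrakk> \<Longrightarrow>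
     (x \<oplus> y) \<ominus> (z \<oplus> w) = (x \<ominus> z) \<oplus> (y \<ominus> w)"
  by (simp add: minus_eq_scale scale_simps M.a_ac)

lemma minus_flip: "\<lbrakk>x \<in> carrier A; y \<in> carrier A\<rbrakk> \<Longrightarrow> x \<ominus> y = (-1) \<odot> (y \<ominus> x)"
  by (simp add: minus_eq_scale scale_simps M.a_ac)

lemma nrm_zero [simp]: "nrm A \<zero> = 0" by (simp add: nrm_eq_0)

lemma nrm_minus_commute: "\<lbrakk>x \<in> carrier A; y \<in> carrier A\<rbrakk> \<Longrightarrow> nrm A (x \<ominus> y) = nrm A (y \<ominus> x)"
  by (subst minus_flip) (auto simp: nrm_smult)

lemma nrm_triangle: "\<lbrakk>x \<in> carrier A; y \<in> carrier A; z \<in> carrier A\<rbrakk> \<Longrightarrow>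
   nrm A (x \<ominus> z) \<le> nrm A (x \<ominus> y) + nrm A (y \<ominus> z)"
  by (subst minus_add_cancel[of x y z]) (auto intro: nrm_add)

lemma nrm_triangle': "\<lbrakk>x \<in> carrier A; y \<in> carrier A\<rbrakk> \<Longrightarrow> nrm A x \<le> nrm A y + nrm A (y \<ominus> x)"
  using nrm_triangle[of x y "\<zero>"] by (simp add: nrm_minus_commute)

text \<open>
  By the C*-identity \<open>\<parallel>x\<parallel>\<^sup>2 = \<parallel>x\<^sup>* x\<parallel> \<le> \<parallel>x\<^sup>*\<parallel> \<parallel>x\<parallel>\<close>, and \<open>\<parallel>x\<parallel>\<close> cancels.
\<close>

lemma nrm_adj_le: assumes x: "x \<in> carrier A" shows "nrm A x \<le> nrm A (adj A x)"
proof (cases "nrm A x = 0")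
  case True then show ?thesis using x by (simp add: nrm_nonneg)
next
  case False
  have "nrm A x * nrm A x \<le> nrm A (adj A x) * nrm A x"
    using cstar_identity[OF x] nrm_mult[of "adj A x" x] x by (simp add: power2_eq_square)
  then show ?thesis using False nrm_nonneg[OF x] by (simp add: mult_le_cancel_right)
qed

lemma nrm_adj: "x \<in> carrier A \<Longrightarrow> nrm A (adj A x) = nrm A x"
  using nrm_adj_le[of x] nrm_adj_le[of "adj A x"] by (simp add: adj_adj)

lemma metric_space: "Metric_space (carrier A) (cstar_dist A)"
proof
  fix x y z
  show "0 \<le> cstar_dist A x y" by (simp add: cstar_dist_def nrm_nonneg)
  show "cstar_dist A x y = cstar_dist A y x" by (simp add: cstar_dist_def nrm_minus_commute)
  assume xyz: "x \<in> carrier A" "y \<in> carrier A"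
  show "(cstar_dist A x y = 0) = (x = y)"
    using xyz by (simp add: cstar_dist_def nrm_eq_0 minus_eq_zero_iff)
  assume "z \<in> carrier A"
  then show "cstar_dist A x z \<le> cstar_dist A x y + cstar_dist A y z"
    using xyz by (simp add: cstar_dist_def nrm_triangle)
qed

lemma norm_limit_iff_limitin:
  assumes "range \<sigma> \<subseteq> carrier A"
  shows "norm_limit A \<sigma> x \<longleftrightarrow>
    limitin (Metric_space.mtopology (carrier A) (cstar_dist A)) \<sigma> x sequentially"
proof -
  have "\<sigma> n \<in> carrier A" for n using assms by auto
  then show ?thesis
    using assms
    by (auto simp: Metric_space.limitin_metric_dist_null[OF metric_space] norm_limit_def cstar_dist_def)
qed

lemma Cauchy_norm_limit:
  assumes \<sigma>: "range \<sigma> \<subseteq> carrier A"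
    and "\<And>\<epsilon>. \<epsilon> > 0 \<Longrightarrow> \<exists>N. \<forall>m\<ge>N. \<forall>n\<ge>N. nrm A (\<sigma> m \<ominus> \<sigma> n) < \<epsilon>"
  shows "\<exists>x. norm_limit A \<sigma> x"
proof -
  have "\<sigma> n \<in> carrier A" for n using \<sigma> by auto
  then have "Metric_space.MCauchy (carrier A) (cstar_dist A) \<sigma>"
    unfolding Metric_space.MCauchy_def[OF metric_space]
    using assms by (simp add: cstar_dist_def)
  then have "\<exists>x. limitin (Metric_space.mtopology (carrier A) (cstar_dist A)) \<sigma> x sequentially"
    using complete unfolding Metric_space.mcomplete_def[OF metric_space] by blast
  then show ?thesis using norm_limit_iff_limitin[OF \<sigma>] by blast
qed

lemma norm_limitD:
  assumes "norm_limit A \<sigma> x"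
  shows "\<sigma> n \<in> carrier A" "x \<in> carrier A" "(\<lambda>n. nrm A (\<sigma> n \<ominus> x)) \<longlonglongrightarrow> 0"
  using assms by (auto simp: norm_limit_def)

lemma norm_limitI_bound:
  assumes "\<And>n. \<sigma> n \<in> carrier A" "x \<in> carrier A" "\<And>n. nrm A (\<sigma> n \<ominus> x) \<le> g n" "g \<longlonglongrightarrow> 0"
  shows "norm_limit A \<sigma> x"
  unfolding norm_limit_def
proof (intro conjI)
  show "(\<lambda>n. nrm A (\<sigma> n \<ominus> x)) \<longlonglongrightarrow> 0"
    by (rule tendsto_sandwich[OF _ _ tendsto_const assms(4)])
       (auto simp: assms nrm_nonneg)
qed (use assms in auto)

lemma norm_limit_nrm: assumes "norm_limit A \<sigma> x" shows "(\<lambda>n. nrm A (\<sigma> n)) \<longlonglongrightarrow> nrm A x"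
proof -
  note [simp] = norm_limitD[OF assms]
  have "(\<lambda>n. nrm A (\<sigma> n) - nrm A x) \<longlonglongrightarrow> 0"
  proof (rule Lim_null_comparison[OF _ norm_limitD(3)[OF assms]], intro always_eventually allI)
    fix n
    show "norm (nrm A (\<sigma> n) - nrm A x) \<le> nrm A (\<sigma> n \<ominus> x)"
      using nrm_triangle'[of "\<sigma> n" x] nrm_triangle'[of x "\<sigma> n"]
      by (simp add: nrm_minus_commute abs_le_iff)
  qed
  then show ?thesis by (simp add: LIM_zero_iff)
qed

lemma norm_limit_const: "x \<in> carrier A \<Longrightarrow> norm_limit A (\<lambda>_. x) x"
  by (auto simp: norm_limit_def)

lemma norm_limit_Suc: assumes "norm_limit A \<sigma> x" shows "norm_limit A (\<lambda>n. \<sigma> (Suc n)) x"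
  using norm_limitD[OF assms] LIMSEQ_Suc[OF norm_limitD(3)[OF assms]]
  by (auto simp: norm_limit_def)

lemma norm_limit_unique: assumes "norm_limit A \<sigma> x" "norm_limit A \<sigma> y" shows "x = y"
proof -
  note [simp] = norm_limitD[OF assms(1)] norm_limitD[OF assms(2)]
  have "(\<lambda>n. nrm A (\<sigma> n \<ominus> x) + nrm A (\<sigma> n \<ominus> y)) \<longlonglongrightarrow> 0 + 0"
    by (intro tendsto_add) simp_all
  moreover have "nrm A (x \<ominus> y) \<le> nrm A (\<sigma> n \<ominus> x) + nrm A (\<sigma> n \<ominus> y)" for n
    using nrm_triangle[of x "\<sigma> n" y] by (simp add: nrm_minus_commute)
  ultimately have "nrm A (x \<ominus> y) \<le> 0" by (intro LIMSEQ_le_const) auto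
  then show ?thesis using nrm_nonneg[of "x \<ominus> y"] nrm_eq_0[of "x \<ominus> y"] by (simp add: minus_eq_zero_iff)
qed

lemma norm_limit_add: assumes "norm_limit A \<sigma> x" "norm_limit A \<tau> y"
  shows "norm_limit A (\<lambda>n. \<sigma> n \<oplus> \<tau> n) (x \<oplus> y)"
proof (rule norm_limitI_bound)
  note [simp] = norm_limitD[OF assms(1)] norm_limitD[OF assms(2)]
  show "(\<lambda>n. nrm A (\<sigma> n \<ominus> x) + nrm A (\<tau> n \<ominus> y)) \<longlonglongrightarrow> 0"
    using tendsto_add[OF norm_limitD(3)[OF assms(1)] norm_limitD(3)[OF assms(2)]] by simp
  show "nrm A (\<sigma> n \<oplus> \<tau> n \<ominus> (x \<oplus> y)) \<le> nrm A (\<sigma> n \<ominus> x) + nrm A (\<tau> n \<ominus> y)" for n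
    by (simp add: minus_add_add nrm_add)
qed (use norm_limitD[OF assms(1)] norm_limitD[OF assms(2)] in auto)

lemma norm_limit_smult: assumes "norm_limit A \<sigma> x"
  shows "norm_limit A (\<lambda>n. c \<odot> \<sigma> n) (c \<odot> x)"
proof (rule norm_limitI_bound)
  note [simp] = norm_limitD[OF assms(1)]
  show "(\<lambda>n. cmod c * nrm A (\<sigma> n \<ominus> x)) \<longlonglongrightarrow> 0"
    using tendsto_mult_left[OF norm_limitD(3)[OF assms(1)], of "cmod c"] by simp
  show "nrm A (c \<odot> \<sigma> n \<ominus> c \<odot> x) \<le> cmod c * nrm A (\<sigma> n \<ominus> x)" for n
    by (simp add: scale_minus[symmetric] nrm_smult)
qed (use norm_limitD[OF assms(1)] in auto)

lemma norm_limit_adj: assumes "norm_limit A \<sigma> x"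
  shows "norm_limit A (\<lambda>n. adj A (\<sigma> n)) (adj A x)"
proof (rule norm_limitI_bound[OF _ _ _ norm_limitD(3)[OF assms(1)]])
  note [simp] = norm_limitD[OF assms(1)]
  show "nrm A (adj A (\<sigma> n) \<ominus> adj A x) \<le> nrm A (\<sigma> n \<ominus> x)" for n
    by (simp add: adj_minus[symmetric] nrm_adj)
qed (use norm_limitD[OF assms(1)] in auto)

lemma norm_limit_mult: assumes "norm_limit A \<sigma> x" "norm_limit A \<tau> y"
  shows "norm_limit A (\<lambda>n. \<sigma> n \<otimes> \<tau> n) (x \<otimes> y)"
proof (rule norm_limitI_bound)
  note [simp] = norm_limitD[OF assms(1)] norm_limitD[OF assms(2)]
  let ?g = "\<lambda>n. nrm A (\<sigma> n) * nrm A (\<tau> n \<ominus> y) + nrm A (\<sigma> n \<ominus> x) * nrm A y"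
  have "?g \<longlonglongrightarrow> nrm A x * 0 + 0 * nrm A y"
    by (intro tendsto_intros norm_limit_nrm[OF assms(1)]) simp_all
  then show "?g \<longlonglongrightarrow> 0" by simp
  show "nrm A (\<sigma> n \<otimes> \<tau> n \<ominus> x \<otimes> y) \<le> ?g n" for n
  proof -
    have "\<sigma> n \<otimes> \<tau> n \<ominus> x \<otimes> y = \<sigma> n \<otimes> (\<tau> n \<ominus> y) \<oplus> (\<sigma> n \<ominus> x) \<otimes> y"
      by (simp add: minus_distrib minus_add_cancel[symmetric])
    also have "nrm A \<dots> \<le> nrm A (\<sigma> n \<otimes> (\<tau> n \<ominus> y)) + nrm A ((\<sigma> n \<ominus> x) \<otimes> y)"
      by (rule nrm_add) auto
    also have "\<dots> \<le> ?g n" by (intro add_mono nrm_mult) auto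
    finally show ?thesis .
  qed
qed (use norm_limitD[OF assms(1)] norm_limitD[OF assms(2)] in auto)

lemma norm_closureD: "x \<in> norm_closure A S \<Longrightarrow> x \<in> carrier A"
  by (simp add: norm_closure_def)

lemma norm_closure_limit:
  assumes S: "S \<subseteq> carrier A" and x: "x \<in> norm_closure A S"
  shows "\<exists>\<sigma>. range \<sigma> \<subseteq> S \<and> norm_limit A \<sigma> x"
proof -
  have "\<forall>n. \<exists>y\<in>S. nrm A (y \<ominus> x) < inverse (real (Suc n))"
    using x by (auto simp: norm_closure_def)
  then obtain \<sigma> where \<sigma>: "\<And>n. \<sigma> n \<in> S" "\<And>n. nrm A (\<sigma> n \<ominus> x) < inverse (real (Suc n))" by metis
  have "norm_limit A \<sigma> x"
    by (rule norm_limitI_bound[OF _ _ _ LIMSEQ_inverse_real_of_nat])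
       (use \<sigma> S x in \<open>auto simp: norm_closureD less_imp_le\<close>)
  then show ?thesis using \<sigma> by (intro exI[of _ \<sigma>]) auto
qed

lemma norm_limit_in_closure:
  assumes "range \<sigma> \<subseteq> S" "norm_limit A \<sigma> x"
  shows "x \<in> norm_closure A S"
  unfolding norm_closure_def
proof (intro CollectI conjI allI impI)
  fix \<epsilon> :: real assume "\<epsilon> > 0"
  then have "eventually (\<lambda>n. nrm A (\<sigma> n \<ominus> x) < \<epsilon>) sequentially"
    using norm_limitD(3)[OF assms(2)] by (simp add: order_tendstoD)
  then obtain n where "nrm A (\<sigma> n \<ominus> x) < \<epsilon>" by (auto simp: eventually_sequentially)
  then show "\<exists>y\<in>S. nrm A (y \<ominus> x) < \<epsilon>" using assms by auto
qed (use norm_limitD[OF assms(2)] in auto)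

lemma norm_closure_subset: "S \<subseteq> carrier A \<Longrightarrow> S \<subseteq> norm_closure A S"
  using norm_limit_in_closure[of "\<lambda>_. x" S x for x] norm_limit_const by blast

lemma norm_closed_norm_closure:
  assumes S: "S \<subseteq> carrier A" shows "norm_closed A (norm_closure A S)"
  unfolding norm_closed_def
proof (intro conjI allI impI)
  fix \<sigma> x assume \<sigma>: "range \<sigma> \<subseteq> norm_closure A S" "norm_limit A \<sigma> x"
  show "x \<in> norm_closure A S"
    unfolding norm_closure_def
  proof (intro CollectI conjI allI impI)
    fix \<epsilon> :: real assume e: "\<epsilon> > 0"
    then have "\<epsilon> / 2 > 0" by simp
    then have "eventually (\<lambda>n. nrm A (\<sigma> n \<ominus> x) < \<epsilon> / 2) sequentially"
      using norm_limitD(3)[OF \<sigma>(2)] by (rule order_tendstoD(2)[rotated])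
    then obtain n where n: "nrm A (\<sigma> n \<ominus> x) < \<epsilon> / 2" by (auto simp: eventually_sequentially)
    have "\<sigma> n \<in> norm_closure A S" using \<sigma> by auto
    then obtain y where y: "y \<in> S" "nrm A (y \<ominus> \<sigma> n) < \<epsilon> / 2"
      using e by (auto simp: norm_closure_def dest!: spec[of _ "\<epsilon> / 2"])
    then have "nrm A (y \<ominus> x) < \<epsilon>"
      using n nrm_triangle[of y "\<sigma> n" x] norm_limitD[OF \<sigma>(2)] S by fastforce
    then show "\<exists>y\<in>S. nrm A (y \<ominus> x) < \<epsilon>" using y by auto
  qed (use norm_limitD[OF \<sigma>(2)] in auto)
qed (auto simp: norm_closure_def)

lemma star_subspaceD:
  assumes "star_subspace A S"
  shows "S \<subseteq> carrier A" "\<zero> \<in> S" "\<lbrakk>x \<in> S; y \<in> S\<rbrakk> \<Longrightarrow> x \<oplus> y \<in> S" "x \<in> S \<Longrightarrow> c \<odot> x \<in> S"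
    "x \<in> S \<Longrightarrow> adj A x \<in> S"
  using assms unfolding star_subspace_def by blast+

lemma star_subspace_minus: "\<lbrakk>star_subspace A S; x \<in> S; y \<in> S\<rbrakk> \<Longrightarrow> x \<ominus> y \<in> S"
  using star_subspaceD[of S] by (auto simp: minus_eq_scale subset_iff)

lemma star_subspace_closure:
  assumes "star_subspace A S" shows "star_subspace A (norm_closure A S)"
proof -
  note S = star_subspaceD[OF assms]
  have add: "x \<oplus> y \<in> norm_closure A S" if "x \<in> norm_closure A S" "y \<in> norm_closure A S" for x y
  proof -
    obtain \<sigma> \<tau> where "range \<sigma> \<subseteq> S" "norm_limit A \<sigma> x" "range \<tau> \<subseteq> S" "norm_limit A \<tau> y"
      using norm_closure_limit[OF S(1)] \<open>x \<in> _\<close> \<open>y \<in> _\<close> by meson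
    then show ?thesis
      using S(3) by (intro norm_limit_in_closure[OF _ norm_limit_add[of \<sigma> x \<tau> y]]) (auto simp: subset_iff)
  qed
  have scale: "c \<odot> x \<in> norm_closure A S" "adj A x \<in> norm_closure A S" if "x \<in> norm_closure A S" for x c
  proof -
    obtain \<sigma> where "range \<sigma> \<subseteq> S" "norm_limit A \<sigma> x"
      using norm_closure_limit[OF S(1)] \<open>x \<in> _\<close> by meson
    then show "c \<odot> x \<in> norm_closure A S" "adj A x \<in> norm_closure A S"
      using S(4,5) norm_limit_in_closure[OF _ norm_limit_smult[of \<sigma> x c], of S]
        norm_limit_in_closure[OF _ norm_limit_adj[of \<sigma> x], of S] by (auto simp: subset_iff)
  qed
  show ?thesis unfolding star_subspace_def
    using add scale S(2) norm_closure_subset[OF S(1)] by (auto dest: norm_closureD)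
qed

lemma mult_closed_closure:
  assumes "star_subspace A S" "mult_closed_set A S" shows "mult_closed_set A (norm_closure A S)"
  unfolding mult_closed_set_def
proof (intro ballI)
  note S = star_subspaceD[OF assms(1)]
  fix x y assume xy: "x \<in> norm_closure A S" "y \<in> norm_closure A S"
  obtain \<sigma> \<tau> where "range \<sigma> \<subseteq> S" "norm_limit A \<sigma> x" "range \<tau> \<subseteq> S" "norm_limit A \<tau> y"
    using norm_closure_limit[OF S(1)] xy by meson
  then show "x \<otimes> y \<in> norm_closure A S"
    using assms(2) by (intro norm_limit_in_closure[OF _ norm_limit_mult[of \<sigma> x \<tau> y]])
      (auto simp: subset_iff mult_closed_set_def)
qed

text \<open>
  The record operation \<open>\<ominus>\<close> is a description over the carrier, so its value in a subalgebra has to be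
  compared with its value in \<open>A\<close>.
\<close>

lemma sub_a_inv:
  assumes S: "star_subspace A S" and x: "x \<in> S"
  shows "\<ominus>\<^bsub>A\<lparr>carrier := S\<rparr>\<^esub> x = \<ominus> x"
proof -
  have xA: "x \<in> carrier A" using x star_subspaceD(1)[OF S] by auto
  have "\<ominus>\<^bsub>A\<lparr>carrier := S\<rparr>\<^esub> x = (THE y. y \<in> S \<and> x \<oplus> y = \<zero> \<and> y \<oplus> x = \<zero>)"
    by (simp add: a_inv_def m_inv_def)
  also have "\<dots> = \<ominus> x"
  proof (rule the_equality)
    show "\<ominus> x \<in> S \<and> x \<oplus> \<ominus> x = \<zero> \<and> \<ominus> x \<oplus> x = \<zero>"
      using x xA star_subspaceD(4)[OF S x, of "-1"] by (simp add: neg_eq_scale[symmetric] M.r_neg M.l_neg)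
    show "y = \<ominus> x" if "y \<in> S \<and> x \<oplus> y = \<zero> \<and> y \<oplus> x = \<zero>" for y
      using that xA star_subspaceD(1)[OF S] by (metis M.minus_equality subset_iff)
  qed
  finally show ?thesis .
qed

lemma sub_minus:
  assumes S: "star_subspace A S" and x: "x \<in> S" "y \<in> S"
  shows "x \<ominus>\<^bsub>A\<lparr>carrier := S\<rparr>\<^esub> y = x \<ominus> y"
  using sub_a_inv[OF S] x by (simp add: a_minus_def)

text \<open>
  The algebraic axioms are inherited by any subset closed under the operations; completeness is
  inherited because a Cauchy sequence of the subset converges in the whole algebra.
\<close>

theorem closed_star_subalgebra:
  assumes S: "star_subspace A S" and m: "mult_closed_set A S" and cl: "norm_closed A S"
  shows "cstar_subalgebra S A"
proof -
  note SD = star_subspaceD[OF S]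
  have inC [simp]: "x \<in> carrier A" if "x \<in> S" for x using SD(1) that by auto
  have ag: "abelian_group (A\<lparr>carrier := S\<rparr>)"
  proof (rule abelian_groupI; simp)
    fix x assume "x \<in> S"
    then show "\<exists>y\<in>S. y \<oplus> x = \<zero>"
      using SD(4)[of x "-1"] by (intro bexI[of _ "(-1) \<odot> x"]) (auto simp: neg_eq_scale[symmetric] M.l_neg)
  qed (use SD in \<open>auto simp: M.a_ac\<close>)
  have mod: "module complex_ring (A\<lparr>carrier := S\<rparr>)"
    by (rule moduleI[OF cring_complex_ring ag]) (use SD in \<open>auto simp: scale_simps\<close>)
  have dist: "cstar_dist (A\<lparr>carrier := S\<rparr>) x y = (if x \<in> S \<and> y \<in> S then nrm A (x \<ominus> y) else 0)" for x y
    by (auto simp: cstar_dist_def sub_minus[OF S])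
  have ms: "Metric_space S (cstar_dist (A\<lparr>carrier := S\<rparr>))"
  proof
    fix x y z
    show "0 \<le> cstar_dist (A\<lparr>carrier := S\<rparr>) x y" by (simp add: dist nrm_nonneg)
    show "cstar_dist (A\<lparr>carrier := S\<rparr>) x y = cstar_dist (A\<lparr>carrier := S\<rparr>) y x"
      by (auto simp add: dist nrm_minus_commute)
    assume xyz: "x \<in> S" "y \<in> S"
    show "(cstar_dist (A\<lparr>carrier := S\<rparr>) x y = 0) = (x = y)"
      using xyz by (simp add: dist nrm_eq_0 minus_eq_zero_iff)
    assume "z \<in> S"
    then show "cstar_dist (A\<lparr>carrier := S\<rparr>) x z \<le> cstar_dist (A\<lparr>carrier := S\<rparr>) x y + cstar_dist (A\<lparr>carrier := S\<rparr>) y z"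
      using xyz by (simp add: dist nrm_triangle)
  qed
  have comp: "Metric_space.mcomplete S (cstar_dist (A\<lparr>carrier := S\<rparr>))"
    unfolding Metric_space.mcomplete_def[OF ms]
  proof (intro allI impI)
    fix \<sigma> assume "Metric_space.MCauchy S (cstar_dist (A\<lparr>carrier := S\<rparr>)) \<sigma>"
    then have \<sigma>: "range \<sigma> \<subseteq> S"
      and C: "\<And>\<epsilon>. \<epsilon> > 0 \<Longrightarrow> \<exists>N. \<forall>n n'. N \<le> n \<longrightarrow> N \<le> n' \<longrightarrow> cstar_dist (A\<lparr>carrier := S\<rparr>) (\<sigma> n) (\<sigma> n') < \<epsilon>"
      unfolding Metric_space.MCauchy_def[OF ms] by auto
    have \<sigma>S: "\<sigma> n \<in> S" for n using \<sigma> by auto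
    have "\<exists>x. norm_limit A \<sigma> x"
      by (rule Cauchy_norm_limit) (use \<sigma>S C in \<open>auto simp: dist\<close>)
    then obtain x where x: "norm_limit A \<sigma> x" by blast
    then have "x \<in> S" using cl \<sigma> unfolding norm_closed_def by blast
    then show "\<exists>x. limitin (Metric_space.mtopology S (cstar_dist (A\<lparr>carrier := S\<rparr>))) \<sigma> x sequentially"
      using norm_limitD(3)[OF x] \<sigma>S
      by (intro exI[of _ x]) (simp add: Metric_space.limitin_metric_dist_null[OF ms] dist)
  qed
  show ?thesis
    unfolding cstar_subalgebra_def
  proof (intro conjI)
    show "cstar_algebra (A\<lparr>carrier := S\<rparr>)"
      by (intro cstar_algebra.intro mod cstar_algebra_axioms.intro)
        (use SD m comp in \<open>auto simp: mult_closed_set_def mult_assoc distrib_left distrib_right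
          smult_mult_left smult_mult_right adj_adj adj_add adj_smult adj_mult nrm_nonneg nrm_eq_0
          nrm_add nrm_smult nrm_mult cstar_identity\<close>)
  qed (rule SD)
qed

end

context cstar_algebra
begin

lemma finsum_smult: "\<lbrakk>finite X; f \<in> X \<rightarrow> carrier A\<rbrakk> \<Longrightarrow> c \<odot> (\<Oplus>i\<in>X. f i) = (\<Oplus>i\<in>X. c \<odot> f i)"
  by (induction X rule: finite_induct) (auto simp: scale_simps Pi_iff)

lemma finsum_mult_right: "\<lbrakk>finite X; f \<in> X \<rightarrow> carrier A; x \<in> carrier A\<rbrakk> \<Longrightarrow>
   (\<Oplus>i\<in>X. f i) \<otimes> x = (\<Oplus>i\<in>X. f i \<otimes> x)"
  by (induction X rule: finite_induct) (auto simp: distrib_right Pi_iff)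

lemma finsum_mult_left: "\<lbrakk>finite X; f \<in> X \<rightarrow> carrier A; x \<in> carrier A\<rbrakk> \<Longrightarrow>
   x \<otimes> (\<Oplus>i\<in>X. f i) = (\<Oplus>i\<in>X. x \<otimes> f i)"
  by (induction X rule: finite_induct) (auto simp: distrib_left Pi_iff)

lemma finsum_adj: "\<lbrakk>finite X; f \<in> X \<rightarrow> carrier A\<rbrakk> \<Longrightarrow> adj A (\<Oplus>i\<in>X. f i) = (\<Oplus>i\<in>X. adj A (f i))"
  by (induction X rule: finite_induct) (auto simp: adj_add Pi_iff)

lemma finsum_all_zero: "(\<And>i. i \<in> X \<Longrightarrow> f i = \<zero>) \<Longrightarrow> (\<Oplus>i\<in>X. f i) = \<zero>"
  by (rule add.finprod_one_eqI)

lemma finsum_single: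
  assumes "finite X" "i \<in> X" "f i \<in> carrier A" "\<And>j. \<lbrakk>j \<in> X; j \<noteq> i\<rbrakk> \<Longrightarrow> f j = \<zero>"
  shows "(\<Oplus>j\<in>X. f j) = f i"
proof -
  have "X = insert i (X - {i})" using assms by auto
  then have "(\<Oplus>j\<in>X. f j) = (\<Oplus>j\<in>insert i (X - {i}). f j)" by simp
  also have "\<dots> = f i \<oplus> (\<Oplus>j\<in>X - {i}. f j)" using assms by (subst M.finsum_insert) auto
  also have "(\<Oplus>j\<in>X - {i}. f j) = \<zero>" using assms by (intro finsum_all_zero) auto
  finally show ?thesis using assms by simp
qed

lemma norm_limit_finsum:
  assumes "finite X" "\<And>i. i \<in> X \<Longrightarrow> norm_limit A (\<lambda>n. \<sigma> n i) (x i)"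
  shows "norm_limit A (\<lambda>n. \<Oplus>i\<in>X. \<sigma> n i) (\<Oplus>i\<in>X. x i)"
  using assms
proof (induction X rule: finite_induct)
  case empty then show ?case by (simp add: norm_limit_const)
next
  case (insert i X)
  then have "norm_limit A (\<lambda>n. \<sigma> n i \<oplus> (\<Oplus>i\<in>X. \<sigma> n i)) (x i \<oplus> (\<Oplus>i\<in>X. x i))"
    by (intro norm_limit_add) auto
  moreover have "\<sigma> n j \<in> carrier A" "x j \<in> carrier A" if "j \<in> insert i X" for n j
    using norm_limitD[OF insert.prems[OF that]] by auto
  ultimately show ?case using insert.hyps by (simp add: Pi_iff)
qed

lemma star_subspace_finsum:
  assumes "star_subspace A S" "f \<in> X \<rightarrow> S"
  shows "(\<Oplus>i\<in>X. f i) \<in> S"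
  using assms(2)
proof (induction X rule: infinite_finite_induct)
  case (insert i X)
  then have "f i \<in> S" "f i \<in> carrier A" "f \<in> X \<rightarrow> carrier A" "f \<in> X \<rightarrow> S"
    using star_subspaceD(1)[OF assms(1)] by auto
  then show ?case using insert star_subspaceD(3)[OF assms(1)] by simp
qed (use star_subspaceD(2)[OF assms(1)] in auto)

text \<open>
  Likewise \<^const>\<open>finsum\<close> refers to the carrier, through the fold that defines it.
\<close>

lemma sub_finsum:
  assumes S: "star_subspace A S" "cstar_subalgebra S A" "f \<in> X \<rightarrow> S"
  shows "finsum (A\<lparr>carrier := S\<rparr>) f X = (\<Oplus>i\<in>X. f i)"
proof -
  interpret S: cstar_algebra "A\<lparr>carrier := S\<rparr>" using assms by (simp add: cstar_subalgebra_def)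
  show ?thesis using assms(3)
  proof (induction X rule: infinite_finite_induct)
    case (infinite X)
    then show ?case using S.M.finsum_infinite[OF infinite(1)] M.finsum_infinite[OF infinite(1)] by simp
  next
    case empty
    then show ?case using S.M.finsum_empty by simp
  next
    case (insert i X)
    then have i: "f i \<in> S" "f i \<in> carrier A" "f \<in> X \<rightarrow> carrier A" "f \<in> X \<rightarrow> S"
      using star_subspaceD(1)[OF assms(1)] by auto
    then show ?case using insert S.M.finsum_insert[of X i f] by simp
  qed
qed

section \<open>Star-homomorphisms are contractive\<close>

text \<open>
  The element \<open>e\<close> is \<open>1 - sqrt (1 - a\<^sup>2)\<close>, written without a unit: it is the fixed point
  \<open>e = (a\<^sup>2 + e\<^sup>2) / 2\<close>. On the ball of radius \<open>nrm A a < 1\<close> the right-hand side is a contraction, and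
  self-adjointness and commutation with \<open>a\<close> pass from the iterates to the limit.
\<close>

lemma exists_one_minus_sqrt:
  assumes a: "a \<in> carrier A" "adj A a = a" "nrm A a < 1"
  shows "\<exists>e\<in>carrier A. adj A e = e \<and> a \<otimes> e = e \<otimes> a \<and> e \<oplus> e = a \<otimes> a \<oplus> e \<otimes> e"
proof -
  define r where "r = nrm A a"
  have r: "0 \<le> r" "r < 1" using a by (auto simp: r_def nrm_nonneg)
  define F where "F = (\<lambda>x. (1/2) \<odot> (a \<otimes> a \<oplus> x \<otimes> x))"
  define E where "E = rec_nat \<zero> (\<lambda>_. F)"
  have E0 [simp]: "E 0 = \<zero>" and ES: "E (Suc n) = F (E n)" for n by (auto simp: E_def)
  have Ec [simp]: "E n \<in> carrier A" for n by (induction n) (auto simp: ES F_def a)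
  have half: "cmod (1/2) = 1/2" by simp
  have En: "nrm A (E n) \<le> r" for n
  proof (induction n)
    case 0 then show ?case using r by simp
  next
    case (Suc n)
    have "nrm A (E (Suc n)) \<le> (1/2) * (nrm A a * nrm A a + nrm A (E n) * nrm A (E n))"
      unfolding ES F_def by (subst nrm_smult) (auto simp: a intro!: order_trans[OF nrm_add] add_mono nrm_mult)
    also have "\<dots> \<le> (1/2) * (r * r + r * r)"
      using Suc r by (intro mult_left_mono add_mono mult_mono) (auto simp: r_def nrm_nonneg)
    also have "\<dots> \<le> r" using r mult_left_mono[of r 1 r] by simp
    finally show ?case .
  qed
  have dif: "nrm A (E (Suc n) \<ominus> E n) \<le> r ^ n" for n
  proof (induction n)
    case 0 then show ?case using En[of 1] r by simp
  next
    case (Suc n)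
    let ?u = "E (Suc n)" and ?v = "E n"
    have "E (Suc (Suc n)) \<ominus> E (Suc n) = (1/2) \<odot> (?u \<otimes> ?u \<ominus> ?v \<otimes> ?v)"
      unfolding ES[of "Suc n"] ES[of n] F_def
      by (simp add: scale_minus[symmetric] minus_add_add a)
    also have "?u \<otimes> ?u \<ominus> ?v \<otimes> ?v = ?u \<otimes> (?u \<ominus> ?v) \<oplus> (?u \<ominus> ?v) \<otimes> ?v"
      by (simp add: minus_distrib minus_add_cancel[symmetric])
    finally have "nrm A (E (Suc (Suc n)) \<ominus> E (Suc n)) =
        (1/2) * nrm A (?u \<otimes> (?u \<ominus> ?v) \<oplus> (?u \<ominus> ?v) \<otimes> ?v)"
      by (simp add: nrm_smult)
    also have "\<dots> \<le> (1/2) * (nrm A ?u * nrm A (?u \<ominus> ?v) + nrm A (?u \<ominus> ?v) * nrm A ?v)"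
      by (intro mult_left_mono order_trans[OF nrm_add] add_mono nrm_mult) auto
    also have "\<dots> \<le> (1/2) * (r * nrm A (?u \<ominus> ?v) + nrm A (?u \<ominus> ?v) * r)"
      using En by (intro mult_left_mono add_mono mult_right_mono) (auto simp: nrm_nonneg)
    also have "\<dots> \<le> r * r ^ n" using Suc r by (simp add: mult_left_mono)
    finally show ?case by simp
  qed
  have far: "nrm A (E (n + k) \<ominus> E n) \<le> (r ^ n - r ^ (n + k)) / (1 - r)" for n k
  proof (induction k)
    case 0 then show ?case by simp
  next
    case (Suc k)
    have "nrm A (E (n + Suc k) \<ominus> E n) \<le> nrm A (E (n + Suc k) \<ominus> E (n + k)) + nrm A (E (n + k) \<ominus> E n)"
      by (rule nrm_triangle) auto
    also have "\<dots> \<le> r ^ (n + k) + (r ^ n - r ^ (n + k)) / (1 - r)"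
      using dif[of "n + k"] Suc by simp
    also have "\<dots> = (r ^ n - r ^ (n + Suc k)) / (1 - r)"
      using r by (simp add: field_simps)
    finally show ?case .
  qed
  have far': "nrm A (E (n + k) \<ominus> E n) \<le> r ^ n / (1 - r)" for n k
    by (rule order_trans[OF far]) (use r in \<open>auto intro!: divide_right_mono\<close>)
  have lim: "(\<lambda>n. r ^ n / (1 - r)) \<longlonglongrightarrow> 0"
    using tendsto_divide[OF LIMSEQ_realpow_zero[OF r] tendsto_const[of "1 - r"]] r by simp
  have "\<exists>e. norm_limit A E e"
  proof (rule Cauchy_norm_limit)
    fix \<epsilon> :: real assume "\<epsilon> > 0"
    then have "eventually (\<lambda>n. r ^ n / (1 - r) < \<epsilon>) sequentially"
      using lim by (rule order_tendstoD(2)[rotated])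
    then obtain N where N: "\<And>n. n \<ge> N \<Longrightarrow> r ^ n / (1 - r) < \<epsilon>" by (auto simp: eventually_sequentially)
    have "nrm A (E m \<ominus> E n) < \<epsilon>" if "m \<ge> N" "n \<ge> N" for m n
    proof (cases "n \<le> m")
      case True then show ?thesis using far'[of n "m - n"] N[OF that(2)] by simp
    next
      case False then show ?thesis using far'[of m "n - m"] N[OF that(1)] by (simp add: nrm_minus_commute)
    qed
    then show "\<exists>N. \<forall>m\<ge>N. \<forall>n\<ge>N. nrm A (E m \<ominus> E n) < \<epsilon>" by blast
  qed auto
  then obtain e where e: "norm_limit A E e" by blast
  then have ec [simp]: "e \<in> carrier A" by (rule norm_limitD)
  have "adj A (E n) = E n" for n
    by (induction n) (auto simp: ES F_def a adj_add adj_smult adj_mult)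
  then have sa: "adj A e = e" using norm_limit_unique[OF norm_limit_adj[OF e]] e by simp
  have comE: "a \<otimes> E n = E n \<otimes> a" for n
  proof (induction n)
    case (Suc n)
    have "a \<otimes> (E n \<otimes> E n) = E n \<otimes> E n \<otimes> a"
      using Suc by (metis Ec a(1) mult_assoc)
    then show ?case by (auto simp: ES F_def a distrib_left distrib_right smult_mult_left smult_mult_right mult_assoc)
  qed (simp add: a)
  have com: "a \<otimes> e = e \<otimes> a"
    using norm_limit_unique[OF norm_limit_mult[OF norm_limit_const e] , of a "e \<otimes> a"]
      norm_limit_mult[OF e norm_limit_const, of a] comE a by simp
  have "norm_limit A (\<lambda>n. E (Suc n)) (F e)"
    unfolding ES F_def
    by (intro norm_limit_smult norm_limit_add norm_limit_mult norm_limit_const e) (simp_all add: a)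
  then have "e = F e" using norm_limit_unique[OF norm_limit_Suc[OF e]] by blast
  then have "e \<oplus> e = F e \<oplus> F e" by simp
  also have "\<dots> = (1/2 + 1/2) \<odot> (a \<otimes> a \<oplus> e \<otimes> e)" unfolding F_def using a by (subst scale_simps) auto
  finally have "e \<oplus> e = a \<otimes> a \<oplus> e \<otimes> e" using a by simp
  then show ?thesis using sa com by auto
qed

text \<open>
  The hypotheses say that \<open>b + \<i> (1 - f)\<close> and \<open>b - \<i> (1 - f)\<close> are unitary in the unitisation. They
  therefore act isometrically on the algebra, and \<open>b\<close>, half their sum, acts contractively.
\<close>

lemma nrm_le_one_if_circle:
  assumes [simp]: "b \<in> carrier A" "f \<in> carrier A"
    and sa: "adj A b = b" "adj A f = f" and com: "b \<otimes> f = f \<otimes> b"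
    and circ: "f \<oplus> f = b \<otimes> b \<oplus> f \<otimes> f"
  shows "nrm A b \<le> 1"
proof -
  have act: "nrm A (b \<otimes> x \<oplus> c \<odot> (x \<ominus> f \<otimes> x)) = nrm A x"
    if x [simp]: "x \<in> carrier A" and c: "cnj c = - c" "cnj c * c = 1" for x c
  proof -
    define y where "y = b \<otimes> x"
    define z where "z = x \<ominus> f \<otimes> x"
    have [simp]: "y \<in> carrier A" "z \<in> carrier A" by (auto simp: y_def z_def)
    have yz: "adj A y \<otimes> z = adj A z \<otimes> y"
    proof -
      have "b \<otimes> (f \<otimes> x) = f \<otimes> (b \<otimes> x)" using com by (simp add: mult_assoc[symmetric])
      then show ?thesis
        by (simp add: y_def z_def adj_mult adj_minus sa minus_distrib mult_assoc)
    qed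
    \<comment> \<open>The four monomials in the expansion of \<open>y\<^sup>* y + z\<^sup>* z\<close>; the circle equation gives \<open>2 P = Q + R\<close>.\<close>
    define P where "P = adj A x \<otimes> (f \<otimes> x)"
    define Q where "Q = adj A x \<otimes> (b \<otimes> (b \<otimes> x))"
    define R where "R = adj A x \<otimes> (f \<otimes> (f \<otimes> x))"
    define X where "X = adj A x \<otimes> x"
    have [simp]: "P \<in> carrier A" "Q \<in> carrier A" "R \<in> carrier A" "X \<in> carrier A"
      by (auto simp: P_def Q_def R_def X_def)
    have PQR: "P \<oplus> P = Q \<oplus> R"
    proof -
      have "adj A x \<otimes> ((f \<oplus> f) \<otimes> x) = adj A x \<otimes> ((b \<otimes> b \<oplus> f \<otimes> f) \<otimes> x)" by (simp add: circ)
      then show ?thesis by (simp add: P_def Q_def R_def distrib_left distrib_right mult_assoc)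
    qed
    have "adj A z \<otimes> z = X \<ominus> P \<ominus> (P \<ominus> R)"
      by (simp add: z_def adj_minus adj_mult sa minus_distrib mult_assoc X_def P_def R_def)
    then have "adj A y \<otimes> y \<oplus> adj A z \<otimes> z = Q \<oplus> (X \<ominus> P \<ominus> (P \<ominus> R))"
      by (simp add: y_def Q_def adj_mult sa mult_assoc)
    also have "\<dots> = X \<oplus> ((Q \<oplus> R) \<oplus> (-1) \<odot> (P \<oplus> P))"
      by (simp add: minus_eq_scale scale_simps M.a_ac)
    also have "\<dots> = X" by (simp add: PQR[symmetric] minus_eq_scale[symmetric])
    finally have yyzz: "adj A y \<otimes> y \<oplus> adj A z \<otimes> z = X" .
    have "adj A (y \<oplus> c \<odot> z) \<otimes> (y \<oplus> c \<odot> z) =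
        (adj A y \<otimes> y \<oplus> (cnj c * c) \<odot> (adj A z \<otimes> z)) \<oplus> (c \<odot> (adj A y \<otimes> z) \<oplus> cnj c \<odot> (adj A z \<otimes> y))"
      by (simp add: adj_add adj_smult distrib_left distrib_right smult_mult_left smult_mult_right
          scale_simps M.a_ac mult.commute)
    also have "\<dots> = X \<oplus> (c + cnj c) \<odot> (adj A z \<otimes> y)"
      by (simp only: c(2) yz scale_triv closed \<open>y \<in> carrier A\<close> \<open>z \<in> carrier A\<close> yyzz scale_simps)
    also have "\<dots> = X" using c by simp
    finally have "nrm A (adj A (y \<oplus> c \<odot> z) \<otimes> (y \<oplus> c \<odot> z)) = nrm A X" by simp
    then have "(nrm A (y \<oplus> c \<odot> z))\<^sup>2 = (nrm A x)\<^sup>2"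
      by (simp add: cstar_identity X_def)
    then show ?thesis by (simp add: y_def z_def nrm_nonneg power2_eq_iff_nonneg)
  qed
  have bx: "nrm A (b \<otimes> x) \<le> nrm A x" if [simp]: "x \<in> carrier A" for x
  proof -
    let ?y = "b \<otimes> x" and ?z = "x \<ominus> f \<otimes> x"
    have "(?y \<oplus> \<i> \<odot> ?z) \<oplus> (?y \<oplus> (-\<i>) \<odot> ?z) = (?y \<oplus> ?y) \<oplus> (\<i> + (-\<i>)) \<odot> ?z"
      by (subst scale_simps) (simp_all add: M.a_ac)
    also have "\<dots> = (1 + 1) \<odot> ?y"
      by (subst scale_simps) simp_all
    finally have "nrm A ((1 + 1) \<odot> ?y) \<le> nrm A (?y \<oplus> \<i> \<odot> ?z) + nrm A (?y \<oplus> (-\<i>) \<odot> ?z)"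
      using nrm_add[of "?y \<oplus> \<i> \<odot> ?z" "?y \<oplus> (-\<i>) \<odot> ?z"] by simp
    also have "\<dots> = nrm A x + nrm A x" using act[of x "\<i>"] act[of x "- \<i>"] by simp
    finally show ?thesis by (subst (asm) nrm_smult) auto
  qed
  \<comment> \<open>Let \<open>b\<close> act on itself: \<open>\<parallel>b\<parallel>\<^sup>2 = \<parallel>b b\<parallel> \<le> \<parallel>b\<parallel>\<close>.\<close>
  have "(nrm A b)\<^sup>2 \<le> nrm A b" using bx[of b] cstar_identity[of b] by (simp add: sa)
  then show ?thesis using nrm_nonneg[of b] by (cases "nrm A b = 0") (auto simp: power2_eq_square)
qed

end

locale cstar_morphism = dom: cstar_algebra A + cod: cstar_algebra B
  for A :: "'a cstar" and B :: "'b cstar" +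
  fixes \<phi> :: "'a \<Rightarrow> 'b"
  assumes hom: "\<phi> \<in> cstar_hom A B"
begin

lemma
  shows hom_closed [simp, intro]: "x \<in> carrier A \<Longrightarrow> \<phi> x \<in> carrier B"
    and hom_add: "\<lbrakk>x \<in> carrier A; y \<in> carrier A\<rbrakk> \<Longrightarrow> \<phi> (x \<oplus>\<^bsub>A\<^esub> y) = \<phi> x \<oplus>\<^bsub>B\<^esub> \<phi> y"
    and hom_smult: "x \<in> carrier A \<Longrightarrow> \<phi> (c \<odot>\<^bsub>A\<^esub> x) = c \<odot>\<^bsub>B\<^esub> \<phi> x"
    and hom_mult: "\<lbrakk>x \<in> carrier A; y \<in> carrier A\<rbrakk> \<Longrightarrow> \<phi> (x \<otimes>\<^bsub>A\<^esub> y) = \<phi> x \<otimes>\<^bsub>B\<^esub> \<phi> y"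
    and hom_adj: "x \<in> carrier A \<Longrightarrow> \<phi> (adj A x) = adj B (\<phi> x)"
  using hom unfolding cstar_hom_def by auto

lemma hom_zero [simp]: "\<phi> \<zero>\<^bsub>A\<^esub> = \<zero>\<^bsub>B\<^esub>"
  using hom_smult[of "\<zero>\<^bsub>A\<^esub>" 0] by simp

lemma hom_minus: "\<lbrakk>x \<in> carrier A; y \<in> carrier A\<rbrakk> \<Longrightarrow> \<phi> (x \<ominus>\<^bsub>A\<^esub> y) = \<phi> x \<ominus>\<^bsub>B\<^esub> \<phi> y"
  by (simp add: dom.minus_eq_scale cod.minus_eq_scale hom_add hom_smult)

lemma hom_finsum:
  "\<lbrakk>finite X; f \<in> X \<rightarrow> carrier A\<rbrakk> \<Longrightarrow> \<phi> (\<Oplus>\<^bsub>A\<^esub>i\<in>X. f i) = (\<Oplus>\<^bsub>B\<^esub>i\<in>X. \<phi> (f i))"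
  by (induction X rule: finite_induct) (auto simp: hom_add Pi_iff)

text \<open>
  Apply \<open>\<phi>\<close> to the solution \<open>e\<close> of \<open>2 e = a\<^sup>2 + e\<^sup>2\<close>: the elements \<open>\<phi> a\<close> and \<open>\<phi> e\<close> satisfy the
  hypotheses of the previous lemma, which bounds \<open>\<phi> a\<close> by \<open>1\<close>. Since \<open>a\<close> is \<open>x\<^sup>* x\<close> scaled to have
  norm below \<open>1\<close>, the C*-identity turns this into the bound for \<open>x\<close>.
\<close>

theorem hom_contractive:
  assumes x: "x \<in> carrier A"
  shows "nrm B (\<phi> x) \<le> nrm A x"
proof (rule dense_ge)
  fix r assume r: "nrm A x < r"
  then have rp: "0 < r" using dom.nrm_nonneg[OF x] by simp
  define a where "a = complex_of_real (1 / r\<^sup>2) \<odot>\<^bsub>A\<^esub> (adj A x \<otimes>\<^bsub>A\<^esub> x)"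
  have a: "a \<in> carrier A" "adj A a = a"
    using x by (auto simp: a_def dom.adj_smult dom.adj_mult dom.adj_adj)
  have "nrm A a = (nrm A x)\<^sup>2 / r\<^sup>2"
    using x rp by (simp add: a_def dom.nrm_smult dom.cstar_identity norm_divide norm_power)
  also have "\<dots> < 1"
    using r rp dom.nrm_nonneg[OF x] by (simp add: power_strict_mono)
  finally obtain e where e: "e \<in> carrier A" "adj A e = e" "a \<otimes>\<^bsub>A\<^esub> e = e \<otimes>\<^bsub>A\<^esub> a"
    "e \<oplus>\<^bsub>A\<^esub> e = a \<otimes>\<^bsub>A\<^esub> a \<oplus>\<^bsub>A\<^esub> e \<otimes>\<^bsub>A\<^esub> e"
    using dom.exists_one_minus_sqrt[OF a] by blast
  have "nrm B (\<phi> a) \<le> 1"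
  proof (rule cod.nrm_le_one_if_circle)
    show "adj B (\<phi> a) = \<phi> a" "adj B (\<phi> e) = \<phi> e"
      using a e hom_adj by metis+
    show "\<phi> a \<otimes>\<^bsub>B\<^esub> \<phi> e = \<phi> e \<otimes>\<^bsub>B\<^esub> \<phi> a" using a e by (metis hom_mult)
    have "\<phi> e \<oplus>\<^bsub>B\<^esub> \<phi> e = \<phi> (e \<oplus>\<^bsub>A\<^esub> e)" using e(1) by (simp add: hom_add)
    also have "\<dots> = \<phi> (a \<otimes>\<^bsub>A\<^esub> a \<oplus>\<^bsub>A\<^esub> e \<otimes>\<^bsub>A\<^esub> e)" using e(4) by (rule arg_cong)
    also have "\<dots> = \<phi> a \<otimes>\<^bsub>B\<^esub> \<phi> a \<oplus>\<^bsub>B\<^esub> \<phi> e \<otimes>\<^bsub>B\<^esub> \<phi> e" using a(1) e(1) by (simp add: hom_add hom_mult)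
    finally show "\<phi> e \<oplus>\<^bsub>B\<^esub> \<phi> e = \<phi> a \<otimes>\<^bsub>B\<^esub> \<phi> a \<oplus>\<^bsub>B\<^esub> \<phi> e \<otimes>\<^bsub>B\<^esub> \<phi> e" .
  qed (use a e in auto)
  moreover have "nrm B (\<phi> a) = (nrm B (\<phi> x))\<^sup>2 / r\<^sup>2"
    using x rp by (simp add: a_def hom_smult hom_mult hom_adj cod.nrm_smult cod.cstar_identity norm_divide norm_power)
  ultimately have "(nrm B (\<phi> x))\<^sup>2 \<le> r\<^sup>2" using rp by (simp add: field_simps)
  then show "nrm B (\<phi> x) \<le> r" using rp by (simp add: power2_le_iff_abs_le cod.nrm_nonneg x)
qed

text \<open>The inverse of the restriction is itself a star-homomorphism, hence contractive.\<close>

lemma isometric_if_inj_on: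
  assumes S: "cstar_subalgebra S A" and T: "cstar_subalgebra (\<phi> ` S) B" and inj: "inj_on \<phi> S"
    and x: "x \<in> S"
  shows "nrm B (\<phi> x) = nrm A x"
proof -
  let ?A = "A\<lparr>carrier := S\<rparr>" and ?B = "B\<lparr>carrier := \<phi> ` S\<rparr>"
  have S': "S \<subseteq> carrier A" using S by (simp add: cstar_subalgebra_def)
  interpret A': cstar_algebra ?A using S by (simp add: cstar_subalgebra_def)
  interpret B': cstar_algebra ?B using T by (simp add: cstar_subalgebra_def)
  define \<psi> where "\<psi> = restrict (inv_into S \<phi>) (\<phi> ` S)"
  have \<psi> [simp]: "\<psi> (\<phi> y) = y" if "y \<in> S" for y using that inj by (simp add: \<psi>_def)
  have cl: "y \<oplus>\<^bsub>A\<^esub> z \<in> S" "y \<otimes>\<^bsub>A\<^esub> z \<in> S" "c \<odot>\<^bsub>A\<^esub> y \<in> S" "adj A y \<in> S" if "y \<in> S" "z \<in> S" for y z c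
    using A'.closed(2,4,5,7)[of y] that by auto
  have "\<psi> \<in> cstar_hom ?B ?A"
    unfolding cstar_hom_def
  proof (intro CollectI conjI ballI allI)
    show "\<psi> \<in> carrier ?B \<rightarrow>\<^sub>E carrier ?A" by (auto simp: \<psi>_def inv_into_into)
  next
    fix u v assume "u \<in> carrier ?B" "v \<in> carrier ?B"
    then obtain y z where yz: "u = \<phi> y" "v = \<phi> z" "y \<in> S" "z \<in> S" by auto
    then have yz': "y \<in> carrier A" "z \<in> carrier A" using S' by auto
    show "\<psi> (u \<oplus>\<^bsub>?B\<^esub> v) = \<psi> u \<oplus>\<^bsub>?A\<^esub> \<psi> v" "\<psi> (u \<otimes>\<^bsub>?B\<^esub> v) = \<psi> u \<otimes>\<^bsub>?A\<^esub> \<psi> v"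
      using yz yz' cl by (simp_all add: hom_add[symmetric] hom_mult[symmetric])
  next
    fix u c assume "u \<in> carrier ?B"
    then obtain y where y: "u = \<phi> y" "y \<in> S" by auto
    then have "y \<in> carrier A" using S' by auto
    then show "\<psi> (c \<odot>\<^bsub>?B\<^esub> u) = c \<odot>\<^bsub>?A\<^esub> \<psi> u"
      using y cl by (simp add: hom_smult[symmetric])
  next
    fix u assume "u \<in> carrier ?B"
    then obtain y where y: "u = \<phi> y" "y \<in> S" by auto
    then have "y \<in> carrier A" using S' by auto
    then show "\<psi> (adj ?B u) = adj ?A (\<psi> u)"
      using y cl by (simp add: hom_adj[symmetric])
  qed
  then interpret inv: cstar_morphism ?B ?A \<psi> by unfold_locales
  show ?thesis
    using inv.hom_contractive[of "\<phi> x"] hom_contractive[of x] x S' by auto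
qed

end

section \<open>Finite systems of matrix units\<close>

text \<open>
  Linear combinations are indexed by \<open>X\<close> rather than by the set of values of \<open>v\<close>, because a family of matrix
  units may take the value zero repeatedly.
\<close>

definition family_span :: "'a cstar \<Rightarrow> ('i \<Rightarrow> 'a) \<Rightarrow> 'i set \<Rightarrow> 'a set" where
  "family_span A v X = {\<Oplus>\<^bsub>A\<^esub>i\<in>X. c i \<odot>\<^bsub>A\<^esub> v i |c. True}"

context cstar_algebra
begin

lemma family_span_subspace:
  assumes X: "finite X" "v \<in> X \<rightarrow> carrier A"
  shows "family_span A v X \<subseteq> carrier A" "\<zero> \<in> family_span A v X"
    "\<lbrakk>x \<in> family_span A v X; y \<in> family_span A v X\<rbrakk> \<Longrightarrow> x \<oplus> y \<in> family_span A v X"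
    "x \<in> family_span A v X \<Longrightarrow> c \<odot> x \<in> family_span A v X"
    "i \<in> X \<Longrightarrow> v i \<in> family_span A v X"
proof -
  have v: "i \<in> X \<Longrightarrow> v i \<in> carrier A" for i using X by auto
  show "family_span A v X \<subseteq> carrier A" using v by (auto simp: family_span_def)
  have "(\<Oplus>i\<in>X. 0 \<odot> v i) = \<zero>" using v by (intro finsum_all_zero) auto
  then show "\<zero> \<in> family_span A v X" unfolding family_span_def
    by (intro CollectI exI[of _ "\<lambda>_. 0"]) simp
  show "x \<oplus> y \<in> family_span A v X" if xy: "x \<in> family_span A v X" "y \<in> family_span A v X" for x y
  proof -
    from xy obtain c d where "x = (\<Oplus>i\<in>X. c i \<odot> v i)" "y = (\<Oplus>i\<in>X. d i \<odot> v i)"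
      by (auto simp: family_span_def)
    moreover have "(\<Oplus>i\<in>X. (c i + d i) \<odot> v i) = (\<Oplus>i\<in>X. c i \<odot> v i \<oplus> d i \<odot> v i)"
      using v by (intro M.finsum_cong') (auto simp: scale_simps)
    moreover have "\<dots> = (\<Oplus>i\<in>X. c i \<odot> v i) \<oplus> (\<Oplus>i\<in>X. d i \<odot> v i)"
      using v by (intro M.finsum_addf) auto
    ultimately show ?thesis unfolding family_span_def
      by (intro CollectI exI[of _ "\<lambda>i. c i + d i"]) simp
  qed
  show "c \<odot> x \<in> family_span A v X" if x: "x \<in> family_span A v X" for x c
  proof -
    from x obtain d where "x = (\<Oplus>i\<in>X. d i \<odot> v i)" by (auto simp: family_span_def)
    then have "c \<odot> x = (\<Oplus>i\<in>X. c \<odot> (d i \<odot> v i))" using v X by (simp add: finsum_smult Pi_iff)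
    also have "\<dots> = (\<Oplus>i\<in>X. (c * d i) \<odot> v i)" using v by (intro M.finsum_cong') (auto simp: scale_simps)
    finally show ?thesis by (auto simp: family_span_def)
  qed
  show "v i \<in> family_span A v X" if i: "i \<in> X" for i
  proof -
    have "(\<Oplus>j\<in>X. (if j = i then 1 else 0) \<odot> v j) = (if i = i then 1 else 0) \<odot> v i"
      using v X i by (intro finsum_single) auto
    then show ?thesis unfolding family_span_def using v i
      by (intro CollectI exI[of _ "\<lambda>j. if j = i then 1 else 0"]) simp
  qed
qed

lemma family_span_least:
  assumes X: "finite X" "v \<in> X \<rightarrow> S" and S: "S \<subseteq> carrier A" "\<zero> \<in> S"
    "\<And>x y. \<lbrakk>x \<in> S; y \<in> S\<rbrakk> \<Longrightarrow> x \<oplus> y \<in> S" "\<And>c x. x \<in> S \<Longrightarrow> c \<odot> x \<in> S"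
  shows "family_span A v X \<subseteq> S"
proof
  fix x assume "x \<in> family_span A v X"
  then obtain c where c: "x = (\<Oplus>i\<in>X. c i \<odot> v i)" by (auto simp: family_span_def)
  have "finite Y \<Longrightarrow> Y \<subseteq> X \<Longrightarrow> (\<Oplus>i\<in>Y. c i \<odot> v i) \<in> S" for Y
  proof (induction Y rule: finite_induct)
    case (insert i Y)
    then have "v i \<in> S" "v \<in> Y \<rightarrow> carrier A" "v i \<in> carrier A" using X S(1) by auto
    then show ?case using insert S by (subst M.finsum_insert) (auto simp: Pi_iff)
  qed (simp add: S)
  then show "x \<in> S" using c X by simp
qed

text \<open>
  If \<open>v\<close> is nonzero, the coefficients of a convergent sequence on its line are Cauchy in the complex numbers.
\<close>

lemma line_closed:
  assumes v: "v \<in> carrier A" and lim: "norm_limit A (\<lambda>n. c n \<odot> v) x"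
  shows "\<exists>k. x = k \<odot> v"
proof (cases "v = \<zero>")
  case True
  then have "norm_limit A (\<lambda>n. \<zero>) x" using lim by simp
  then have "x = \<zero>" using norm_limit_unique norm_limit_const by blast
  then show ?thesis using True by simp
next
  case False
  then have nv: "nrm A v > 0" using nrm_nonneg[OF v] nrm_eq_0[OF v] by linarith
  have xc: "x \<in> carrier A" using lim by (rule norm_limitD)
  have "Cauchy c"
  proof (rule metric_CauchyI)
    fix e :: real assume "e > 0"
    then have "e * nrm A v / 2 > 0" using nv by simp
    then have "eventually (\<lambda>n. nrm A (c n \<odot> v \<ominus> x) < e * nrm A v / 2) sequentially"
      using norm_limitD(3)[OF lim] by (rule order_tendstoD(2)[rotated])
    then obtain N where N: "\<And>n. n \<ge> N \<Longrightarrow> nrm A (c n \<odot> v \<ominus> x) < e * nrm A v / 2"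
      by (auto simp: eventually_sequentially)
    have "dist (c m) (c n) < e" if "m \<ge> N" "n \<ge> N" for m n
    proof -
      have "cmod (c m - c n) * nrm A v = nrm A ((c m - c n) \<odot> v)" using v by (simp add: nrm_smult)
      also have "(c m - c n) \<odot> v = c m \<odot> v \<ominus> c n \<odot> v"
        using v scale_simps(1)[of v "c m" "- c n"] by (simp add: minus_eq_scale scale_simps(3))
      also have "nrm A \<dots> \<le> nrm A (c m \<odot> v \<ominus> x) + nrm A (x \<ominus> c n \<odot> v)"
        using v xc by (intro nrm_triangle) auto
      also have "\<dots> < e * nrm A v"
        using N[OF that(1)] N[OF that(2)] v xc by (simp add: nrm_minus_commute)
      finally show ?thesis using nv by (simp add: dist_norm)
    qed
    then show "\<exists>M. \<forall>m\<ge>M. \<forall>n\<ge>M. dist (c m) (c n) < e" by blast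
  qed
  then obtain k where k: "c \<longlonglongrightarrow> k" using Cauchy_convergent convergent_def by blast
  have "norm_limit A (\<lambda>n. c n \<odot> v) (k \<odot> v)"
  proof (rule norm_limitI_bound)
    show "nrm A (c n \<odot> v \<ominus> k \<odot> v) \<le> cmod (c n - k) * nrm A v" for n
      using v scale_simps(1)[of v "c n" "- k"] nrm_smult[OF v, of "c n - k"]
      by (simp add: minus_eq_scale scale_simps(3))
    have "(\<lambda>n. cmod (c n - k) * nrm A v) \<longlonglongrightarrow> cmod (k - k) * nrm A v"
      by (intro tendsto_intros k)
    then show "(\<lambda>n. cmod (c n - k) * nrm A v) \<longlonglongrightarrow> 0" by simp
  qed (use v in auto)
  then show ?thesis using norm_limit_unique[OF lim] by blast
qed

end

text \<open>
  Units may vanish, and indices are related only when they belong to the same block: the span is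
  a direct sum of matrix algebras over the blocks whose units are nonzero.
\<close>

locale matrix_units = cstar_algebra A for A :: "'a cstar" (structure) +
  fixes R :: "('i \<times> 'i) set" and e :: "'i \<Rightarrow> 'i \<Rightarrow> 'a"
  assumes finite_R: "finite R" and sym_R: "(i, j) \<in> R \<Longrightarrow> (j, i) \<in> R"
    and trans_R: "\<lbrakk>(i, j) \<in> R; (j, l) \<in> R\<rbrakk> \<Longrightarrow> (i, l) \<in> R"
    and unit_closed: "(i, j) \<in> R \<Longrightarrow> e i j \<in> carrier A"
    and unit_adj: "(i, j) \<in> R \<Longrightarrow> adj A (e i j) = e j i"
    and unit_mult: "\<lbrakk>(i, j) \<in> R; (k, l) \<in> R\<rbrakk> \<Longrightarrow> e i j \<otimes> e k l = (if j = k then e i l else \<zero>)"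
begin

definition unit_span :: "'a set" where
  "unit_span = family_span A (\<lambda>(i, j). e i j) R"

lemma refl_R: "(i, j) \<in> R \<Longrightarrow> (i, i) \<in> R \<and> (j, j) \<in> R"
  using sym_R trans_R by blast

lemma units_Pi: "(\<lambda>(i, j). e i j) \<in> R \<rightarrow> carrier A" using unit_closed by auto

lemmas unit_span_subspace = family_span_subspace[OF finite_R units_Pi, folded unit_span_def]

lemma unit_in_span: "(i, j) \<in> R \<Longrightarrow> e i j \<in> unit_span"
  using unit_span_subspace(5)[of "(i, j)"] by simp

text \<open>
  Compression by diagonal units isolates one coefficient. This is what makes the span closed and
  what detects the kernel of a homomorphism on it.
\<close>

lemma compress_combination:
  assumes ij: "(i, j) \<in> R"
  shows "e i i \<otimes> (\<Oplus>p\<in>R. c p \<odot> (case p of (i, j) \<Rightarrow> e i j)) \<otimes> e j j = c (i, j) \<odot> e i j"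
proof -
  let ?u = "\<lambda>p. case p of (i, j) \<Rightarrow> e i j"
  have u: "?u p \<in> carrier A" if "p \<in> R" for p using that unit_closed by (cases p) auto
  have ii: "(i, i) \<in> R" "(j, j) \<in> R" using refl_R[OF ij] by auto
  note [simp] = unit_closed[OF ii(1)] unit_closed[OF ii(2)] unit_closed[OF ij]
  have "e i i \<otimes> (\<Oplus>p\<in>R. c p \<odot> ?u p) \<otimes> e j j = (\<Oplus>p\<in>R. e i i \<otimes> (c p \<odot> ?u p) \<otimes> e j j)"
    using u finite_R by (simp add: finsum_mult_left finsum_mult_right Pi_iff)
  also have "\<dots> = e i i \<otimes> (c (i, j) \<odot> ?u (i, j)) \<otimes> e j j"
  proof (rule finsum_single[OF finite_R ij])
    fix q assume q: "q \<in> R" "q \<noteq> (i, j)"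
    obtain k l where kl: "q = (k, l)" by (cases q)
    have "e i i \<otimes> e k l \<otimes> e j j = \<zero>"
    proof (cases "i = k")
      case True
      then show ?thesis using q kl ii unit_mult[OF ii(1), of k l] unit_mult[of k l j j] by auto
    next
      case False
      then show ?thesis using q kl ii unit_mult[OF ii(1), of k l] by auto
    qed
    then show "e i i \<otimes> (c q \<odot> ?u q) \<otimes> e j j = \<zero>"
      using kl u[OF q(1)] by (simp add: smult_mult_left smult_mult_right)
  qed simp
  also have "\<dots> = c (i, j) \<odot> e i j"
    using ij ii unit_mult[OF ii(1) ij] unit_mult[OF ij ii(2)] by (simp add: smult_mult_left smult_mult_right)
  finally show ?thesis .
qed

lemma star_subspace_unit_span: "star_subspace A unit_span"
proof -
  have "adj A x \<in> unit_span" if "x \<in> unit_span" for x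
  proof -
    have "unit_span \<subseteq> {x \<in> carrier A. adj A x \<in> unit_span}"
      unfolding unit_span_def
    proof (rule family_span_least[OF finite_R], fold unit_span_def)
      show "(\<lambda>(i, j). e i j) \<in> R \<rightarrow> {x \<in> carrier A. adj A x \<in> unit_span}"
        using unit_closed unit_adj sym_R unit_in_span by auto
    qed (use unit_span_subspace in \<open>auto simp: adj_add adj_smult\<close>)
    then show ?thesis using that by auto
  qed
  then show ?thesis unfolding star_subspace_def using unit_span_subspace by auto
qed

lemma mult_closed_unit_span: "mult_closed_set A unit_span"
proof -
  have 1: "unit_span \<subseteq> {x \<in> carrier A. e i j \<otimes> x \<in> unit_span}" if ij: "(i, j) \<in> R" for i j
    unfolding unit_span_def
  proof (rule family_span_least[OF finite_R], fold unit_span_def)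
    show "(\<lambda>(i, j). e i j) \<in> R \<rightarrow> {x \<in> carrier A. e i j \<otimes> x \<in> unit_span}"
      using ij unit_closed unit_mult trans_R unit_in_span unit_span_subspace(2) by auto
  qed (use unit_span_subspace unit_closed[OF ij] in \<open>auto simp: distrib_left smult_mult_right\<close>)
  have 2: "unit_span \<subseteq> {x \<in> carrier A. \<forall>y\<in>unit_span. x \<otimes> y \<in> unit_span}"
    unfolding unit_span_def
  proof (rule family_span_least[OF finite_R], fold unit_span_def)
    show "(\<lambda>(i, j). e i j) \<in> R \<rightarrow> {x \<in> carrier A. \<forall>y\<in>unit_span. x \<otimes> y \<in> unit_span}"
      using 1 unit_closed by auto
  qed (use unit_span_subspace in \<open>auto simp: distrib_right smult_mult_left subset_iff\<close>)
  then show ?thesis by (auto simp: mult_closed_set_def)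
qed

text \<open>
  In a convergent sequence of combinations the summand at each unit is a compression of the combination,
  hence converges itself, and its limit stays on the line of the unit.
\<close>

lemma norm_closed_unit_span: "norm_closed A unit_span"
  unfolding norm_closed_def
proof (intro conjI allI impI)
  fix \<sigma> x assume \<sigma>: "range \<sigma> \<subseteq> unit_span" and lim: "norm_limit A \<sigma> x"
  let ?u = "\<lambda>p. case p of (i, j) \<Rightarrow> e i j"
  have u: "?u p \<in> carrier A" if "p \<in> R" for p using that unit_closed by (cases p) auto
  have "\<forall>n. \<exists>c. \<sigma> n = (\<Oplus>p\<in>R. c p \<odot> ?u p)" using \<sigma> by (auto simp: unit_span_def family_span_def)
  then obtain c where c: "\<And>n. \<sigma> n = (\<Oplus>p\<in>R. c n p \<odot> ?u p)" by metis
  have "\<exists>k. norm_limit A (\<lambda>n. c n p \<odot> ?u p) (k \<odot> ?u p)" if p: "p \<in> R" for p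
  proof -
    obtain i j where ij: "p = (i, j)" by (cases p)
    have ii: "(i, i) \<in> R" "(j, j) \<in> R" using refl_R p ij by auto
    have "norm_limit A (\<lambda>n. e i i \<otimes> \<sigma> n \<otimes> e j j) (e i i \<otimes> x \<otimes> e j j)"
      using unit_closed ii by (intro norm_limit_mult norm_limit_const lim)
    then have l: "norm_limit A (\<lambda>n. c n p \<odot> ?u p) (e i i \<otimes> x \<otimes> e j j)"
      using compress_combination[of i j] p by (simp add: c ij)
    then show ?thesis using line_closed[OF u[OF p] l] by metis
  qed
  then obtain k where "\<And>p. p \<in> R \<Longrightarrow> norm_limit A (\<lambda>n. c n p \<odot> ?u p) (k p \<odot> ?u p)" by metis
  then have "norm_limit A (\<lambda>n. \<Oplus>p\<in>R. c n p \<odot> ?u p) (\<Oplus>p\<in>R. k p \<odot> ?u p)"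
    by (rule norm_limit_finsum[OF finite_R])
  then have "x = (\<Oplus>p\<in>R. k p \<odot> ?u p)" using norm_limit_unique[OF lim] by (simp add: c[symmetric])
  then show "x \<in> unit_span" by (auto simp: unit_span_def family_span_def)
qed (rule unit_span_subspace)

lemmas cstar_subalgebra_unit_span =
  closed_star_subalgebra[OF star_subspace_unit_span mult_closed_unit_span norm_closed_unit_span]

text \<open>
  Dimension is counted over a set of vectors, so the family of units is replaced by the set of its values.
\<close>

lemma finite_dimensional_unit_span: "finite_dimensional (A\<lparr>carrier := unit_span\<rparr>)"
proof -
  define X where "X = (\<lambda>(i, j). e i j) ` R"
  have X: "finite X" "X \<subseteq> unit_span" using finite_R unit_in_span by (auto simp: X_def)
  have XA: "(\<lambda>x. x) \<in> X \<rightarrow> carrier A" using X unit_span_subspace(1) by auto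
  have "e i j \<in> family_span A (\<lambda>x. x) X" if "(i, j) \<in> R" for i j
    using family_span_subspace(5)[OF X(1) XA, of "e i j"] that by (auto simp: X_def)
  then have sub: "unit_span \<subseteq> family_span A (\<lambda>x. x) X"
    unfolding unit_span_def
    by (intro family_span_least[OF finite_R] family_span_subspace(1-4)[OF X(1) XA]) auto
  have "\<exists>c. a = (\<Oplus>\<^bsub>A\<lparr>carrier := unit_span\<rparr>\<^esub>x\<in>X. c x \<odot> x)" if a: "a \<in> unit_span" for a
  proof -
    have "a \<in> family_span A (\<lambda>x. x) X" using sub a by (rule subsetD)
    then obtain c where c: "a = (\<Oplus>x\<in>X. c x \<odot> x)" unfolding family_span_def by blast
    have pi: "(\<lambda>x. c x \<odot> x) \<in> X \<rightarrow> unit_span" using X(2) unit_span_subspace(4) by (intro Pi_I) (metis subsetD)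
    show ?thesis
      by (rule exI[of _ c])
         (simp only: c sub_finsum[OF star_subspace_unit_span cstar_subalgebra_unit_span pi])
  qed
  then show ?thesis unfolding finite_dimensional_def using X by (intro exI[of _ X]) simp
qed

text \<open>
  Compressing \<open>\<phi> x\<close> by the images of the diagonal units reads off the coefficients of \<open>x\<close>, so \<open>\<phi>\<close>
  is injective on the span as soon as it kills no nonzero unit.
\<close>

lemma hom_isometric_on_unit_span:
  assumes \<phi>: "cstar_morphism A B \<phi>"
    and nz: "\<And>i j. (i, j) \<in> R \<Longrightarrow> e i j \<noteq> \<zero> \<Longrightarrow> \<phi> (e i j) \<noteq> \<zero>\<^bsub>B\<^esub>"
    and x: "x \<in> unit_span"
  shows "nrm B (\<phi> x) = nrm A x"
proof -
  interpret \<phi>: cstar_morphism A B \<phi> by (rule \<phi>)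
  interpret B: matrix_units B R "\<lambda>i j. \<phi> (e i j)"
  proof
    show "adj B (\<phi> (e i j)) = \<phi> (e j i)" if "(i, j) \<in> R" for i j
      using that unit_adj unit_closed \<phi>.hom_adj by metis
    show "\<phi> (e i j) \<otimes>\<^bsub>B\<^esub> \<phi> (e k l) = (if j = k then \<phi> (e i l) else \<zero>\<^bsub>B\<^esub>)"
      if "(i, j) \<in> R" "(k, l) \<in> R" for i j k l
      using that unit_mult[OF that] unit_closed by (auto simp: \<phi>.hom_mult[symmetric])
  qed (use finite_R sym_R trans_R unit_closed in blast)+
  let ?u = "\<lambda>p. case p of (i, j) \<Rightarrow> e i j"
  have u: "?u p \<in> carrier A" if "p \<in> R" for p using that unit_closed by (cases p) auto
  have im: "\<phi> (\<Oplus>p\<in>R. c p \<odot> ?u p) = (\<Oplus>\<^bsub>B\<^esub>p\<in>R. c p \<odot>\<^bsub>B\<^esub> (case p of (i, j) \<Rightarrow> \<phi> (e i j)))" for c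
  proof -
    have "\<phi> (\<Oplus>p\<in>R. c p \<odot> ?u p) = (\<Oplus>\<^bsub>B\<^esub>p\<in>R. \<phi> (c p \<odot> ?u p))"
      using u finite_R by (intro \<phi>.hom_finsum) auto
    also have "\<dots> = (\<Oplus>\<^bsub>B\<^esub>p\<in>R. c p \<odot>\<^bsub>B\<^esub> (case p of (i, j) \<Rightarrow> \<phi> (e i j)))"
      using unit_closed by (intro \<phi>.cod.M.finsum_cong') (auto simp: \<phi>.hom_smult)
    finally show ?thesis .
  qed
  have img: "\<phi> ` unit_span = B.unit_span"
    unfolding unit_span_def B.unit_span_def family_span_def by (auto simp: im image_iff) (metis im)
  have ker: "y = \<zero>" if y: "y \<in> unit_span" "\<phi> y = \<zero>\<^bsub>B\<^esub>" for y
  proof -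
    obtain c where c: "y = (\<Oplus>p\<in>R. c p \<odot> ?u p)"
      using y(1) unfolding unit_span_def family_span_def by blast
    have "c p \<odot> ?u p = \<zero>" if p: "p \<in> R" for p
    proof -
      obtain i j where ij: "p = (i, j)" by (cases p)
      have "c (i, j) \<odot>\<^bsub>B\<^esub> \<phi> (e i j) = \<phi> (e i i) \<otimes>\<^bsub>B\<^esub> \<phi> y \<otimes>\<^bsub>B\<^esub> \<phi> (e j j)"
        using B.compress_combination[of i j c] p ij by (simp add: c im)
      also have "\<dots> = \<zero>\<^bsub>B\<^esub>" using y p ij refl_R[of i j] unit_closed by auto
      finally have "cmod (c p) * nrm B (\<phi> (e i j)) = 0"
        using p ij unit_closed \<phi>.cod.nrm_smult[of "\<phi> (e i j)" "c p"] by simp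
      then have "c p = 0 \<or> \<phi> (e i j) = \<zero>\<^bsub>B\<^esub>" using p ij unit_closed \<phi>.cod.nrm_eq_0 by auto
      then have "c p = 0 \<or> e i j = \<zero>" using nz p ij by blast
      then show ?thesis using p ij unit_closed by auto
    qed
    then show ?thesis unfolding c by (intro finsum_all_zero)
  qed
  have sub: "unit_span \<subseteq> carrier A" by (rule unit_span_subspace)
  have "inj_on \<phi> unit_span"
  proof (rule inj_onI)
    fix y z assume yz: "y \<in> unit_span" "z \<in> unit_span" "\<phi> y = \<phi> z"
    then have c: "y \<in> carrier A" "z \<in> carrier A" using sub by auto
    then have "\<phi> (y \<ominus> z) = \<zero>\<^bsub>B\<^esub>" using yz by (simp add: \<phi>.hom_minus)
    then have "y \<ominus> z = \<zero>" using ker yz star_subspace_minus[OF star_subspace_unit_span] by blast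
    then show "y = z" using c by (simp add: minus_eq_zero_iff)
  qed
  then show ?thesis
    using \<phi>.isometric_if_inj_on[OF cstar_subalgebra_unit_span _ _ x] B.cstar_subalgebra_unit_span img by simp
qed

end

section \<open>Common extensions and the closure of a finite set of paths\<close>

lemma ex1_unique: "\<lbrakk>\<exists>!x. P x; P a; P b\<rbrakk> \<Longrightarrow> a = b"
  by blast

context k_graph
begin

lemma deg_src: "\<mu> \<in> paths \<Lambda> \<Longrightarrow> deg \<Lambda> (src \<Lambda> \<mu>) = 0"
  using deg_id[of "src \<Lambda> \<mu>"] by (simp add: src_closed rng_src)

lemma factor_unique:
  assumes p: "\<mu> \<in> paths \<Lambda>" "\<nu> \<in> paths \<Lambda>" "\<mu>' \<in> paths \<Lambda>" "\<nu>' \<in> paths \<Lambda>"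
    and c: "src \<Lambda> \<mu> = rng \<Lambda> \<nu>" "src \<Lambda> \<mu>' = rng \<Lambda> \<nu>'"
    and eq: "\<mu> \<cdot> \<nu> = \<mu>' \<cdot> \<nu>'" and d: "deg \<Lambda> \<mu> = deg \<Lambda> \<mu>'"
  shows "\<mu> = \<mu>'" "\<nu> = \<nu>'"
proof -
  have "deg \<Lambda> \<mu> + deg \<Lambda> \<nu> = deg \<Lambda> \<mu>' + deg \<Lambda> \<nu>'" using deg_cmp p c eq by metis
  then have d': "deg \<Lambda> \<nu> = deg \<Lambda> \<nu>'" using d by simp
  let ?P = "\<lambda>(\<mu>1, \<nu>1). \<mu>1 \<in> paths \<Lambda> \<and> \<nu>1 \<in> paths \<Lambda> \<and> src \<Lambda> \<mu>1 = rng \<Lambda> \<nu>1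
             \<and> deg \<Lambda> \<mu>1 = deg \<Lambda> \<mu> \<and> deg \<Lambda> \<nu>1 = deg \<Lambda> \<nu> \<and> \<mu> \<cdot> \<nu> = \<mu>1 \<cdot> \<nu>1"
  have ex: "\<exists>!x. ?P x"
    by (rule factorisation) (use p c in \<open>auto intro: cmp_closed deg_cmp\<close>)
  have "?P (\<mu>, \<nu>)" "?P (\<mu>', \<nu>')" using p c eq d d' by auto
  with ex have "(\<mu>, \<nu>) = (\<mu>', \<nu>')" by (rule ex1_unique)
  then show "\<mu> = \<mu>'" "\<nu> = \<nu>'" by auto
qed

lemma left_cancel:
  "\<lbrakk>\<mu> \<in> paths \<Lambda>; \<alpha> \<in> paths \<Lambda>; \<beta> \<in> paths \<Lambda>; src \<Lambda> \<mu> = rng \<Lambda> \<alpha>; src \<Lambda> \<mu> = rng \<Lambda> \<beta>;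
    \<mu> \<cdot> \<alpha> = \<mu> \<cdot> \<beta>\<rbrakk> \<Longrightarrow> \<alpha> = \<beta>"
  using factor_unique(2)[of \<mu> \<alpha> \<mu> \<beta>] by simp

lemma deg_zero_id:
  assumes "\<mu> \<in> paths \<Lambda>" "deg \<Lambda> \<mu> = 0"
  shows "rng \<Lambda> \<mu> = \<mu>" "src \<Lambda> \<mu> = \<mu>"
proof -
  have c: "src \<Lambda> (rng \<Lambda> \<mu>) = rng \<Lambda> \<mu>" "src \<Lambda> \<mu> = rng \<Lambda> (src \<Lambda> \<mu>)"
    "rng \<Lambda> \<mu> \<cdot> \<mu> = \<mu> \<cdot> src \<Lambda> \<mu>" "deg \<Lambda> (rng \<Lambda> \<mu>) = deg \<Lambda> \<mu>"
    using assms by (simp_all add: src_rng rng_src rng_id src_id deg_id)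
  show "rng \<Lambda> \<mu> = \<mu>"
    by (rule factor_unique(1)[OF _ _ _ _ c]) (use assms in \<open>auto intro: rng_closed src_closed\<close>)
  have "\<mu> = src \<Lambda> \<mu>"
    by (rule factor_unique(2)[OF _ _ _ _ c]) (use assms in \<open>auto intro: rng_closed src_closed\<close>)
  then show "src \<Lambda> \<mu> = \<mu>" by simp
qed

lemma factor_ex:
  assumes "\<sigma> \<in> paths \<Lambda>" "m \<le> deg \<Lambda> \<sigma>"
  shows "\<exists>\<mu>\<in>paths \<Lambda>. \<exists>\<nu>\<in>paths \<Lambda>. src \<Lambda> \<mu> = rng \<Lambda> \<nu> \<and> deg \<Lambda> \<mu> = m \<and> \<sigma> = \<mu> \<cdot> \<nu>"
proof -
  have "deg \<Lambda> \<sigma> = m + (deg \<Lambda> \<sigma> - m)" using assms(2) by (auto simp: le_fun_def fun_eq_iff)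
  then show ?thesis using factorisation[OF assms(1)] by blast
qed

text \<open>
  Both factorisations of the path start with an initial segment of degree \<open>deg \<Lambda> \<mu>\<close>, and such a
  segment is unique.
\<close>

lemma prefix_factor:
  assumes \<mu>: "\<mu> \<in> paths \<Lambda>" "\<alpha> \<in> paths \<Lambda>" "src \<Lambda> \<mu> = rng \<Lambda> \<alpha>"
    and \<xi>: "\<xi> \<in> paths \<Lambda>" "\<omega> \<in> paths \<Lambda>" "src \<Lambda> \<xi> = rng \<Lambda> \<omega>"
    and eq: "\<mu> \<cdot> \<alpha> = \<xi> \<cdot> \<omega>" and le: "deg \<Lambda> \<mu> \<le> deg \<Lambda> \<xi>"
  shows "\<exists>\<beta>\<in>paths \<Lambda>. src \<Lambda> \<mu> = rng \<Lambda> \<beta> \<and> \<xi> = \<mu> \<cdot> \<beta>"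
proof -
  obtain \<mu>' \<beta> where *: "\<mu>' \<in> paths \<Lambda>" "\<beta> \<in> paths \<Lambda>" "src \<Lambda> \<mu>' = rng \<Lambda> \<beta>" "deg \<Lambda> \<mu>' = deg \<Lambda> \<mu>" "\<xi> = \<mu>' \<cdot> \<beta>"
    using factor_ex[OF \<xi>(1) le] by blast
  have c: "src \<Lambda> \<beta> = rng \<Lambda> \<omega>" using src_cmp[OF *(1-3)] \<xi>(3) *(5) by simp
  have "\<mu>' \<cdot> (\<beta> \<cdot> \<omega>) = \<mu> \<cdot> \<alpha>" using cmp_assoc[OF *(1,2) \<xi>(2) *(3) c] eq *(5) by simp
  then have "\<mu>' = \<mu>"
    using factor_unique(1)[OF *(1) cmp_closed[OF *(2) \<xi>(2) c] \<mu>(1,2) _ \<mu>(3)] rng_cmp[OF *(2) \<xi>(2) c] *(3,4) by simp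
  then show ?thesis using * by blast
qed

text \<open>
  An initial segment given by the description in \<^const>\<open>segment\<close> is the same as a prefix: the
  first of the three factors has degree zero, so it is an identity and can be absorbed.
\<close>

lemma segment_eq_iff:
  assumes \<sigma>: "\<sigma> \<in> paths \<Lambda>" and \<mu>: "\<mu> \<in> paths \<Lambda>" and le: "deg \<Lambda> \<mu> \<le> deg \<Lambda> \<sigma>"
  shows "segment \<Lambda> \<sigma> 0 (deg \<Lambda> \<mu>) = \<mu> \<longleftrightarrow> (\<exists>\<alpha>\<in>paths \<Lambda>. src \<Lambda> \<mu> = rng \<Lambda> \<alpha> \<and> \<sigma> = \<mu> \<cdot> \<alpha>)"
proof -
  let ?P = "\<lambda>\<nu>. \<nu> \<in> paths \<Lambda> \<and> deg \<Lambda> \<nu> = deg \<Lambda> \<mu> - 0 \<and>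
     (\<exists>\<kappa>\<in>paths \<Lambda>. \<exists>\<tau>\<in>paths \<Lambda>. deg \<Lambda> \<kappa> = 0 \<and> deg \<Lambda> \<tau> = deg \<Lambda> \<sigma> - deg \<Lambda> \<mu> \<and>
        src \<Lambda> \<kappa> = rng \<Lambda> \<nu> \<and> src \<Lambda> \<nu> = rng \<Lambda> \<tau> \<and> \<sigma> = \<kappa> \<cdot> \<nu> \<cdot> \<tau>)"
  let ?Q = "\<lambda>\<nu>. \<nu> \<in> paths \<Lambda> \<and> deg \<Lambda> \<nu> = deg \<Lambda> \<mu> \<and> (\<exists>\<tau>\<in>paths \<Lambda>. src \<Lambda> \<nu> = rng \<Lambda> \<tau> \<and> \<sigma> = \<nu> \<cdot> \<tau>)"
  have PQ: "?P \<nu> \<longleftrightarrow> ?Q \<nu>" for \<nu>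
  proof
    assume "?P \<nu>"
    then obtain \<kappa> \<tau> where *: "\<nu> \<in> paths \<Lambda>" "deg \<Lambda> \<nu> = deg \<Lambda> \<mu>" "\<kappa> \<in> paths \<Lambda>" "\<tau> \<in> paths \<Lambda>"
      "deg \<Lambda> \<kappa> = 0" "src \<Lambda> \<kappa> = rng \<Lambda> \<nu>" "src \<Lambda> \<nu> = rng \<Lambda> \<tau>" "\<sigma> = \<kappa> \<cdot> \<nu> \<cdot> \<tau>" by auto
    then have "\<kappa> \<cdot> \<nu> = \<nu>" using deg_zero_id[of \<kappa>] rng_id[of \<nu>] by metis
    then show "?Q \<nu>" using * by auto
  next
    assume "?Q \<nu>"
    then obtain \<tau> where *: "\<nu> \<in> paths \<Lambda>" "deg \<Lambda> \<nu> = deg \<Lambda> \<mu>" "\<tau> \<in> paths \<Lambda>"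
      "src \<Lambda> \<nu> = rng \<Lambda> \<tau>" "\<sigma> = \<nu> \<cdot> \<tau>" by auto
    have "deg \<Lambda> \<sigma> = deg \<Lambda> \<mu> + deg \<Lambda> \<tau>" using * deg_cmp by metis
    then have "deg \<Lambda> \<tau> = deg \<Lambda> \<sigma> - deg \<Lambda> \<mu>" by (auto simp: fun_eq_iff)
    moreover have "deg \<Lambda> \<nu> = deg \<Lambda> \<mu> - 0" using * by (auto simp: fun_eq_iff)
    moreover have "rng \<Lambda> \<nu> \<cdot> \<nu> = \<nu>" using * rng_id by simp
    moreover have "\<sigma> = rng \<Lambda> \<nu> \<cdot> \<nu> \<cdot> \<tau>" "rng \<Lambda> \<nu> \<in> paths \<Lambda>" "deg \<Lambda> (rng \<Lambda> \<nu>) = 0" "src \<Lambda> (rng \<Lambda> \<nu>) = rng \<Lambda> \<nu>"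
      using * by (simp_all add: rng_id rng_closed deg_id src_rng)
    ultimately show "?P \<nu>" using * by (intro conjI bexI[of _ "rng \<Lambda> \<nu>"] bexI[of _ \<tau>]) simp_all
  qed
  obtain \<nu> where \<nu>: "?Q \<nu>" using factor_ex[OF \<sigma> le] by metis
  have uniq: "\<nu>' = \<nu>" if "?Q \<nu>'" for \<nu>' using \<nu> that factor_unique(1) by metis
  have "segment \<Lambda> \<sigma> 0 (deg \<Lambda> \<mu>) = (THE \<nu>. ?Q \<nu>)" unfolding segment_def using PQ by presburger
  also have "\<dots> = \<nu>" using \<nu> uniq by (rule the_equality)
  finally have "segment \<Lambda> \<sigma> 0 (deg \<Lambda> \<mu>) = \<nu>" .
  moreover have "\<nu> = \<mu> \<longleftrightarrow> ?Q \<mu>" using \<nu> uniq[of \<mu>] by auto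
  ultimately show ?thesis using \<mu> by simp
qed

lemma MCE_iff:
  assumes \<mu>: "\<mu> \<in> paths \<Lambda>" and \<nu>: "\<nu> \<in> paths \<Lambda>"
  shows "\<sigma> \<in> MCE \<Lambda> \<mu> \<nu> \<longleftrightarrow> \<sigma> \<in> paths \<Lambda> \<and> deg \<Lambda> \<sigma> = sup (deg \<Lambda> \<mu>) (deg \<Lambda> \<nu>) \<and>
    (\<exists>\<alpha>\<in>paths \<Lambda>. src \<Lambda> \<mu> = rng \<Lambda> \<alpha> \<and> \<sigma> = \<mu> \<cdot> \<alpha>) \<and> (\<exists>\<beta>\<in>paths \<Lambda>. src \<Lambda> \<nu> = rng \<Lambda> \<beta> \<and> \<sigma> = \<nu> \<cdot> \<beta>)"
proof -
  have "segment \<Lambda> \<sigma> 0 (deg \<Lambda> \<mu>) = \<mu> \<longleftrightarrow> (\<exists>\<alpha>\<in>paths \<Lambda>. src \<Lambda> \<mu> = rng \<Lambda> \<alpha> \<and> \<sigma> = \<mu> \<cdot> \<alpha>)"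
    "segment \<Lambda> \<sigma> 0 (deg \<Lambda> \<nu>) = \<nu> \<longleftrightarrow> (\<exists>\<alpha>\<in>paths \<Lambda>. src \<Lambda> \<nu> = rng \<Lambda> \<alpha> \<and> \<sigma> = \<nu> \<cdot> \<alpha>)"
    if "\<sigma> \<in> paths \<Lambda>" "deg \<Lambda> \<sigma> = sup (deg \<Lambda> \<mu>) (deg \<Lambda> \<nu>)"
    using segment_eq_iff[OF that(1) \<mu>] segment_eq_iff[OF that(1) \<nu>] that(2) by auto
  then show ?thesis unfolding MCE_def by blast
qed

lemma Lambda_min_iff:
  assumes \<mu>: "\<mu> \<in> paths \<Lambda>" and \<nu>: "\<nu> \<in> paths \<Lambda>"
  shows "(\<alpha>, \<beta>) \<in> Lambda_min \<Lambda> \<mu> \<nu> \<longleftrightarrow> \<alpha> \<in> paths \<Lambda> \<and> \<beta> \<in> paths \<Lambda> \<and> src \<Lambda> \<mu> = rng \<Lambda> \<alpha> \<and>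
    src \<Lambda> \<nu> = rng \<Lambda> \<beta> \<and> \<mu> \<cdot> \<alpha> = \<nu> \<cdot> \<beta> \<and> deg \<Lambda> (\<mu> \<cdot> \<alpha>) = sup (deg \<Lambda> \<mu>) (deg \<Lambda> \<nu>)"
  unfolding Lambda_min_def using MCE_iff[OF \<mu> \<nu>, of "\<mu> \<cdot> \<alpha>"] cmp_closed \<mu> by auto

text \<open>
  By cancellation a pair in \<open>Lambda_min \<Lambda> \<mu> \<nu>\<close> is determined by the common extension it produces.
\<close>

lemma finite_Lambda_min:
  assumes "finitely_aligned \<Lambda>" and \<mu>: "\<mu> \<in> paths \<Lambda>" and \<nu>: "\<nu> \<in> paths \<Lambda>"
  shows "finite (Lambda_min \<Lambda> \<mu> \<nu>)"
proof (rule inj_on_finite)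
  show "inj_on (\<lambda>(\<alpha>, \<beta>). \<mu> \<cdot> \<alpha>) (Lambda_min \<Lambda> \<mu> \<nu>)"
  proof (rule inj_onI)
    fix x y assume xy: "x \<in> Lambda_min \<Lambda> \<mu> \<nu>" "y \<in> Lambda_min \<Lambda> \<mu> \<nu>"
      "(\<lambda>(\<alpha>, \<beta>). \<mu> \<cdot> \<alpha>) x = (\<lambda>(\<alpha>, \<beta>). \<mu> \<cdot> \<alpha>) y"
    obtain \<alpha> \<beta> \<alpha>' \<beta>' where e: "x = (\<alpha>, \<beta>)" "y = (\<alpha>', \<beta>')" by (cases x, cases y)
    then have *: "\<alpha> \<in> paths \<Lambda>" "\<beta> \<in> paths \<Lambda>" "src \<Lambda> \<mu> = rng \<Lambda> \<alpha>" "src \<Lambda> \<nu> = rng \<Lambda> \<beta>" "\<mu> \<cdot> \<alpha> = \<nu> \<cdot> \<beta>"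
      "\<alpha>' \<in> paths \<Lambda>" "\<beta>' \<in> paths \<Lambda>" "src \<Lambda> \<mu> = rng \<Lambda> \<alpha>'" "src \<Lambda> \<nu> = rng \<Lambda> \<beta>'" "\<mu> \<cdot> \<alpha>' = \<nu> \<cdot> \<beta>'"
      using xy(1,2) Lambda_min_iff[OF \<mu> \<nu>] by auto
    have "\<mu> \<cdot> \<alpha> = \<mu> \<cdot> \<alpha>'" using xy(3) e by simp
    then have "\<alpha> = \<alpha>'" "\<nu> \<cdot> \<beta> = \<nu> \<cdot> \<beta>'" using * left_cancel[OF \<mu>, of \<alpha> \<alpha>'] by auto
    then show "x = y" using * e left_cancel[OF \<nu>, of \<beta> \<beta>'] by auto
  qed
  show "(\<lambda>(\<alpha>, \<beta>). \<mu> \<cdot> \<alpha>) ` Lambda_min \<Lambda> \<mu> \<nu> \<subseteq> MCE \<Lambda> \<mu> \<nu>" by (auto simp: Lambda_min_def)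
  show "finite (MCE \<Lambda> \<mu> \<nu>)" using assms by (simp add: finitely_aligned_def)
qed

text \<open>
  The path \<open>\<mu> \<cdot> \<nu>\<close> is itself the only minimal common extension of \<open>\<mu>\<close> and \<open>\<mu> \<cdot> \<nu>\<close>.
\<close>

lemma Lambda_min_prefix:
  assumes \<mu>: "\<mu> \<in> paths \<Lambda>" and \<nu>: "\<nu> \<in> paths \<Lambda>" and c: "src \<Lambda> \<mu> = rng \<Lambda> \<nu>"
  shows "Lambda_min \<Lambda> \<mu> (\<mu> \<cdot> \<nu>) = {(\<nu>, src \<Lambda> \<nu>)}"
proof -
  have \<mu>\<nu>: "\<mu> \<cdot> \<nu> \<in> paths \<Lambda>" "deg \<Lambda> (\<mu> \<cdot> \<nu>) = deg \<Lambda> \<mu> + deg \<Lambda> \<nu>" "src \<Lambda> (\<mu> \<cdot> \<nu>) = src \<Lambda> \<nu>"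
    using assms by (auto intro: cmp_closed deg_cmp src_cmp)
  have sup: "sup (deg \<Lambda> \<mu>) (deg \<Lambda> \<mu> + deg \<Lambda> \<nu>) = deg \<Lambda> \<mu> + deg \<Lambda> \<nu>"
    by (auto simp: fun_eq_iff sup_nat_def)
  have id: "\<mu> \<cdot> \<nu> \<cdot> src \<Lambda> \<nu> = \<mu> \<cdot> \<nu>" using src_id[OF \<mu>\<nu>(1)] \<mu>\<nu>(3) by simp
  show ?thesis
  proof (rule equalityI; rule subrelI)
    fix \<alpha> \<beta> assume "(\<alpha>, \<beta>) \<in> Lambda_min \<Lambda> \<mu> (\<mu> \<cdot> \<nu>)"
    then have *: "\<alpha> \<in> paths \<Lambda>" "\<beta> \<in> paths \<Lambda>" "src \<Lambda> \<mu> = rng \<Lambda> \<alpha>" "src \<Lambda> \<nu> = rng \<Lambda> \<beta>"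
      "\<mu> \<cdot> \<alpha> = \<mu> \<cdot> \<nu> \<cdot> \<beta>" "deg \<Lambda> (\<mu> \<cdot> \<alpha>) = deg \<Lambda> \<mu> + deg \<Lambda> \<nu>"
      by (auto simp: Lambda_min_iff[OF \<mu> \<mu>\<nu>(1)] \<mu>\<nu> sup)
    have "deg \<Lambda> (\<mu> \<cdot> \<nu> \<cdot> \<beta>) = deg \<Lambda> \<mu> + deg \<Lambda> \<nu> + deg \<Lambda> \<beta>"
      using deg_cmp[OF \<mu>\<nu>(1) *(2)] \<mu>\<nu> * by simp
    then have "deg \<Lambda> \<beta> = 0" using * by simp
    then have \<beta>: "\<beta> = src \<Lambda> \<nu>" using * deg_zero_id by metis
    then have "\<mu> \<cdot> \<alpha> = \<mu> \<cdot> \<nu>" using *(5) id by metis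
    then have "\<alpha> = \<nu>" by (rule left_cancel[OF \<mu> *(1) \<nu> *(3) c])
    with \<beta> show "(\<alpha>, \<beta>) \<in> {(\<nu>, src \<Lambda> \<nu>)}" by simp
  next
    have "(\<nu>, src \<Lambda> \<nu>) \<in> Lambda_min \<Lambda> \<mu> (\<mu> \<cdot> \<nu>)"
      using assms \<mu>\<nu> id by (simp add: Lambda_min_iff sup src_closed rng_src)
    then show "(\<alpha>, \<beta>) \<in> Lambda_min \<Lambda> \<mu> (\<mu> \<cdot> \<nu>)" if "(\<alpha>, \<beta>) \<in> {(\<nu>, src \<Lambda> \<nu>)}" for \<alpha> \<beta>
      using that by simp
  qed
qed

lemma Lambda_min_self:
  assumes \<mu>: "\<mu> \<in> paths \<Lambda>" shows "Lambda_min \<Lambda> \<mu> \<mu> = {(src \<Lambda> \<mu>, src \<Lambda> \<mu>)}"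
  using Lambda_min_prefix[OF \<mu> src_closed[OF \<mu>]] \<mu> by (simp add: rng_src src_src src_id)

lemma Ext_singleton_iff:
  assumes "\<mu> \<in> paths \<Lambda>" "\<sigma> \<in> paths \<Lambda>"
  shows "\<alpha> \<in> Ext \<Lambda> \<mu> {\<sigma>} \<longleftrightarrow> (\<exists>\<beta>. (\<alpha>, \<beta>) \<in> Lambda_min \<Lambda> \<mu> \<sigma>)"
  unfolding Ext_def paths_into_def using Lambda_min_iff[OF assms] by auto

lemma finite_Ext_singleton:
  assumes "finitely_aligned \<Lambda>" "\<mu> \<in> paths \<Lambda>" "\<sigma> \<in> paths \<Lambda>"
  shows "finite (Ext \<Lambda> \<mu> {\<sigma>})"
proof (rule finite_subset)
  show "Ext \<Lambda> \<mu> {\<sigma>} \<subseteq> fst ` Lambda_min \<Lambda> \<mu> \<sigma>"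
    using Ext_singleton_iff[OF assms(2,3)] by force
qed (use finite_Lambda_min[OF assms] in simp)

lemma Pi_closure_paths:
  assumes E: "E \<subseteq> paths \<Lambda>" shows "Pi_closure \<Lambda> E \<subseteq> paths \<Lambda>"
proof
  fix \<kappa> assume "\<kappa> \<in> Pi_closure \<Lambda> E"
  then show "\<kappa> \<in> paths \<Lambda>"
  proof induction
    case (ext \<kappa> \<mu> \<sigma> \<alpha>)
    then show ?case by (intro cmp_closed) (auto simp: Ext_def paths_into_def)
  qed (use E in auto)
qed

end

lemma finite_fun_le: "finite {m :: 'k::finite \<Rightarrow> nat. m \<le> n}"
proof (rule finite_subset)
  show "{m. m \<le> n} \<subseteq> (\<Pi>\<^sub>E i\<in>UNIV. {..n i})" by (auto simp: le_fun_def)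
qed (auto intro: finite_PiE)

text \<open>
  Degrees in the closure stay below the sum of the degrees in \<open>E\<close>, so it is enough to bound the
  paths of one degree \<open>n\<close>, given finiteness in the lower degrees. A path of degree \<open>n\<close> lies in \<open>E\<close>, or
  is \<open>\<kappa> \<cdot> \<alpha>\<close> with \<open>\<kappa>\<close>, \<open>\<mu>\<close>, \<open>\<sigma>\<close> all of lower degree; call these the new paths. Otherwise
  it arises by replacing initial segments of a path of degree \<open>n\<close>, and repeated replacements
  collapse to a single one, made in a new path: two successive initial segments that are replaced have a common
  extension inside the path, and this extension already lies in the closure.
\<close>

lemma (in k_graph) finite_Pi_closure:
  assumes fa: "finitely_aligned \<Lambda>" and E: "E \<subseteq> paths \<Lambda>" "finite E"
  shows "finite (Pi_closure \<Lambda> E)"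
proof -
  define G where "G = Pi_closure \<Lambda> E"
  have Gp: "\<kappa> \<in> paths \<Lambda>" if "\<kappa> \<in> G" for \<kappa> using Pi_closure_paths[OF E(1)] that by (auto simp: G_def)
  define N where "N i = (\<Sum>\<mu>\<in>E. deg \<Lambda> \<mu> i)" for i
  have bound: "deg \<Lambda> \<kappa> \<le> N" if "\<kappa> \<in> G" for \<kappa>
    using that unfolding G_def
  proof induction
    case (base \<mu>)
    then show ?case unfolding N_def le_fun_def using E(2) by (auto intro: member_le_sum)
  next
    case (ext \<kappa> \<mu> \<sigma> \<alpha>)
    have p: "\<kappa> \<in> paths \<Lambda>" "\<mu> \<in> paths \<Lambda>" "\<sigma> \<in> paths \<Lambda>"
      using ext.hyps Gp by (auto simp: G_def)
    obtain \<beta> where "(\<alpha>, \<beta>) \<in> Lambda_min \<Lambda> \<mu> \<sigma>" using ext.hyps(6) Ext_singleton_iff[OF p(2,3)] by blast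
    then have l: "\<alpha> \<in> paths \<Lambda>" "src \<Lambda> \<mu> = rng \<Lambda> \<alpha>" "deg \<Lambda> (\<mu> \<cdot> \<alpha>) = sup (deg \<Lambda> \<mu>) (deg \<Lambda> \<sigma>)"
      using Lambda_min_iff[OF p(2,3)] by auto
    have "deg \<Lambda> (\<kappa> \<cdot> \<alpha>) = deg \<Lambda> (\<mu> \<cdot> \<alpha>)"
      using deg_cmp[OF p(1) l(1)] deg_cmp[OF p(2) l(1)] l ext.hyps by simp
    then show ?case using l ext.IH by (auto simp: le_fun_def)
  qed
  have fin: "finite {\<kappa> \<in> G. deg \<Lambda> \<kappa> = n}" for n
  proof (induction "\<Sum>i\<in>UNIV. n i" arbitrary: n rule: less_induct)
    case less
    define L where "L = {\<kappa> \<in> G. deg \<Lambda> \<kappa> \<le> n \<and> deg \<Lambda> \<kappa> \<noteq> n}"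
    have "L \<subseteq> (\<Union>m\<in>{m. m \<le> n \<and> m \<noteq> n}. {\<kappa> \<in> G. deg \<Lambda> \<kappa> = m})" by (auto simp: L_def)
    moreover have "finite {\<kappa> \<in> G. deg \<Lambda> \<kappa> = m}" if "m \<le> n" "m \<noteq> n" for m
    proof (rule less)
      obtain i where "m i \<noteq> n i" using \<open>m \<noteq> n\<close> by auto
      then have "m i < n i" using \<open>m \<le> n\<close> by (simp add: le_fun_def order.not_eq_order_implies_strict)
      then show "sum m UNIV < sum n UNIV" using \<open>m \<le> n\<close> by (intro sum_strict_mono_ex1) (auto simp: le_fun_def)
    qed
    moreover have "finite {m. m \<le> n \<and> m \<noteq> n}" by (rule finite_subset[OF _ finite_fun_le[of n]]) auto
    ultimately have finL: "finite L" by (auto intro: finite_subset)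
    \<comment> \<open>\<open>T\<close> contains the new paths of degree \<open>n\<close>, and \<open>S\<close> adds the results of one replacement.\<close>
    define T where "T = E \<union> (\<Union>\<kappa>\<in>L. \<Union>\<mu>\<in>L. \<Union>\<sigma>\<in>L. (\<lambda>\<alpha>. \<kappa> \<cdot> \<alpha>) ` Ext \<Lambda> \<mu> {\<sigma>})"
    have "finite (Ext \<Lambda> \<mu> {\<sigma>})" if "\<mu> \<in> L" "\<sigma> \<in> L" for \<mu> \<sigma>
      using that Gp finite_Ext_singleton[OF fa] by (auto simp: L_def)
    then have finT: "finite T" using finL E by (auto simp: T_def)
    define S where "S = T \<union> (\<Union>\<kappa>\<in>L. \<Union>\<rho>\<in>T. {\<kappa> \<cdot> \<tau> |\<tau> \<nu>. \<tau> \<in> paths \<Lambda> \<and> \<nu> \<in> paths \<Lambda> \<and>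
        src \<Lambda> \<kappa> = rng \<Lambda> \<tau> \<and> src \<Lambda> \<nu> = rng \<Lambda> \<tau> \<and> deg \<Lambda> \<nu> = deg \<Lambda> \<kappa> \<and> \<rho> = \<nu> \<cdot> \<tau>})"
    have "finite {\<kappa> \<cdot> \<tau> |\<tau> \<nu>. \<tau> \<in> paths \<Lambda> \<and> \<nu> \<in> paths \<Lambda> \<and>
        src \<Lambda> \<kappa> = rng \<Lambda> \<tau> \<and> src \<Lambda> \<nu> = rng \<Lambda> \<tau> \<and> deg \<Lambda> \<nu> = deg \<Lambda> \<kappa> \<and> \<rho> = \<nu> \<cdot> \<tau>}" (is "finite ?X") for \<kappa> \<rho>
    proof (cases "?X = {}")
      case False
      then obtain x where "x \<in> ?X" by blast
      then obtain \<tau> \<nu> where *: "\<tau> \<in> paths \<Lambda>" "\<nu> \<in> paths \<Lambda>" "src \<Lambda> \<nu> = rng \<Lambda> \<tau>"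
        "deg \<Lambda> \<nu> = deg \<Lambda> \<kappa>" "\<rho> = \<nu> \<cdot> \<tau>" by auto
      have "?X \<subseteq> {\<kappa> \<cdot> \<tau>}"
      proof
        fix y assume "y \<in> ?X"
        then obtain \<tau>' \<nu>' where y: "y = \<kappa> \<cdot> \<tau>'" "\<tau>' \<in> paths \<Lambda>" "\<nu>' \<in> paths \<Lambda>" "src \<Lambda> \<nu>' = rng \<Lambda> \<tau>'"
          "deg \<Lambda> \<nu>' = deg \<Lambda> \<kappa>" "\<rho> = \<nu>' \<cdot> \<tau>'" by auto
        then have "\<tau>' = \<tau>" using factor_unique(2)[OF y(3,2) *(2,1) y(4) *(3)] * by simp
        then show "y \<in> {\<kappa> \<cdot> \<tau>}" using y by simp
      qed
      then show ?thesis by (rule finite_subset) simp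
    next
      case True
      then show ?thesis by (simp only: finite.emptyI)
    qed
    then have finS: "finite S" using finL finT by (auto simp: S_def)
    have S_I: "\<kappa> \<cdot> \<tau> \<in> S" if "\<kappa> \<in> L" "\<nu> \<cdot> \<tau> \<in> T" "\<tau> \<in> paths \<Lambda>" "\<nu> \<in> paths \<Lambda>"
      "src \<Lambda> \<kappa> = rng \<Lambda> \<tau>" "src \<Lambda> \<nu> = rng \<Lambda> \<tau>" "deg \<Lambda> \<nu> = deg \<Lambda> \<kappa>" for \<kappa> \<nu> \<tau>
      unfolding S_def
      by (rule UnI2, rule UN_I[OF that(1)], rule UN_I[OF that(2)], rule CollectI)
         (intro exI[of _ \<tau>] exI[of _ \<nu>] conjI refl that)
    have "deg \<Lambda> \<tau> = n \<longrightarrow> \<tau> \<in> S" if "\<tau> \<in> G" for \<tau>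
      using that unfolding G_def
    proof induction
      case (base \<mu>)
      then show ?case by (simp add: S_def T_def)
    next
      case (ext \<kappa> \<mu> \<sigma> \<alpha>)
      have G: "\<kappa> \<in> G" "\<mu> \<in> G" "\<sigma> \<in> G" using ext.hyps by (auto simp: G_def)
      note p = Gp[OF G(1)] Gp[OF G(2)] Gp[OF G(3)]
      obtain \<beta> where "(\<alpha>, \<beta>) \<in> Lambda_min \<Lambda> \<mu> \<sigma>" using ext.hyps(6) Ext_singleton_iff[OF p(2,3)] by blast
      then have l: "\<alpha> \<in> paths \<Lambda>" "\<beta> \<in> paths \<Lambda>" "src \<Lambda> \<mu> = rng \<Lambda> \<alpha>" "src \<Lambda> \<sigma> = rng \<Lambda> \<beta>"
        "\<mu> \<cdot> \<alpha> = \<sigma> \<cdot> \<beta>" "deg \<Lambda> (\<mu> \<cdot> \<alpha>) = sup (deg \<Lambda> \<mu>) (deg \<Lambda> \<sigma>)"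
        using Lambda_min_iff[OF p(2,3)] by auto
      have dk: "deg \<Lambda> (\<kappa> \<cdot> \<alpha>) = deg \<Lambda> (\<mu> \<cdot> \<alpha>)"
        using deg_cmp[OF p(1) l(1)] deg_cmp[OF p(2) l(1)] l ext.hyps by simp
      show ?case
      proof
        assume n: "deg \<Lambda> (\<kappa> \<cdot> \<alpha>) = n"
        \<comment> \<open>Either the step is trivial, or it creates a new path, or it replaces \<open>\<mu>\<close> by \<open>\<kappa>\<close> in \<open>\<sigma>\<close>.\<close>
        then have sup: "sup (deg \<Lambda> \<mu>) (deg \<Lambda> \<sigma>) = n" using dk l by simp
        then have le: "deg \<Lambda> \<mu> \<le> n" "deg \<Lambda> \<sigma> \<le> n" by auto
        consider "deg \<Lambda> \<mu> = n" | "deg \<Lambda> \<mu> \<noteq> n" "deg \<Lambda> \<sigma> \<noteq> n" | "deg \<Lambda> \<mu> \<noteq> n" "deg \<Lambda> \<sigma> = n" by blast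
        then show "\<kappa> \<cdot> \<alpha> \<in> S"
        proof cases
          case 1
          then have "deg \<Lambda> \<alpha> = 0" using n dk deg_cmp[OF p(2) l(1)] l by simp
          then have "\<alpha> = src \<Lambda> \<kappa>" using deg_zero_id l ext.hyps by metis
          then show ?thesis using ext.IH ext.hyps 1 src_id[OF p(1)] by simp
        next
          case 2
          then have "\<kappa> \<in> L" "\<mu> \<in> L" "\<sigma> \<in> L" using le ext.hyps G by (auto simp: L_def)
          then show ?thesis using ext.hyps(6) by (auto simp: S_def T_def)
        next
          case 3
          then have L: "\<kappa> \<in> L" "\<mu> \<in> L" using le ext.hyps G by (auto simp: L_def)
          have "deg \<Lambda> \<beta> = 0" using 3 n dk deg_cmp[OF p(3) l(2)] l by simp
          then have "\<beta> = src \<Lambda> \<sigma>" using deg_zero_id l by metis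
          then have \<sigma>: "\<sigma> = \<mu> \<cdot> \<alpha>" using l src_id[OF p(3)] by simp
          have "\<sigma> \<in> S" using ext.IH 3 by simp
          then consider "\<sigma> \<in> T" | \<kappa>' \<rho> \<tau> \<nu> where "\<kappa>' \<in> L" "\<rho> \<in> T" "\<sigma> = \<kappa>' \<cdot> \<tau>" "\<tau> \<in> paths \<Lambda>" "\<nu> \<in> paths \<Lambda>"
            "src \<Lambda> \<nu> = rng \<Lambda> \<tau>" "deg \<Lambda> \<nu> = deg \<Lambda> \<kappa>'" "\<rho> = \<nu> \<cdot> \<tau>" "src \<Lambda> \<kappa>' = rng \<Lambda> \<tau>"
            unfolding S_def by blast
          then show ?thesis
          proof cases
            case 1
            then show ?thesis using S_I[OF L(1) _ l(1) p(2) _ l(3)] \<sigma> ext.hyps l(3) by simp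
          next
            case (2 \<kappa>' \<rho> \<tau> \<nu>)
            have p': "\<kappa>' \<in> paths \<Lambda>" and G': "\<kappa>' \<in> G" using 2 Gp by (auto simp: L_def)
            \<comment> \<open>\<open>\<xi>\<close> is the minimal common extension inside \<open>\<sigma>\<close> of the two segments \<open>\<mu>\<close> and \<open>\<kappa>'\<close>.\<close>
            define m where "m = sup (deg \<Lambda> \<mu>) (deg \<Lambda> \<kappa>')"
            have "m \<le> n" using L 2(1) by (auto simp: m_def L_def)
            then obtain \<xi> \<omega> where \<xi>: "\<xi> \<in> paths \<Lambda>" "\<omega> \<in> paths \<Lambda>" "src \<Lambda> \<xi> = rng \<Lambda> \<omega>"
              "deg \<Lambda> \<xi> = m" "\<sigma> = \<xi> \<cdot> \<omega>"
              using factor_ex[OF p(3), of m] 3 by auto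
            obtain \<alpha>' where \<alpha>': "\<alpha>' \<in> paths \<Lambda>" "src \<Lambda> \<mu> = rng \<Lambda> \<alpha>'" "\<xi> = \<mu> \<cdot> \<alpha>'"
              using prefix_factor[OF p(2) l(1) l(3) \<xi>(1,2,3)] \<sigma> \<xi> by (auto simp: m_def)
            obtain \<beta>' where \<beta>': "\<beta>' \<in> paths \<Lambda>" "src \<Lambda> \<kappa>' = rng \<Lambda> \<beta>'" "\<xi> = \<kappa>' \<cdot> \<beta>'"
              using prefix_factor[OF p' 2(4) 2(9) \<xi>(1,2,3)] 2 \<xi> by (auto simp: m_def)
            have c: "src \<Lambda> \<alpha>' = rng \<Lambda> \<omega>" "src \<Lambda> \<beta>' = rng \<Lambda> \<omega>"
              using src_cmp[OF p(2) \<alpha>'(1,2)] src_cmp[OF p' \<beta>'(1,2)] \<alpha>' \<beta>' \<xi>(3) by auto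
            have "\<mu> \<cdot> \<alpha> = \<mu> \<cdot> (\<alpha>' \<cdot> \<omega>)"
              using cmp_assoc[OF p(2) \<alpha>'(1) \<xi>(2) \<alpha>'(2) c(1)] \<alpha>'(3) \<xi>(5) \<sigma> by metis
            then have \<alpha>\<omega>: "\<alpha> = \<alpha>' \<cdot> \<omega>"
              by (rule left_cancel[OF p(2) l(1) cmp_closed[OF \<alpha>'(1) \<xi>(2) c(1)] l(3), rotated])
                 (simp add: rng_cmp[OF \<alpha>'(1) \<xi>(2) c(1)] \<alpha>'(2))
            have "\<kappa>' \<cdot> \<tau> = \<kappa>' \<cdot> (\<beta>' \<cdot> \<omega>)"
              using cmp_assoc[OF p' \<beta>'(1) \<xi>(2) \<beta>'(2) c(2)] \<beta>'(3) \<xi>(5) 2(3) by metis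
            then have \<tau>\<omega>: "\<tau> = \<beta>' \<cdot> \<omega>"
              by (rule left_cancel[OF p' 2(4) cmp_closed[OF \<beta>'(1) \<xi>(2) c(2)] 2(9), rotated])
                 (simp add: rng_cmp[OF \<beta>'(1) \<xi>(2) c(2)] \<beta>'(2))
            have kc: "src \<Lambda> \<kappa> = rng \<Lambda> \<alpha>'" using ext.hyps \<alpha>' by simp
            have \<kappa>\<alpha>: "\<kappa> \<cdot> \<alpha> = \<kappa> \<cdot> \<alpha>' \<cdot> \<omega>"
              using cmp_assoc[OF p(1) \<alpha>'(1) \<xi>(2) kc c(1)] \<alpha>\<omega> by simp
            have "(\<alpha>', \<beta>') \<in> Lambda_min \<Lambda> \<mu> \<kappa>'"
              using Lambda_min_iff[OF p(2) p'] \<alpha>' \<beta>' \<xi>(4) by (simp add: m_def)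
            then have ex: "\<alpha>' \<in> Ext \<Lambda> \<mu> {\<kappa>'}" using Ext_singleton_iff[OF p(2) p'] by blast
            have \<kappa>\<alpha>': "\<kappa> \<cdot> \<alpha>' \<in> paths \<Lambda>" "src \<Lambda> (\<kappa> \<cdot> \<alpha>') = rng \<Lambda> \<omega>" "\<kappa> \<cdot> \<alpha>' \<in> G"
              using cmp_closed[OF p(1) \<alpha>'(1) kc] src_cmp[OF p(1) \<alpha>'(1) kc] c(1)
                Pi_closure.ext[OF _ _ _ ext.hyps(4,5) ex] G G' by (auto simp: G_def)
            have dm: "deg \<Lambda> (\<kappa> \<cdot> \<alpha>') = m"
              using deg_cmp[OF p(1) \<alpha>'(1) kc] deg_cmp[OF p(2) \<alpha>'(1,2)] ext.hyps(4) \<alpha>' \<xi>(4) by simp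
            show ?thesis
            proof (cases "m = n")
              case True
              then have "deg \<Lambda> \<omega> = 0" using deg_cmp[OF \<kappa>\<alpha>'(1) \<xi>(2) \<kappa>\<alpha>'(2)] dm n \<kappa>\<alpha> by simp
              then have "\<kappa> \<cdot> \<alpha> = \<kappa> \<cdot> \<alpha>'" using deg_zero_id[OF \<xi>(2)] src_id[OF \<kappa>\<alpha>'(1)] \<kappa>\<alpha>'(2) \<kappa>\<alpha> by simp
              then show ?thesis using L 2(1) ex by (auto simp: S_def T_def)
            next
              case False
              then have L': "\<kappa> \<cdot> \<alpha>' \<in> L" using dm \<kappa>\<alpha>'(3) \<open>m \<le> n\<close> by (simp add: L_def)
              have nc: "src \<Lambda> \<nu> = rng \<Lambda> \<beta>'" using 2(6,9) \<beta>'(2) by simp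
              have "\<nu> \<cdot> \<beta>' \<in> paths \<Lambda>" "src \<Lambda> (\<nu> \<cdot> \<beta>') = rng \<Lambda> \<omega>" "deg \<Lambda> (\<nu> \<cdot> \<beta>') = m" "\<rho> = \<nu> \<cdot> \<beta>' \<cdot> \<omega>"
                using cmp_closed[OF 2(5) \<beta>'(1) nc] src_cmp[OF 2(5) \<beta>'(1) nc] c(2) deg_cmp[OF 2(5) \<beta>'(1) nc]
                  deg_cmp[OF p' \<beta>'(1,2)] 2(7,8) \<beta>' \<xi>(4) cmp_assoc[OF 2(5) \<beta>'(1) \<xi>(2) nc c(2)] \<tau>\<omega> by simp_all
              then show ?thesis unfolding \<kappa>\<alpha> using S_I[OF L' _ \<xi>(2), of "\<nu> \<cdot> \<beta>'"] 2(2) \<kappa>\<alpha>'(2) dm by simp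
            qed
          qed
        qed
      qed
    qed
    then have "{\<kappa> \<in> G. deg \<Lambda> \<kappa> = n} \<subseteq> S" by auto
    then show ?case using finS by (rule finite_subset)
  qed
  have "G \<subseteq> (\<Union>m\<in>{m. m \<le> N}. {\<kappa> \<in> G. deg \<Lambda> \<kappa> = m})" using bound by auto
  then have "finite G" using fin finite_fun_le[of N] by (auto intro: finite_subset)
  then show ?thesis by (simp add: G_def)
qed

section \<open>Products of complements of commuting projections\<close>

context cstar_algebra
begin

lemma prod_act_empty: "x \<in> carrier A \<Longrightarrow> prod_act A f {} x = x"
  by (simp add: prod_act_def)

lemma prod_act_insert:
  assumes "finite S" "i \<notin> S" "x \<in> carrier A" "\<And>j. j \<in> insert i S \<Longrightarrow> f j \<in> carrier A"
    and "\<And>j l. \<lbrakk>j \<in> insert i S; l \<in> insert i S\<rbrakk> \<Longrightarrow> f j \<otimes> f l = f l \<otimes> f j"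
  shows "prod_act A f (insert i S) x = f i \<otimes> prod_act A f S x"
  unfolding prod_act_def
proof (rule LCD.foldD_insert[where B = "insert i S"])
  show "LCD (insert i S) (carrier A) (\<lambda>i y. f i \<otimes> y)"
    using assms(4,5) by unfold_locales (auto simp: mult_assoc[symmetric])
qed (use assms in auto)

end

text \<open>
  Outside the index set the factors may be arbitrary, even outside the carrier, so the congruence is
  proved for the underlying fold relation.
\<close>

lemma prod_act_cong:
  assumes "\<And>i. i \<in> S \<Longrightarrow> f i = g i" shows "prod_act A f S x = prod_act A g S x"
proof -
  have *: "(S, y) \<in> foldSetD (carrier A) (\<lambda>i y. g i \<otimes>\<^bsub>A\<^esub> y) x"
    if "(S, y) \<in> foldSetD (carrier A) (\<lambda>i y. f i \<otimes>\<^bsub>A\<^esub> y) x" "\<And>i. i \<in> S \<Longrightarrow> f i = g i" for f g y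
    using that
  proof (induction rule: foldSetD.induct)
    case emptyI
    then show ?case by (auto intro: foldSetD.emptyI)
  next
    case (insertI i X y)
    have "f i = g i" using insertI by simp
    then have "(insert i X, g i \<otimes>\<^bsub>A\<^esub> y) \<in> foldSetD (carrier A) (\<lambda>i y. g i \<otimes>\<^bsub>A\<^esub> y) x"
      using insertI by (intro foldSetD.insertI) auto
    then show ?case using \<open>f i = g i\<close> by simp
  qed
  have "(S, y) \<in> foldSetD (carrier A) (\<lambda>i y. f i \<otimes>\<^bsub>A\<^esub> y) x \<longleftrightarrow>
    (S, y) \<in> foldSetD (carrier A) (\<lambda>i y. g i \<otimes>\<^bsub>A\<^esub> y) x" for y
    using *[of y f g] *[of y g f] assms by (metis (no_types, lifting))
  then show ?thesis by (simp add: prod_act_def foldD_def)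
qed

lemma (in cstar_algebra) prod_act_closed:
  assumes "finite S" "x \<in> carrier A" "\<And>i. i \<in> S \<Longrightarrow> f i \<in> carrier A"
    "\<And>i j. \<lbrakk>i \<in> S; j \<in> S\<rbrakk> \<Longrightarrow> f i \<otimes> f j = f j \<otimes> f i"
  shows "prod_act A f S x \<in> carrier A"
  using assms(1,3,4)
proof (induction S rule: finite_induct)
  case (insert i S)
  have "prod_act A f (insert i S) x = f i \<otimes> prod_act A f S x"
    using insert.hyps assms(2) insert.prems by (rule prod_act_insert)
  moreover have "prod_act A f S x \<in> carrier A" using insert by simp
  ultimately show ?case using insert.prems(1) by simp
qed (use assms(2) in \<open>simp add: prod_act_empty\<close>)

lemma (in cstar_morphism) hom_prod_act:
  assumes "finite S" "x \<in> carrier A" "\<And>i. i \<in> S \<Longrightarrow> f i \<in> carrier A"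
    "\<And>i j. \<lbrakk>i \<in> S; j \<in> S\<rbrakk> \<Longrightarrow> f i \<otimes>\<^bsub>A\<^esub> f j = f j \<otimes>\<^bsub>A\<^esub> f i"
  shows "\<phi> (prod_act A f S x) = prod_act B (\<lambda>i. \<phi> (f i)) S (\<phi> x)"
  using assms(1,3,4)
proof (induction S rule: finite_induct)
  case empty
  then show ?case using assms(2) by (simp add: dom.prod_act_empty cod.prod_act_empty)
next
  case (insert i S)
  have c: "f j \<in> carrier A" if "j \<in> insert i S" for j using insert.prems(1) that by blast
  have m: "\<phi> (f j) \<otimes>\<^bsub>B\<^esub> \<phi> (f l) = \<phi> (f l) \<otimes>\<^bsub>B\<^esub> \<phi> (f j)" if "j \<in> insert i S" "l \<in> insert i S" for j l
    using insert.prems(2)[OF that] c[OF that(1)] c[OF that(2)] by (simp add: hom_mult[symmetric])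
  have p: "prod_act A f S x \<in> carrier A"
    using insert assms(2) by (intro dom.prod_act_closed) auto
  have "prod_act A f (insert i S) x = f i \<otimes>\<^bsub>A\<^esub> prod_act A f S x"
    using insert.hyps assms(2) c insert.prems(2) by (rule dom.prod_act_insert)
  moreover have "prod_act B (\<lambda>i. \<phi> (f i)) (insert i S) (\<phi> x) = \<phi> (f i) \<otimes>\<^bsub>B\<^esub> prod_act B (\<lambda>i. \<phi> (f i)) S (\<phi> x)"
    using insert.hyps assms(2) c m by (intro cod.prod_act_insert) auto
  ultimately show ?case using insert p c by (simp add: hom_mult)
qed

text \<open>
  The \<open>r i\<close> are commuting projections below the projection \<open>q\<close>. The product of the \<open>q - r i\<close> is
  the largest projection below \<open>q\<close> orthogonal to all of them, which is how it is used: it kills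
  every \<open>r i\<close>, and it fixes whatever lies below \<open>q\<close> and is killed by every \<open>r i\<close>.
\<close>

locale commuting_projections = cstar_algebra A for A :: "'a cstar" (structure) +
  fixes q :: 'a and r :: "'i \<Rightarrow> 'a" and S :: "'i set"
  assumes finite_S: "finite S" and q: "q \<in> carrier A" "adj A q = q" "q \<otimes> q = q"
    and r: "i \<in> S \<Longrightarrow> r i \<in> carrier A" "i \<in> S \<Longrightarrow> adj A (r i) = r i" "i \<in> S \<Longrightarrow> r i \<otimes> r i = r i"
    and qr: "i \<in> S \<Longrightarrow> q \<otimes> r i = r i"
    and r_comm: "\<lbrakk>i \<in> S; j \<in> S\<rbrakk> \<Longrightarrow> r i \<otimes> r j = r j \<otimes> r i"
begin

definition residue :: "'i set \<Rightarrow> 'a" where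
  "residue X = prod_act A (\<lambda>i. q \<ominus> r i) X q"

lemma rq: "i \<in> S \<Longrightarrow> r i \<otimes> q = r i"
  using qr[of i] r[of i] q adj_mult[of q "r i"] by simp

lemma factor_closed: "i \<in> S \<Longrightarrow> q \<ominus> r i \<in> carrier A" using q r by simp

lemma factor_comm: "\<lbrakk>i \<in> S; j \<in> S\<rbrakk> \<Longrightarrow> (q \<ominus> r i) \<otimes> (q \<ominus> r j) = (q \<ominus> r j) \<otimes> (q \<ominus> r i)"
  using q r r_comm[of i j] qr rq
  by (simp add: minus_eq_scale distrib_left distrib_right smult_mult_left smult_mult_right scale_simps M.a_ac)

lemma residue_empty: "residue {} = q" using q by (simp add: residue_def prod_act_empty)

lemma residue_insert: "\<lbrakk>X \<subseteq> S; i \<in> S; i \<notin> X\<rbrakk> \<Longrightarrow> residue (insert i X) = (q \<ominus> r i) \<otimes> residue X"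
  unfolding residue_def
  by (rule prod_act_insert) (auto intro!: factor_comm factor_closed finite_subset[OF _ finite_S] q)

lemma residue_induct [consumes 1, case_names empty insert]:
  assumes "X \<subseteq> S" "P {}" "\<And>i X. \<lbrakk>X \<subseteq> S; i \<in> S; i \<notin> X; P X\<rbrakk> \<Longrightarrow> P (insert i X)"
  shows "P X"
  using finite_subset[OF assms(1) finite_S] assms(1)
  by (induction X rule: finite_induct) (use assms(2,3) in auto)

lemma residue_closed: "X \<subseteq> S \<Longrightarrow> residue X \<in> carrier A"
  by (induction X rule: residue_induct) (use q factor_closed in \<open>auto simp: residue_empty residue_insert\<close>)

lemma residue_commute:
  assumes "X \<subseteq> S" and y: "y \<in> carrier A" "y \<otimes> q = q \<otimes> y" "\<And>i. i \<in> S \<Longrightarrow> y \<otimes> r i = r i \<otimes> y"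
  shows "y \<otimes> residue X = residue X \<otimes> y"
  using assms(1)
proof (induction X rule: residue_induct)
  case (insert i X)
  have "y \<otimes> (q \<ominus> r i) = (q \<ominus> r i) \<otimes> y" using insert y q r by (simp add: minus_distrib)
  then have "y \<otimes> ((q \<ominus> r i) \<otimes> residue X) = (q \<ominus> r i) \<otimes> (y \<otimes> residue X)"
    using y factor_closed[OF insert(2)] residue_closed[OF insert(1)] by (simp add: mult_assoc[symmetric])
  then show ?case
    using insert y factor_closed[OF insert(2)] residue_closed[OF insert(1)]
    by (simp add: residue_insert mult_assoc)
qed (use y in \<open>simp add: residue_empty\<close>)

lemma residue_adj: "X \<subseteq> S \<Longrightarrow> adj A (residue X) = residue X"
proof (induction X rule: residue_induct)
  case (insert i X)
  have "(q \<ominus> r i) \<otimes> residue X = residue X \<otimes> (q \<ominus> r i)"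
    using insert(1,2) q r qr rq r_comm
    by (intro residue_commute) (auto simp: minus_distrib)
  then show ?case
    using insert q r residue_closed[OF insert(1)]
    by (simp add: residue_insert adj_mult adj_minus)
qed (use q in \<open>simp add: residue_empty\<close>)

lemma q_residue: "X \<subseteq> S \<Longrightarrow> q \<otimes> residue X = residue X"
proof (induction X rule: residue_induct)
  case (insert i X)
  have "q \<otimes> (q \<ominus> r i) = q \<ominus> r i" using insert(2) q r qr by (simp add: minus_distrib)
  then show ?case using insert(1-3) q factor_closed[OF insert(2)] residue_closed[OF insert(1)]
    by (simp add: residue_insert mult_assoc[symmetric])
qed (use q in \<open>simp add: residue_empty\<close>)

lemma residue_q: "X \<subseteq> S \<Longrightarrow> residue X \<otimes> q = residue X"
  using residue_commute[of X q] q q_residue qr rq by simp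

lemma r_residue: "\<lbrakk>X \<subseteq> S; j \<in> X\<rbrakk> \<Longrightarrow> r j \<otimes> residue X = \<zero>"
proof (induction X rule: residue_induct)
  case (insert i X)
  then have j: "j \<in> S" by auto
  note c = factor_closed[OF insert(2)] residue_closed[OF insert(1)] r(1)[OF j]
  have ji: "r j \<otimes> (q \<ominus> r i) = (q \<ominus> r i) \<otimes> r j"
    using insert(2) j q r rq qr r_comm by (simp add: minus_distrib)
  show ?case
  proof (cases "j = i")
    case True
    have "r j \<otimes> (q \<ominus> r i) = \<zero>" using True j q r rq by (simp add: minus_distrib)
    then show ?thesis using insert c by (simp add: residue_insert mult_assoc[symmetric])
  next
    case False
    then have "r j \<otimes> residue X = \<zero>" using insert by auto
    then have "(q \<ominus> r i) \<otimes> (r j \<otimes> residue X) = \<zero>" using c by simp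
    then show ?thesis using insert(1-3) c ji by (simp add: residue_insert mult_assoc[symmetric])
  qed
qed simp

lemma residue_fixes:
  assumes "X \<subseteq> S" and x: "x \<in> carrier A" "q \<otimes> x = x" "\<And>i. i \<in> X \<Longrightarrow> r i \<otimes> x = \<zero>"
  shows "residue X \<otimes> x = x"
  using assms(1) x(3)
proof (induction X rule: residue_induct)
  case (insert i X)
  then show ?case
    using x(1,2) q r factor_closed[OF insert(2)] residue_closed[OF insert(1)]
    by (simp add: residue_insert mult_assoc minus_distrib)
qed (use x in \<open>simp add: residue_empty\<close>)

lemma prod_act_residue:
  assumes "X \<subseteq> S" and x: "x \<in> carrier A" "q \<otimes> x = x"
  shows "prod_act A (\<lambda>i. q \<ominus> r i) X x = residue X \<otimes> x"
  using assms(1)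
proof (induction X rule: residue_induct)
  case (insert i X)
  have "prod_act A (\<lambda>i. q \<ominus> r i) (insert i X) x = (q \<ominus> r i) \<otimes> prod_act A (\<lambda>i. q \<ominus> r i) X x"
    using insert(1-3) x
    by (intro prod_act_insert) (auto intro!: factor_comm factor_closed finite_subset[OF _ finite_S])
  then show ?case using insert x factor_closed[OF insert(2)] residue_closed[OF insert(1)]
    by (simp add: residue_insert mult_assoc)
qed (use x in \<open>simp add: residue_empty prod_act_empty\<close>)

end

section \<open>Toeplitz-Cuntz-Krieger families\<close>

text \<open>
  These are the relations shared by the families for all choices of \<open>\<E>\<close>. They make each \<open>t\<^sub>\<mu>\<close> a partial
  isometry, since \<open>t_star\<close> turns \<open>t\<^sub>\<mu>\<^sup>* t\<^sub>\<mu>\<close> into the projection at the source of \<open>\<mu>\<close>.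
\<close>

locale toeplitz_family = k_graph \<Lambda> + alg: cstar_algebra B
  for \<Lambda> :: "('p, 'k::finite) kgraph" (structure) and B :: "'a cstar" +
  fixes t :: "'p \<Rightarrow> 'a"
  assumes fa: "finitely_aligned \<Lambda>"
    and t_closed [simp, intro]: "\<mu> \<in> paths \<Lambda> \<Longrightarrow> t \<mu> \<in> carrier B"
    and t_vertex: "v \<in> vertices \<Lambda> \<Longrightarrow> projection B (t v)"
    and t_orthogonal: "\<lbrakk>v \<in> vertices \<Lambda>; w \<in> vertices \<Lambda>; v \<noteq> w\<rbrakk> \<Longrightarrow> t v \<otimes>\<^bsub>B\<^esub> t w = \<zero>\<^bsub>B\<^esub>"
    and t_cmp: "\<lbrakk>\<mu> \<in> paths \<Lambda>; \<nu> \<in> paths \<Lambda>; src \<Lambda> \<mu> = rng \<Lambda> \<nu>\<rbrakk> \<Longrightarrow> t \<mu> \<otimes>\<^bsub>B\<^esub> t \<nu> = t (\<mu> \<cdot> \<nu>)"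
    and t_star: "\<lbrakk>\<mu> \<in> paths \<Lambda>; \<nu> \<in> paths \<Lambda>\<rbrakk> \<Longrightarrow> adj B (t \<mu>) \<otimes>\<^bsub>B\<^esub> t \<nu> =
        (\<Oplus>\<^bsub>B\<^esub>q\<in>Lambda_min \<Lambda> \<mu> \<nu>. t (fst q) \<otimes>\<^bsub>B\<^esub> adj B (t (snd q)))"

lemma toeplitz_family_if_rel_CK:
  assumes "k_graph \<Lambda>" "finitely_aligned \<Lambda>" "cstar_algebra B" "rel_CK_family \<Lambda> \<E> B t"
  shows "toeplitz_family \<Lambda> B t"
proof -
  interpret k_graph \<Lambda> by fact
  interpret cstar_algebra B by fact
  note CK = assms(4)[unfolded rel_CK_family_def]
  show ?thesis
  proof unfold_locales
    show "finitely_aligned \<Lambda>" by fact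
    show "t \<mu> \<in> carrier B" if "\<mu> \<in> paths \<Lambda>" for \<mu>
      using CK[THEN conjunct1] that by (simp add: partial_isometry_def)
    note CK = CK[THEN conjunct2]
    show "projection B (t v)" if "v \<in> vertices \<Lambda>" for v using CK[THEN conjunct1] that by simp
    note CK = CK[THEN conjunct2]
    show "t v \<otimes>\<^bsub>B\<^esub> t w = \<zero>\<^bsub>B\<^esub>" if "v \<in> vertices \<Lambda>" "w \<in> vertices \<Lambda>" "v \<noteq> w" for v w
      using CK[THEN conjunct1] that by simp
    note CK = CK[THEN conjunct2]
    show "t \<mu> \<otimes>\<^bsub>B\<^esub> t \<nu> = t (\<mu> \<cdot>\<^bsub>\<Lambda>\<^esub> \<nu>)" if "\<mu> \<in> paths \<Lambda>" "\<nu> \<in> paths \<Lambda>" "src \<Lambda> \<mu> = rng \<Lambda> \<nu>" for \<mu> \<nu>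
      using CK[THEN conjunct1] that by simp
    note CK = CK[THEN conjunct2]
    show "adj B (t \<mu>) \<otimes>\<^bsub>B\<^esub> t \<nu> = (\<Oplus>\<^bsub>B\<^esub>q\<in>Lambda_min \<Lambda> \<mu> \<nu>. t (fst q) \<otimes>\<^bsub>B\<^esub> adj B (t (snd q)))"
      if "\<mu> \<in> paths \<Lambda>" "\<nu> \<in> paths \<Lambda>" for \<mu> \<nu>
      using CK[THEN conjunct1] that by simp
  qed
qed

context toeplitz_family
begin

lemma src_vertex: "\<mu> \<in> paths \<Lambda> \<Longrightarrow> src \<Lambda> \<mu> \<in> vertices \<Lambda>"
  by (simp add: vertices_def src_closed deg_src)

lemma t_src:
  assumes "\<mu> \<in> paths \<Lambda>"
  shows "t (src \<Lambda> \<mu>) \<in> carrier B" "adj B (t (src \<Lambda> \<mu>)) = t (src \<Lambda> \<mu>)"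
    "t (src \<Lambda> \<mu>) \<otimes>\<^bsub>B\<^esub> t (src \<Lambda> \<mu>) = t (src \<Lambda> \<mu>)"
  using t_vertex[OF src_vertex[OF assms]] by (auto simp: projection_def)

lemma t_mult_src: "\<mu> \<in> paths \<Lambda> \<Longrightarrow> t \<mu> \<otimes>\<^bsub>B\<^esub> t (src \<Lambda> \<mu>) = t \<mu>"
  using t_cmp[of \<mu> "src \<Lambda> \<mu>"] by (simp add: src_closed rng_src src_id)

lemma rng_mult_t: "\<mu> \<in> paths \<Lambda> \<Longrightarrow> t (rng \<Lambda> \<mu>) \<otimes>\<^bsub>B\<^esub> t \<mu> = t \<mu>"
  using t_cmp[of "rng \<Lambda> \<mu>" \<mu>] by (simp add: rng_closed src_rng rng_id)

lemma src_mult_star: "\<mu> \<in> paths \<Lambda> \<Longrightarrow> t (src \<Lambda> \<mu>) \<otimes>\<^bsub>B\<^esub> adj B (t \<mu>) = adj B (t \<mu>)"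
  using arg_cong[OF t_mult_src, of \<mu> "adj B"] t_src[of \<mu>] by (simp add: alg.adj_mult)

lemma star_mult_self: "\<mu> \<in> paths \<Lambda> \<Longrightarrow> adj B (t \<mu>) \<otimes>\<^bsub>B\<^esub> t \<mu> = t (src \<Lambda> \<mu>)"
  using t_star[of \<mu> \<mu>] t_src[of \<mu>] by (simp add: Lambda_min_self alg.M.finsum_insert)

lemma star_mult_prefix:
  assumes "\<mu> \<in> paths \<Lambda>" "\<nu> \<in> paths \<Lambda>" "src \<Lambda> \<mu> = rng \<Lambda> \<nu>"
  shows "adj B (t \<mu>) \<otimes>\<^bsub>B\<^esub> t (\<mu> \<cdot> \<nu>) = t \<nu>"
proof -
  have "adj B (t \<mu>) \<otimes>\<^bsub>B\<^esub> t (\<mu> \<cdot> \<nu>) = adj B (t \<mu>) \<otimes>\<^bsub>B\<^esub> t \<mu> \<otimes>\<^bsub>B\<^esub> t \<nu>"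
    using assms by (simp add: t_cmp[symmetric] alg.mult_assoc)
  then show ?thesis using assms by (simp add: star_mult_self rng_mult_t)
qed

lemma star_cmp:
  assumes "\<mu> \<in> paths \<Lambda>" "\<nu> \<in> paths \<Lambda>" "src \<Lambda> \<mu> = rng \<Lambda> \<nu>"
  shows "adj B (t \<nu>) \<otimes>\<^bsub>B\<^esub> adj B (t \<mu>) = adj B (t (\<mu> \<cdot> \<nu>))"
  using assms by (simp add: t_cmp[symmetric] alg.adj_mult)

definition range_proj :: "'p \<Rightarrow> 'a" where "range_proj \<mu> = t \<mu> \<otimes>\<^bsub>B\<^esub> adj B (t \<mu>)"

lemma range_proj_closed [simp, intro]: "\<mu> \<in> paths \<Lambda> \<Longrightarrow> range_proj \<mu> \<in> carrier B"
  by (simp add: range_proj_def)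

lemma range_proj_adj: "\<mu> \<in> paths \<Lambda> \<Longrightarrow> adj B (range_proj \<mu>) = range_proj \<mu>"
  by (simp add: range_proj_def alg.adj_mult alg.adj_adj)

lemma range_proj_mult_t: "\<mu> \<in> paths \<Lambda> \<Longrightarrow> range_proj \<mu> \<otimes>\<^bsub>B\<^esub> t \<mu> = t \<mu>"
  by (simp add: range_proj_def alg.mult_assoc star_mult_self t_mult_src)

lemma range_proj_idem: "\<mu> \<in> paths \<Lambda> \<Longrightarrow> range_proj \<mu> \<otimes>\<^bsub>B\<^esub> range_proj \<mu> = range_proj \<mu>"
  unfolding range_proj_def[of \<mu>] using range_proj_mult_t[of \<mu>, unfolded range_proj_def]
  by (simp add: alg.mult_assoc[symmetric])

lemma range_proj_below: "\<mu> \<in> paths \<Lambda> \<Longrightarrow> t (rng \<Lambda> \<mu>) \<otimes>\<^bsub>B\<^esub> range_proj \<mu> = range_proj \<mu>"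
  by (simp add: range_proj_def alg.mult_assoc[symmetric] rng_mult_t rng_closed)

text \<open>
  The middle factor \<open>t\<^sub>\<mu>\<^sup>* t\<^sub>\<nu>\<close> is expanded by \<open>t_star\<close>. Thus the elements \<open>t\<^sub>\<kappa> t\<^sub>\<mu>\<^sup>*\<close> span an algebra.
\<close>

lemma product_expansion:
  assumes p: "\<kappa> \<in> paths \<Lambda>" "\<mu> \<in> paths \<Lambda>" "\<nu> \<in> paths \<Lambda>" "\<rho> \<in> paths \<Lambda>"
    and s: "src \<Lambda> \<kappa> = src \<Lambda> \<mu>" "src \<Lambda> \<nu> = src \<Lambda> \<rho>"
  shows "(t \<kappa> \<otimes>\<^bsub>B\<^esub> adj B (t \<mu>)) \<otimes>\<^bsub>B\<^esub> (t \<nu> \<otimes>\<^bsub>B\<^esub> adj B (t \<rho>)) =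
    (\<Oplus>\<^bsub>B\<^esub>q\<in>Lambda_min \<Lambda> \<mu> \<nu>. t (\<kappa> \<cdot> fst q) \<otimes>\<^bsub>B\<^esub> adj B (t (\<rho> \<cdot> snd q)))"
proof -
  let ?L = "Lambda_min \<Lambda> \<mu> \<nu>"
  have L: "fst q \<in> paths \<Lambda>" "snd q \<in> paths \<Lambda>" "src \<Lambda> \<kappa> = rng \<Lambda> (fst q)" "src \<Lambda> \<rho> = rng \<Lambda> (snd q)"
    if "q \<in> ?L" for q
    using that Lambda_min_iff[OF p(2,3), of "fst q" "snd q"] s by simp_all
  note fin = finite_Lambda_min[OF fa p(2,3)]
  have "(t \<kappa> \<otimes>\<^bsub>B\<^esub> adj B (t \<mu>)) \<otimes>\<^bsub>B\<^esub> (t \<nu> \<otimes>\<^bsub>B\<^esub> adj B (t \<rho>)) =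
    t \<kappa> \<otimes>\<^bsub>B\<^esub> (adj B (t \<mu>) \<otimes>\<^bsub>B\<^esub> t \<nu>) \<otimes>\<^bsub>B\<^esub> adj B (t \<rho>)"
    using p by (simp add: alg.mult_assoc)
  also have "\<dots> = (\<Oplus>\<^bsub>B\<^esub>q\<in>?L. t \<kappa> \<otimes>\<^bsub>B\<^esub> (t (fst q) \<otimes>\<^bsub>B\<^esub> adj B (t (snd q))) \<otimes>\<^bsub>B\<^esub> adj B (t \<rho>))"
    using p L fin by (simp add: t_star alg.finsum_mult_left alg.finsum_mult_right Pi_iff)
  also have "\<dots> = (\<Oplus>\<^bsub>B\<^esub>q\<in>?L. t (\<kappa> \<cdot> fst q) \<otimes>\<^bsub>B\<^esub> adj B (t (\<rho> \<cdot> snd q)))"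
  proof (rule alg.M.finsum_cong')
    fix q assume q: "q \<in> ?L"
    have "t \<kappa> \<otimes>\<^bsub>B\<^esub> (t (fst q) \<otimes>\<^bsub>B\<^esub> adj B (t (snd q))) \<otimes>\<^bsub>B\<^esub> adj B (t \<rho>) =
      (t \<kappa> \<otimes>\<^bsub>B\<^esub> t (fst q)) \<otimes>\<^bsub>B\<^esub> (adj B (t (snd q)) \<otimes>\<^bsub>B\<^esub> adj B (t \<rho>))"
      using p L[OF q] by (simp add: alg.mult_assoc)
    then show "t \<kappa> \<otimes>\<^bsub>B\<^esub> (t (fst q) \<otimes>\<^bsub>B\<^esub> adj B (t (snd q))) \<otimes>\<^bsub>B\<^esub> adj B (t \<rho>) =
       t (\<kappa> \<cdot> fst q) \<otimes>\<^bsub>B\<^esub> adj B (t (\<rho> \<cdot> snd q))"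
      using p L[OF q] by (simp add: t_cmp star_cmp)
  next
    have "t (\<kappa> \<cdot> fst q) \<otimes>\<^bsub>B\<^esub> adj B (t (\<rho> \<cdot> snd q)) \<in> carrier B" if "q \<in> ?L" for q
      using cmp_closed[OF p(1) L(1,3)] cmp_closed[OF p(4) L(2,4)] that by simp
    then show "(\<lambda>q. t (\<kappa> \<cdot> fst q) \<otimes>\<^bsub>B\<^esub> adj B (t (\<rho> \<cdot> snd q))) \<in> ?L \<rightarrow> carrier B" by blast
  qed simp
  finally show ?thesis .
qed

text \<open>The product is a sum of range projections of common extensions, hence self-adjoint.\<close>

lemma range_proj_commute:
  assumes p: "\<mu> \<in> paths \<Lambda>" "\<nu> \<in> paths \<Lambda>"
  shows "range_proj \<mu> \<otimes>\<^bsub>B\<^esub> range_proj \<nu> = range_proj \<nu> \<otimes>\<^bsub>B\<^esub> range_proj \<mu>"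
proof -
  let ?L = "Lambda_min \<Lambda> \<mu> \<nu>"
  have L: "\<mu> \<cdot> fst q \<in> paths \<Lambda>" "\<nu> \<cdot> snd q = \<mu> \<cdot> fst q" if "q \<in> ?L" for q
    using that Lambda_min_iff[OF p, of "fst q" "snd q"] p by (auto intro: cmp_closed)
  have eq: "range_proj \<mu> \<otimes>\<^bsub>B\<^esub> range_proj \<nu> = (\<Oplus>\<^bsub>B\<^esub>q\<in>?L. range_proj (\<mu> \<cdot> fst q))"
    unfolding range_proj_def product_expansion[OF p(1,1) p(2,2) refl refl]
    by (rule alg.M.finsum_cong') (use L in auto)
  have "adj B (\<Oplus>\<^bsub>B\<^esub>q\<in>?L. range_proj (\<mu> \<cdot> fst q)) = (\<Oplus>\<^bsub>B\<^esub>q\<in>?L. adj B (range_proj (\<mu> \<cdot> fst q)))"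
    using L finite_Lambda_min[OF fa p] by (intro alg.finsum_adj) auto
  also have "\<dots> = (\<Oplus>\<^bsub>B\<^esub>q\<in>?L. range_proj (\<mu> \<cdot> fst q))"
    using L by (intro alg.M.finsum_cong') (auto simp: range_proj_adj)
  finally have "adj B (range_proj \<mu> \<otimes>\<^bsub>B\<^esub> range_proj \<nu>) = range_proj \<mu> \<otimes>\<^bsub>B\<^esub> range_proj \<nu>"
    by (simp add: eq)
  then show ?thesis using p by (simp add: alg.adj_mult range_proj_adj)
qed

end

section \<open>Matrix units of a finite closed set of paths\<close>

text \<open>
  The property of \<open>G\<close> is the defining closure property of \<open>\<Pi>E\<close>. The elements \<open>\<Theta>\<close> are analysed for any such \<open>G\<close>.
\<close>

locale toeplitz_closed_set = toeplitz_family \<Lambda> B t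
  for \<Lambda> :: "('p, 'k::finite) kgraph" (structure) and B :: "'a cstar" and t :: "'p \<Rightarrow> 'a" +
  fixes G :: "'p set"
  assumes finite_G: "finite G" and G_paths: "\<kappa> \<in> G \<Longrightarrow> \<kappa> \<in> paths \<Lambda>"
    and G_ext: "\<lbrakk>\<kappa> \<in> G; \<mu> \<in> G; \<sigma> \<in> G; deg \<Lambda> \<kappa> = deg \<Lambda> \<mu>; src \<Lambda> \<kappa> = src \<Lambda> \<mu>; \<alpha> \<in> Ext \<Lambda> \<mu> {\<sigma>}\<rbrakk>
      \<Longrightarrow> \<kappa> \<cdot> \<alpha> \<in> G"
begin

definition pairs :: "('p \<times> 'p) set" where
  "pairs = {(\<kappa>, \<mu>). \<kappa> \<in> G \<and> \<mu> \<in> G \<and> deg \<Lambda> \<kappa> = deg \<Lambda> \<mu> \<and> src \<Lambda> \<kappa> = src \<Lambda> \<mu>}"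

definition tails :: "'p \<Rightarrow> 'p set" where
  "tails \<kappa> = {\<nu> \<in> paths_into \<Lambda> (src \<Lambda> \<kappa>). \<kappa> \<cdot> \<nu> \<in> G - {\<kappa>}}"

lemma tailsD:
  assumes "\<kappa> \<in> G" "\<nu> \<in> tails \<kappa>"
  shows "\<nu> \<in> paths \<Lambda>" "src \<Lambda> \<kappa> = rng \<Lambda> \<nu>" "\<kappa> \<cdot> \<nu> \<in> G" "\<kappa> \<cdot> \<nu> \<noteq> \<kappa>" "src \<Lambda> (\<kappa> \<cdot> \<nu>) = src \<Lambda> \<nu>"
  using assms G_paths src_cmp[of \<kappa> \<nu>] by (auto simp: tails_def paths_into_def)

lemma finite_tails:
  assumes "\<kappa> \<in> G" shows "finite (tails \<kappa>)"
proof (rule inj_on_finite)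
  show "inj_on (\<lambda>\<nu>. \<kappa> \<cdot> \<nu>) (tails \<kappa>)"
    using tailsD[OF assms] left_cancel[OF G_paths[OF assms]] by (intro inj_onI) blast
  show "(\<lambda>\<nu>. \<kappa> \<cdot> \<nu>) ` tails \<kappa> \<subseteq> G" using tailsD[OF assms] by blast
qed (rule finite_G)

lemma tails_longer:
  assumes "\<kappa> \<in> G" "\<nu> \<in> tails \<kappa>"
  shows "deg \<Lambda> \<nu> \<noteq> 0"
  using tailsD[OF assms] deg_zero_id[of \<nu>] src_id[OF G_paths[OF assms(1)]] by metis

text \<open>
  A tail \<open>\<nu>\<close> of \<open>\<kappa>\<close> is the extension of \<open>\<kappa>\<close> by \<open>\<kappa> \<cdot> \<nu>\<close>, and the closure property transplants such
  extensions to every \<open>\<mu>\<close> of the same degree and source.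
\<close>

lemma tails_pair_subset: assumes "(\<kappa>, \<mu>) \<in> pairs" shows "tails \<kappa> \<subseteq> tails \<mu>"
proof
  have G: "\<kappa> \<in> G" "\<mu> \<in> G" "deg \<Lambda> \<kappa> = deg \<Lambda> \<mu>" "src \<Lambda> \<kappa> = src \<Lambda> \<mu>" using assms by (auto simp: pairs_def)
  fix \<nu> assume \<nu>: "\<nu> \<in> tails \<kappa>"
  note d = tailsD[OF G(1) \<nu>]
  have "\<nu> \<in> Ext \<Lambda> \<kappa> {\<kappa> \<cdot> \<nu>}"
    using Lambda_min_prefix[OF G_paths[OF G(1)] d(1,2)] Ext_singleton_iff[OF G_paths[OF G(1)] G_paths[OF d(3)]] by blast
  then have in_G: "\<mu> \<cdot> \<nu> \<in> G" using G_ext[OF G(2,1) d(3)] G by simp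
  have "deg \<Lambda> (\<mu> \<cdot> \<nu>) = deg \<Lambda> \<mu> + deg \<Lambda> \<nu>"
    using deg_cmp[OF G_paths[OF G(2)] d(1)] d(2) G(4) by simp
  then have "\<mu> \<cdot> \<nu> \<noteq> \<mu>" using tails_longer[OF G(1) \<nu>] by auto
  then show "\<nu> \<in> tails \<mu>" using in_G d G(4) by (simp add: tails_def paths_into_def)
qed

lemma pairs_sym: "(\<kappa>, \<mu>) \<in> pairs \<Longrightarrow> (\<mu>, \<kappa>) \<in> pairs" by (auto simp: pairs_def)

lemma tails_pair: "(\<kappa>, \<mu>) \<in> pairs \<Longrightarrow> tails \<kappa> = tails \<mu>"
  using tails_pair_subset pairs_sym by blast

lemma common_extension:
  assumes "\<mu> \<in> G" "\<nu> \<in> G" "(\<alpha>, \<beta>) \<in> Lambda_min \<Lambda> \<mu> \<nu>"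
  shows "\<mu> \<cdot> \<alpha> \<in> G" "\<mu> \<cdot> \<alpha> = \<nu> \<cdot> \<beta>" "\<alpha> \<in> paths_into \<Lambda> (src \<Lambda> \<mu>)" "\<beta> \<in> paths_into \<Lambda> (src \<Lambda> \<nu>)"
proof -
  note p = G_paths[OF assms(1)] G_paths[OF assms(2)]
  show "\<mu> \<cdot> \<alpha> = \<nu> \<cdot> \<beta>" "\<alpha> \<in> paths_into \<Lambda> (src \<Lambda> \<mu>)" "\<beta> \<in> paths_into \<Lambda> (src \<Lambda> \<nu>)"
    using assms(3) Lambda_min_iff[OF p] by (simp_all add: paths_into_def)
  have "\<alpha> \<in> Ext \<Lambda> \<mu> {\<nu>}" using assms(3) Ext_singleton_iff[OF p] by blast
  then show "\<mu> \<cdot> \<alpha> \<in> G" by (rule G_ext[OF assms(1,1,2) refl refl])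
qed

text \<open>
  The part of the source projection of \<open>\<kappa>\<close> that no proper extension of \<open>\<kappa>\<close> in \<open>G\<close> covers. The
  product acts on \<open>t (src \<Lambda> \<kappa>)\<close>, so that for \<open>\<kappa>\<close> without tails it is this projection.
\<close>

definition gap :: "'p \<Rightarrow> 'a" where
  "gap \<kappa> = prod_act B (\<lambda>\<nu>. t (src \<Lambda> \<kappa>) \<ominus>\<^bsub>B\<^esub> range_proj \<nu>) (tails \<kappa>) (t (src \<Lambda> \<kappa>))"

text \<open>
  For \<open>G = \<Pi>E\<close> this is \<open>\<Theta>\<close>, with the product written as an element.
\<close>

definition unit :: "'p \<Rightarrow> 'p \<Rightarrow> 'a" where
  "unit \<kappa> \<mu> = t \<kappa> \<otimes>\<^bsub>B\<^esub> gap \<kappa> \<otimes>\<^bsub>B\<^esub> adj B (t \<mu>)"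

lemma commuting_tails:
  assumes "\<kappa> \<in> G" shows "commuting_projections B (t (src \<Lambda> \<kappa>)) range_proj (tails \<kappa>)"
  using tailsD[OF assms] t_src[OF G_paths[OF assms]] finite_tails[OF assms]
  by unfold_locales (auto simp: range_proj_adj range_proj_idem range_proj_below range_proj_commute)

lemma
  assumes \<kappa>: "\<kappa> \<in> G"
  shows gap_closed: "gap \<kappa> \<in> carrier B"
    and gap_adj: "adj B (gap \<kappa>) = gap \<kappa>"
    and src_gap: "t (src \<Lambda> \<kappa>) \<otimes>\<^bsub>B\<^esub> gap \<kappa> = gap \<kappa>"
    and gap_src: "gap \<kappa> \<otimes>\<^bsub>B\<^esub> t (src \<Lambda> \<kappa>) = gap \<kappa>"
    and range_proj_gap: "\<nu> \<in> tails \<kappa> \<Longrightarrow> range_proj \<nu> \<otimes>\<^bsub>B\<^esub> gap \<kappa> = \<zero>\<^bsub>B\<^esub>"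
    and gap_fixes: "\<lbrakk>x \<in> carrier B; t (src \<Lambda> \<kappa>) \<otimes>\<^bsub>B\<^esub> x = x;
      \<And>\<nu>. \<nu> \<in> tails \<kappa> \<Longrightarrow> range_proj \<nu> \<otimes>\<^bsub>B\<^esub> x = \<zero>\<^bsub>B\<^esub>\<rbrakk> \<Longrightarrow> gap \<kappa> \<otimes>\<^bsub>B\<^esub> x = x"
    and gap_prod_act: "\<lbrakk>x \<in> carrier B; t (src \<Lambda> \<kappa>) \<otimes>\<^bsub>B\<^esub> x = x\<rbrakk> \<Longrightarrow>
      prod_act B (\<lambda>\<nu>. t (src \<Lambda> \<kappa>) \<ominus>\<^bsub>B\<^esub> range_proj \<nu>) (tails \<kappa>) x = gap \<kappa> \<otimes>\<^bsub>B\<^esub> x"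
proof -
  interpret commuting_projections B "t (src \<Lambda> \<kappa>)" range_proj "tails \<kappa>" by (rule commuting_tails[OF \<kappa>])
  have gap: "gap \<kappa> = residue (tails \<kappa>)" by (simp add: gap_def residue_def)
  show "gap \<kappa> \<in> carrier B" unfolding gap by (rule residue_closed) simp
  show "adj B (gap \<kappa>) = gap \<kappa>" unfolding gap by (rule residue_adj) simp
  show "t (src \<Lambda> \<kappa>) \<otimes>\<^bsub>B\<^esub> gap \<kappa> = gap \<kappa>" unfolding gap by (rule q_residue) simp
  show "gap \<kappa> \<otimes>\<^bsub>B\<^esub> t (src \<Lambda> \<kappa>) = gap \<kappa>" unfolding gap by (rule residue_q) simp
  show "range_proj \<nu> \<otimes>\<^bsub>B\<^esub> gap \<kappa> = \<zero>\<^bsub>B\<^esub>" if "\<nu> \<in> tails \<kappa>" for \<nu>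
    unfolding gap using that by (rule r_residue[rotated]) simp
  show "gap \<kappa> \<otimes>\<^bsub>B\<^esub> x = x" if "x \<in> carrier B" "t (src \<Lambda> \<kappa>) \<otimes>\<^bsub>B\<^esub> x = x"
    "\<And>\<nu>. \<nu> \<in> tails \<kappa> \<Longrightarrow> range_proj \<nu> \<otimes>\<^bsub>B\<^esub> x = \<zero>\<^bsub>B\<^esub>" for x
    unfolding gap using order_refl that by (rule residue_fixes)
  show "prod_act B (\<lambda>\<nu>. t (src \<Lambda> \<kappa>) \<ominus>\<^bsub>B\<^esub> range_proj \<nu>) (tails \<kappa>) x = gap \<kappa> \<otimes>\<^bsub>B\<^esub> x"
    if "x \<in> carrier B" "t (src \<Lambda> \<kappa>) \<otimes>\<^bsub>B\<^esub> x = x" for x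
    unfolding gap using order_refl that by (rule prod_act_residue)
qed

lemma gap_idem: "\<kappa> \<in> G \<Longrightarrow> gap \<kappa> \<otimes>\<^bsub>B\<^esub> gap \<kappa> = gap \<kappa>"
  by (simp add: gap_fixes gap_closed src_gap range_proj_gap)

text \<open>
  The adjoint of \<open>t\<^sub>\<nu>\<close> factors through the range projection of \<open>\<nu>\<close>, which the gap kills.
\<close>

lemma star_gap:
  assumes "\<kappa> \<in> G" "\<nu> \<in> tails \<kappa>" shows "adj B (t \<nu>) \<otimes>\<^bsub>B\<^esub> gap \<kappa> = \<zero>\<^bsub>B\<^esub>"
proof -
  note d = tailsD[OF assms]
  have "adj B (t \<nu>) = adj B (t \<nu>) \<otimes>\<^bsub>B\<^esub> range_proj \<nu>"
    using arg_cong[OF range_proj_mult_t[OF d(1)], of "adj B"] d by (simp add: alg.adj_mult range_proj_adj)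
  then have "adj B (t \<nu>) \<otimes>\<^bsub>B\<^esub> gap \<kappa> = adj B (t \<nu>) \<otimes>\<^bsub>B\<^esub> (range_proj \<nu> \<otimes>\<^bsub>B\<^esub> gap \<kappa>)"
    using d gap_closed[OF assms(1)] by (metis alg.closed(7) alg.mult_assoc range_proj_closed t_closed)
  then show ?thesis using d by (simp add: range_proj_gap[OF assms])
qed

lemma gap_t:
  assumes "\<kappa> \<in> G" "\<nu> \<in> tails \<kappa>" shows "gap \<kappa> \<otimes>\<^bsub>B\<^esub> t \<nu> = \<zero>\<^bsub>B\<^esub>"
  using arg_cong[OF star_gap[OF assms], of "adj B"] tailsD[OF assms] gap_closed[OF assms(1)]
  by (simp add: alg.adj_mult alg.adj_adj gap_adj[OF assms(1)])

lemma gap_pair: "(\<kappa>, \<mu>) \<in> pairs \<Longrightarrow> gap \<kappa> = gap \<mu>"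
  using tails_pair[of \<kappa> \<mu>] by (auto simp: gap_def pairs_def)

lemma unit_closed: "(\<kappa>, \<mu>) \<in> pairs \<Longrightarrow> unit \<kappa> \<mu> \<in> carrier B"
  by (auto simp: unit_def pairs_def G_paths gap_closed)

text \<open>
  Two different elements of the closed set have only common extensions that extend one of them
  properly, and these are removed by the corresponding gap projection.
\<close>

lemma gap_star_t_gap:
  assumes G: "\<mu> \<in> G" "\<nu> \<in> G" and ne: "\<mu> \<noteq> \<nu>"
  shows "gap \<mu> \<otimes>\<^bsub>B\<^esub> (adj B (t \<mu>) \<otimes>\<^bsub>B\<^esub> t \<nu>) \<otimes>\<^bsub>B\<^esub> gap \<nu> = \<zero>\<^bsub>B\<^esub>"
proof -
  let ?L = "Lambda_min \<Lambda> \<mu> \<nu>"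
  note p = G_paths[OF G(1)] G_paths[OF G(2)]
  have L: "fst q \<in> paths \<Lambda>" "snd q \<in> paths \<Lambda>" if "q \<in> ?L" for q
    using that Lambda_min_iff[OF p, of "fst q" "snd q"] by simp_all
  note [simp] = gap_closed[OF G(1)] gap_closed[OF G(2)]
  have "gap \<mu> \<otimes>\<^bsub>B\<^esub> (adj B (t \<mu>) \<otimes>\<^bsub>B\<^esub> t \<nu>) \<otimes>\<^bsub>B\<^esub> gap \<nu> =
    (\<Oplus>\<^bsub>B\<^esub>q\<in>?L. gap \<mu> \<otimes>\<^bsub>B\<^esub> (t (fst q) \<otimes>\<^bsub>B\<^esub> adj B (t (snd q))) \<otimes>\<^bsub>B\<^esub> gap \<nu>)"
    using L p finite_Lambda_min[OF fa p]
    by (simp add: t_star alg.finsum_mult_left alg.finsum_mult_right Pi_iff)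
  also have "\<dots> = \<zero>\<^bsub>B\<^esub>"
  proof (rule alg.finsum_all_zero)
    fix q assume q: "q \<in> ?L"
    then have "(fst q, snd q) \<in> ?L" by simp
    note c = common_extension[OF G this]
    have "gap \<mu> \<otimes>\<^bsub>B\<^esub> (t (fst q) \<otimes>\<^bsub>B\<^esub> adj B (t (snd q))) \<otimes>\<^bsub>B\<^esub> gap \<nu> =
      (gap \<mu> \<otimes>\<^bsub>B\<^esub> t (fst q)) \<otimes>\<^bsub>B\<^esub> (adj B (t (snd q)) \<otimes>\<^bsub>B\<^esub> gap \<nu>)"
      using L[OF q] by (simp add: alg.mult_assoc)
    moreover have "fst q \<in> tails \<mu> \<or> snd q \<in> tails \<nu>" using c ne by (auto simp: tails_def)
    then have "gap \<mu> \<otimes>\<^bsub>B\<^esub> t (fst q) = \<zero>\<^bsub>B\<^esub> \<or> adj B (t (snd q)) \<otimes>\<^bsub>B\<^esub> gap \<nu> = \<zero>\<^bsub>B\<^esub>"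
      using gap_t[OF G(1)] star_gap[OF G(2)] by blast
    ultimately show "gap \<mu> \<otimes>\<^bsub>B\<^esub> (t (fst q) \<otimes>\<^bsub>B\<^esub> adj B (t (snd q))) \<otimes>\<^bsub>B\<^esub> gap \<nu> = \<zero>\<^bsub>B\<^esub>"
      using L[OF q] by auto
  qed
  finally show ?thesis .
qed

lemma unit_mult:
  assumes 1: "(\<kappa>, \<mu>) \<in> pairs" and 2: "(\<nu>, \<rho>) \<in> pairs"
  shows "unit \<kappa> \<mu> \<otimes>\<^bsub>B\<^esub> unit \<nu> \<rho> = (if \<mu> = \<nu> then unit \<kappa> \<rho> else \<zero>\<^bsub>B\<^esub>)"
proof -
  have G: "\<kappa> \<in> G" "\<mu> \<in> G" "\<nu> \<in> G" "\<rho> \<in> G" and s: "src \<Lambda> \<kappa> = src \<Lambda> \<mu>" "src \<Lambda> \<nu> = src \<Lambda> \<rho>"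
    using 1 2 by (auto simp: pairs_def)
  note [simp] = G_paths[OF G(1)] G_paths[OF G(2)] G_paths[OF G(3)] G_paths[OF G(4)]
    gap_closed[OF G(1)] gap_closed[OF G(2)] gap_closed[OF G(3)] gap_closed[OF G(4)]
  have "unit \<kappa> \<mu> \<otimes>\<^bsub>B\<^esub> unit \<nu> \<rho> =
    t \<kappa> \<otimes>\<^bsub>B\<^esub> (gap \<mu> \<otimes>\<^bsub>B\<^esub> (adj B (t \<mu>) \<otimes>\<^bsub>B\<^esub> t \<nu>) \<otimes>\<^bsub>B\<^esub> gap \<nu>) \<otimes>\<^bsub>B\<^esub> adj B (t \<rho>)"
    using gap_pair[OF 1] by (simp add: unit_def alg.mult_assoc)
  also have "\<dots> = (if \<mu> = \<nu> then unit \<kappa> \<rho> else \<zero>\<^bsub>B\<^esub>)"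
  proof (cases "\<mu> = \<nu>")
    case True
    then have "gap \<mu> \<otimes>\<^bsub>B\<^esub> (adj B (t \<mu>) \<otimes>\<^bsub>B\<^esub> t \<nu>) \<otimes>\<^bsub>B\<^esub> gap \<nu> = gap \<kappa>"
      using G gap_pair[OF 1] by (simp add: star_mult_self gap_src gap_idem)
    then show ?thesis using True by (simp add: unit_def)
  qed (use G in \<open>simp add: gap_star_t_gap\<close>)
  finally show ?thesis .
qed

lemma matrix_units_pairs: "matrix_units B pairs unit"
proof unfold_locales
  show "finite pairs"
    by (rule finite_subset[OF _ finite_cartesian_product[OF finite_G finite_G]]) (auto simp: pairs_def)
  show "adj B (unit \<kappa> \<mu>) = unit \<mu> \<kappa>" if "(\<kappa>, \<mu>) \<in> pairs" for \<kappa> \<mu>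
    using that gap_pair[OF that] by (auto simp: unit_def pairs_def alg.adj_mult alg.adj_adj G_paths
        gap_closed gap_adj alg.mult_assoc)
qed (use unit_closed unit_mult in \<open>auto simp: pairs_def\<close>)

lemma through_tail:
  assumes \<kappa>: "\<kappa> \<in> G" and \<nu>: "\<nu> \<in> tails \<kappa>" and \<omega>: "\<omega> \<in> tails (\<kappa> \<cdot> \<nu>)"
  shows "\<nu> \<cdot> \<omega> \<in> tails \<kappa>"
proof -
  note k = G_paths[OF \<kappa>] and d = tailsD[OF \<kappa> \<nu>] and e = tailsD[OF tailsD(3)[OF \<kappa> \<nu>] \<omega>]
  have c: "src \<Lambda> \<nu> = rng \<Lambda> \<omega>" using e(2) d(5) by simp
  have eq: "\<kappa> \<cdot> \<nu> \<cdot> \<omega> = \<kappa> \<cdot> (\<nu> \<cdot> \<omega>)" by (rule cmp_assoc[OF k d(1) e(1) d(2) c])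
  have "deg \<Lambda> (\<kappa> \<cdot> \<nu> \<cdot> \<omega>) = deg \<Lambda> \<kappa> + deg \<Lambda> \<nu> + deg \<Lambda> \<omega>"
    using deg_cmp[OF G_paths[OF d(3)] e(1,2)] deg_cmp[OF k d(1,2)] by simp
  then have "\<kappa> \<cdot> \<nu> \<cdot> \<omega> \<noteq> \<kappa>" using tails_longer[OF \<kappa> \<nu>] by (auto simp: fun_eq_iff)
  then show ?thesis using e(3) eq cmp_closed[OF d(1) e(1) c] rng_cmp[OF d(1) e(1) c] d(2)
    by (simp add: tails_def paths_into_def)
qed

lemma pair_tail:
  assumes "(\<kappa>, \<mu>) \<in> pairs" "\<nu> \<in> tails \<kappa>"
  shows "(\<kappa> \<cdot> \<nu>, \<mu> \<cdot> \<nu>) \<in> pairs"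
proof -
  have G: "\<kappa> \<in> G" "\<mu> \<in> G" "deg \<Lambda> \<kappa> = deg \<Lambda> \<mu>" using assms by (auto simp: pairs_def)
  have \<nu>: "\<nu> \<in> tails \<mu>" using tails_pair[OF assms(1)] assms(2) by simp
  note d = tailsD[OF G(1) assms(2)] and e = tailsD[OF G(2) \<nu>]
  show ?thesis using d e G(3) deg_cmp[OF G_paths[OF G(1)] d(1,2)] deg_cmp[OF G_paths[OF G(2)] e(1,2)]
    by (simp add: pairs_def)
qed

text \<open>
  Extending by a tail strictly lowers the level, so it serves as the measure for inductions that go from
  the longest paths of \<open>G\<close> down to the shorter ones.
\<close>

definition level :: "'p \<Rightarrow> nat" where
  "level \<kappa> = card {\<rho> \<in> G. deg \<Lambda> \<kappa> \<le> deg \<Lambda> \<rho> \<and> deg \<Lambda> \<kappa> \<noteq> deg \<Lambda> \<rho>}"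

lemma level_tail:
  assumes "\<kappa> \<in> G" "\<nu> \<in> tails \<kappa>" shows "level (\<kappa> \<cdot> \<nu>) < level \<kappa>"
  unfolding level_def
proof (rule psubset_card_mono)
  note d = tailsD[OF assms]
  have deg: "deg \<Lambda> (\<kappa> \<cdot> \<nu>) = deg \<Lambda> \<kappa> + deg \<Lambda> \<nu>" using deg_cmp[OF G_paths[OF assms(1)] d(1,2)] .
  have le: "deg \<Lambda> \<kappa> \<le> deg \<Lambda> (\<kappa> \<cdot> \<nu>)" and ne: "deg \<Lambda> \<kappa> \<noteq> deg \<Lambda> (\<kappa> \<cdot> \<nu>)"
    using tails_longer[OF assms] unfolding deg by (auto simp: le_fun_def)
  have "{\<rho> \<in> G. deg \<Lambda> (\<kappa> \<cdot> \<nu>) \<le> deg \<Lambda> \<rho> \<and> deg \<Lambda> (\<kappa> \<cdot> \<nu>) \<noteq> deg \<Lambda> \<rho>}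
    \<subseteq> {\<rho> \<in> G. deg \<Lambda> \<kappa> \<le> deg \<Lambda> \<rho> \<and> deg \<Lambda> \<kappa> \<noteq> deg \<Lambda> \<rho>}"
    using le ne by (auto intro: order_trans)
  then show "{\<rho> \<in> G. deg \<Lambda> (\<kappa> \<cdot> \<nu>) \<le> deg \<Lambda> \<rho> \<and> deg \<Lambda> (\<kappa> \<cdot> \<nu>) \<noteq> deg \<Lambda> \<rho>}
    \<subset> {\<rho> \<in> G. deg \<Lambda> \<kappa> \<le> deg \<Lambda> \<rho> \<and> deg \<Lambda> \<kappa> \<noteq> deg \<Lambda> \<rho>}"
    using le ne d(3) by blast
qed (use finite_G in simp)

text \<open>
  The diagonal unit at \<open>\<kappa> \<cdot> \<nu>\<close>, transported by \<open>t\<^sub>\<kappa>\<close> into the corner at the source of \<open>\<kappa>\<close>.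
\<close>

definition tail_block :: "'p \<Rightarrow> 'p \<Rightarrow> 'a" where
  "tail_block \<kappa> \<nu> = t \<nu> \<otimes>\<^bsub>B\<^esub> gap (\<kappa> \<cdot> \<nu>) \<otimes>\<^bsub>B\<^esub> adj B (t \<nu>)"

lemma tail_block_closed: "\<lbrakk>\<kappa> \<in> G; \<nu> \<in> tails \<kappa>\<rbrakk> \<Longrightarrow> tail_block \<kappa> \<nu> \<in> carrier B"
  using tailsD[of \<kappa> \<nu>] by (simp add: tail_block_def gap_closed)

lemma tail_block_mult:
  assumes \<kappa>: "\<kappa> \<in> G" and \<nu>: "\<nu> \<in> tails \<kappa>" and \<rho>: "\<rho> \<in> tails \<kappa>"
  shows "tail_block \<kappa> \<nu> \<otimes>\<^bsub>B\<^esub> tail_block \<kappa> \<rho> = (if \<nu> = \<rho> then tail_block \<kappa> \<nu> else \<zero>\<^bsub>B\<^esub>)"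
proof -
  note n = tailsD[OF \<kappa> \<nu>] and r = tailsD[OF \<kappa> \<rho>] and k = G_paths[OF \<kappa>]
  note [simp] = gap_closed[OF n(3)] gap_closed[OF r(3)] n(1) r(1) k
  \<comment> \<open>Multiplying both tails by \<open>\<kappa>\<close> brings the product into a form about two elements of \<open>G\<close>.\<close>
  have key: "adj B (t \<nu>) \<otimes>\<^bsub>B\<^esub> t \<rho> = adj B (t (\<kappa> \<cdot> \<nu>)) \<otimes>\<^bsub>B\<^esub> t (\<kappa> \<cdot> \<rho>)"
  proof -
    have "adj B (t (\<kappa> \<cdot> \<nu>)) \<otimes>\<^bsub>B\<^esub> t (\<kappa> \<cdot> \<rho>) = adj B (t \<nu>) \<otimes>\<^bsub>B\<^esub> (adj B (t \<kappa>) \<otimes>\<^bsub>B\<^esub> t (\<kappa> \<cdot> \<rho>))"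
      using n r G_paths[OF r(3)] by (simp add: star_cmp[symmetric] alg.mult_assoc)
    then show ?thesis using r by (simp add: star_mult_prefix)
  qed
  have "tail_block \<kappa> \<nu> \<otimes>\<^bsub>B\<^esub> tail_block \<kappa> \<rho> =
    t \<nu> \<otimes>\<^bsub>B\<^esub> (gap (\<kappa> \<cdot> \<nu>) \<otimes>\<^bsub>B\<^esub> (adj B (t \<nu>) \<otimes>\<^bsub>B\<^esub> t \<rho>) \<otimes>\<^bsub>B\<^esub> gap (\<kappa> \<cdot> \<rho>)) \<otimes>\<^bsub>B\<^esub> adj B (t \<rho>)"
    by (simp add: tail_block_def alg.mult_assoc)
  also have "\<dots> = (if \<nu> = \<rho> then tail_block \<kappa> \<nu> else \<zero>\<^bsub>B\<^esub>)"
  proof (cases "\<nu> = \<rho>")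
    case True
    then show ?thesis
      using n(3,5) gap_src[OF n(3)] gap_idem[OF n(3)] by (simp add: star_mult_self tail_block_def)
  next
    case False
    then have "\<kappa> \<cdot> \<nu> \<noteq> \<kappa> \<cdot> \<rho>" using left_cancel[OF k n(1) r(1) n(2) r(2)] by blast
    then show ?thesis using False by (simp add: key gap_star_t_gap[OF n(3) r(3)])
  qed
  finally show ?thesis .
qed

text \<open>
  By induction on the number of longer paths, each range projection \<open>range_proj \<nu>\<close> of a tail \<open>\<nu>\<close> is
  the sum of the blocks at the tails through \<open>\<nu>\<close>. So \<open>t (src \<Lambda> \<kappa>)\<close> minus the sum of all blocks is
  killed by the range projections of all tails, and is therefore fixed by the gap. As the gap also kills
  the blocks, the two are equal.
\<close>

lemma source_decomposition:
  assumes "\<kappa> \<in> G"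
  shows "t (src \<Lambda> \<kappa>) = gap \<kappa> \<oplus>\<^bsub>B\<^esub> (\<Oplus>\<^bsub>B\<^esub>\<nu>\<in>tails \<kappa>. tail_block \<kappa> \<nu>)"
  using assms
proof (induction "level \<kappa>" arbitrary: \<kappa> rule: less_induct)
  case less
  note \<kappa> = \<open>\<kappa> \<in> G\<close> and k = G_paths[OF \<open>\<kappa> \<in> G\<close>]
  let ?v = "t (src \<Lambda> \<kappa>)"
  define R where "R = (\<Oplus>\<^bsub>B\<^esub>\<nu>\<in>tails \<kappa>. tail_block \<kappa> \<nu>)"
  note [simp] = t_src[OF k] gap_closed[OF \<kappa>]
  have W: "tail_block \<kappa> \<nu> \<in> carrier B" if "\<nu> \<in> tails \<kappa>" for \<nu> using tail_block_closed[OF \<kappa> that] .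
  have R [simp]: "R \<in> carrier B" unfolding R_def using W by (intro alg.M.finsum_closed) auto
  define x where "x = ?v \<ominus>\<^bsub>B\<^esub> R"
  have x [simp]: "x \<in> carrier B" by (simp add: x_def)
  have vW: "?v \<otimes>\<^bsub>B\<^esub> tail_block \<kappa> \<nu> = tail_block \<kappa> \<nu>" "tail_block \<kappa> \<nu> \<otimes>\<^bsub>B\<^esub> ?v = tail_block \<kappa> \<nu>"
    if \<nu>: "\<nu> \<in> tails \<kappa>" for \<nu>
  proof -
    note d = tailsD[OF \<kappa> \<nu>]
    have l: "?v \<otimes>\<^bsub>B\<^esub> t \<nu> = t \<nu>" using rng_mult_t[OF d(1)] d(2) by simp
    have "adj B (?v \<otimes>\<^bsub>B\<^esub> t \<nu>) = adj B (t \<nu>) \<otimes>\<^bsub>B\<^esub> adj B ?v" using d(1) by (intro alg.adj_mult) simp_all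
    then have r: "adj B (t \<nu>) \<otimes>\<^bsub>B\<^esub> ?v = adj B (t \<nu>)" using l by simp
    show "?v \<otimes>\<^bsub>B\<^esub> tail_block \<kappa> \<nu> = tail_block \<kappa> \<nu>"
      using l d(1) gap_closed[OF d(3)] by (simp add: tail_block_def alg.mult_assoc[symmetric])
    show "tail_block \<kappa> \<nu> \<otimes>\<^bsub>B\<^esub> ?v = tail_block \<kappa> \<nu>"
      using r d(1) gap_closed[OF d(3)] by (simp add: tail_block_def alg.mult_assoc)
  qed
  have "?v \<otimes>\<^bsub>B\<^esub> R = (\<Oplus>\<^bsub>B\<^esub>\<nu>\<in>tails \<kappa>. ?v \<otimes>\<^bsub>B\<^esub> tail_block \<kappa> \<nu>)"
    unfolding R_def using W finite_tails[OF \<kappa>] by (intro alg.finsum_mult_left) auto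
  also have "\<dots> = R" unfolding R_def using W vW by (intro alg.M.finsum_cong') auto
  finally have vx: "?v \<otimes>\<^bsub>B\<^esub> x = x" by (simp add: x_def alg.minus_distrib)
  have Wx: "tail_block \<kappa> \<nu> \<otimes>\<^bsub>B\<^esub> x = \<zero>\<^bsub>B\<^esub>" if \<nu>: "\<nu> \<in> tails \<kappa>" for \<nu>
  proof -
    have "tail_block \<kappa> \<nu> \<otimes>\<^bsub>B\<^esub> R = (\<Oplus>\<^bsub>B\<^esub>\<rho>\<in>tails \<kappa>. tail_block \<kappa> \<nu> \<otimes>\<^bsub>B\<^esub> tail_block \<kappa> \<rho>)"
      unfolding R_def using W \<nu> finite_tails[OF \<kappa>] by (intro alg.finsum_mult_left) auto
    also have "\<dots> = tail_block \<kappa> \<nu> \<otimes>\<^bsub>B\<^esub> tail_block \<kappa> \<nu>"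
      using tail_block_mult[OF \<kappa> \<nu>] W \<nu> finite_tails[OF \<kappa>] by (intro alg.finsum_single) auto
    also have "\<dots> = tail_block \<kappa> \<nu>" using tail_block_mult[OF \<kappa> \<nu> \<nu>] by simp
    finally show ?thesis using W[OF \<nu>] vW[OF \<nu>] by (simp add: x_def alg.minus_distrib)
  qed
  have px: "range_proj \<nu> \<otimes>\<^bsub>B\<^esub> x = \<zero>\<^bsub>B\<^esub>" if \<nu>: "\<nu> \<in> tails \<kappa>" for \<nu>
  proof -
    note d = tailsD[OF \<kappa> \<nu>]
    have IH: "t (src \<Lambda> \<nu>) = gap (\<kappa> \<cdot> \<nu>) \<oplus>\<^bsub>B\<^esub> (\<Oplus>\<^bsub>B\<^esub>\<omega>\<in>tails (\<kappa> \<cdot> \<nu>). tail_block (\<kappa> \<cdot> \<nu>) \<omega>)"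
      using less(1)[OF level_tail[OF \<kappa> \<nu>] d(3)] d(5) by simp
    have W': "tail_block (\<kappa> \<cdot> \<nu>) \<omega> \<in> carrier B" if "\<omega> \<in> tails (\<kappa> \<cdot> \<nu>)" for \<omega>
      using tail_block_closed[OF d(3) that] .
    have sumc: "(\<Oplus>\<^bsub>B\<^esub>\<omega>\<in>tails (\<kappa> \<cdot> \<nu>). tail_block (\<kappa> \<cdot> \<nu>) \<omega>) \<in> carrier B"
      using W' by (intro alg.M.finsum_closed) auto
    note [simp] = d(1) gap_closed[OF d(3)] sumc
    have "range_proj \<nu> = t \<nu> \<otimes>\<^bsub>B\<^esub> t (src \<Lambda> \<nu>) \<otimes>\<^bsub>B\<^esub> adj B (t \<nu>)"
      by (simp add: range_proj_def t_mult_src)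
    also have "\<dots> = tail_block \<kappa> \<nu> \<oplus>\<^bsub>B\<^esub>
       t \<nu> \<otimes>\<^bsub>B\<^esub> (\<Oplus>\<^bsub>B\<^esub>\<omega>\<in>tails (\<kappa> \<cdot> \<nu>). tail_block (\<kappa> \<cdot> \<nu>) \<omega>) \<otimes>\<^bsub>B\<^esub> adj B (t \<nu>)"
      unfolding IH by (simp add: alg.distrib_left alg.distrib_right tail_block_def[of \<kappa> \<nu>])
    also have "t \<nu> \<otimes>\<^bsub>B\<^esub> (\<Oplus>\<^bsub>B\<^esub>\<omega>\<in>tails (\<kappa> \<cdot> \<nu>). tail_block (\<kappa> \<cdot> \<nu>) \<omega>) \<otimes>\<^bsub>B\<^esub> adj B (t \<nu>) =
      (\<Oplus>\<^bsub>B\<^esub>\<omega>\<in>tails (\<kappa> \<cdot> \<nu>). t \<nu> \<otimes>\<^bsub>B\<^esub> tail_block (\<kappa> \<cdot> \<nu>) \<omega> \<otimes>\<^bsub>B\<^esub> adj B (t \<nu>))"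
      using W' finite_tails[OF d(3)] by (simp add: alg.finsum_mult_left alg.finsum_mult_right Pi_iff)
    also have "\<dots> = (\<Oplus>\<^bsub>B\<^esub>\<omega>\<in>tails (\<kappa> \<cdot> \<nu>). tail_block \<kappa> (\<nu> \<cdot> \<omega>))"
    proof (rule alg.M.finsum_cong')
      fix \<omega> assume \<omega>: "\<omega> \<in> tails (\<kappa> \<cdot> \<nu>)"
      note e = tailsD[OF d(3) \<omega>]
      have c: "src \<Lambda> \<nu> = rng \<Lambda> \<omega>" using e(2) d(5) by simp
      have "t \<nu> \<otimes>\<^bsub>B\<^esub> tail_block (\<kappa> \<cdot> \<nu>) \<omega> \<otimes>\<^bsub>B\<^esub> adj B (t \<nu>) =
        (t \<nu> \<otimes>\<^bsub>B\<^esub> t \<omega>) \<otimes>\<^bsub>B\<^esub> gap (\<kappa> \<cdot> \<nu> \<cdot> \<omega>) \<otimes>\<^bsub>B\<^esub> (adj B (t \<omega>) \<otimes>\<^bsub>B\<^esub> adj B (t \<nu>))"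
        using e(1) gap_closed[OF e(3)] by (simp add: tail_block_def alg.mult_assoc)
      then show "t \<nu> \<otimes>\<^bsub>B\<^esub> tail_block (\<kappa> \<cdot> \<nu>) \<omega> \<otimes>\<^bsub>B\<^esub> adj B (t \<nu>) = tail_block \<kappa> (\<nu> \<cdot> \<omega>)"
        using cmp_assoc[OF k d(1) e(1) d(2) c] c e(1) by (simp add: t_cmp star_cmp tail_block_def)
    qed (use through_tail[OF \<kappa> \<nu>] W in auto)
    finally have p: "range_proj \<nu> = tail_block \<kappa> \<nu> \<oplus>\<^bsub>B\<^esub> (\<Oplus>\<^bsub>B\<^esub>\<omega>\<in>tails (\<kappa> \<cdot> \<nu>). tail_block \<kappa> (\<nu> \<cdot> \<omega>))" .
    have W'': "tail_block \<kappa> (\<nu> \<cdot> \<omega>) \<in> carrier B" if "\<omega> \<in> tails (\<kappa> \<cdot> \<nu>)" for \<omega>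
      using W through_tail[OF \<kappa> \<nu> that] by blast
    have "(\<Oplus>\<^bsub>B\<^esub>\<omega>\<in>tails (\<kappa> \<cdot> \<nu>). tail_block \<kappa> (\<nu> \<cdot> \<omega>)) \<otimes>\<^bsub>B\<^esub> x =
      (\<Oplus>\<^bsub>B\<^esub>\<omega>\<in>tails (\<kappa> \<cdot> \<nu>). tail_block \<kappa> (\<nu> \<cdot> \<omega>) \<otimes>\<^bsub>B\<^esub> x)"
      using W'' finite_tails[OF d(3)] by (intro alg.finsum_mult_right) auto
    also have "\<dots> = \<zero>\<^bsub>B\<^esub>" using Wx through_tail[OF \<kappa> \<nu>] by (intro alg.finsum_all_zero) blast
    finally show ?thesis
      unfolding p using Wx[OF \<nu>] W[OF \<nu>] W'' by (simp add: alg.distrib_right alg.M.finsum_closed Pi_iff)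
  qed
  have "gap \<kappa> \<otimes>\<^bsub>B\<^esub> x = x" by (rule gap_fixes[OF \<kappa> x vx px])
  moreover have "gap \<kappa> \<otimes>\<^bsub>B\<^esub> x = gap \<kappa>"
  proof -
    have "gap \<kappa> \<otimes>\<^bsub>B\<^esub> tail_block \<kappa> \<nu> = \<zero>\<^bsub>B\<^esub>" if \<nu>: "\<nu> \<in> tails \<kappa>" for \<nu>
      using gap_t[OF \<kappa> \<nu>] tailsD[OF \<kappa> \<nu>] gap_closed[OF tailsD(3)[OF \<kappa> \<nu>]]
      by (simp add: tail_block_def alg.mult_assoc[symmetric])
    moreover have "gap \<kappa> \<otimes>\<^bsub>B\<^esub> R = (\<Oplus>\<^bsub>B\<^esub>\<nu>\<in>tails \<kappa>. gap \<kappa> \<otimes>\<^bsub>B\<^esub> tail_block \<kappa> \<nu>)"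
      unfolding R_def using W finite_tails[OF \<kappa>] by (intro alg.finsum_mult_left) auto
    ultimately have "gap \<kappa> \<otimes>\<^bsub>B\<^esub> R = \<zero>\<^bsub>B\<^esub>" by (simp add: alg.finsum_all_zero)
    then show ?thesis by (simp add: x_def alg.minus_distrib gap_src[OF \<kappa>])
  qed
  ultimately have "gap \<kappa> = ?v \<ominus>\<^bsub>B\<^esub> R" by (simp add: x_def)
  moreover have "(?v \<ominus>\<^bsub>B\<^esub> R) \<oplus>\<^bsub>B\<^esub> R = ?v" by (simp add: a_minus_def alg.M.a_assoc alg.M.l_neg)
  ultimately show ?case by (simp add: R_def)
qed

text \<open>
  Multiply the decomposition of the source projection by \<open>t\<^sub>\<kappa>\<close> on the left and \<open>t\<^sub>\<mu>\<^sup>*\<close> on the right.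
\<close>

lemma generator_decomposition:
  assumes pr: "(\<kappa>, \<mu>) \<in> pairs"
  shows "t \<kappa> \<otimes>\<^bsub>B\<^esub> adj B (t \<mu>) = unit \<kappa> \<mu> \<oplus>\<^bsub>B\<^esub> (\<Oplus>\<^bsub>B\<^esub>\<nu>\<in>tails \<kappa>. unit (\<kappa> \<cdot> \<nu>) (\<mu> \<cdot> \<nu>))"
proof -
  have G: "\<kappa> \<in> G" "\<mu> \<in> G" "deg \<Lambda> \<kappa> = deg \<Lambda> \<mu>" "src \<Lambda> \<kappa> = src \<Lambda> \<mu>" using pr by (auto simp: pairs_def)
  note p = G_paths[OF G(1)] G_paths[OF G(2)]
  have W: "tail_block \<kappa> \<nu> \<in> carrier B" if "\<nu> \<in> tails \<kappa>" for \<nu> using tail_block_closed[OF G(1) that] .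
  have sumc: "(\<Oplus>\<^bsub>B\<^esub>\<nu>\<in>tails \<kappa>. tail_block \<kappa> \<nu>) \<in> carrier B"
    using W by (intro alg.M.finsum_closed) auto
  note [simp] = p gap_closed[OF G(1)] sumc
  have "t \<kappa> \<otimes>\<^bsub>B\<^esub> adj B (t \<mu>) = t \<kappa> \<otimes>\<^bsub>B\<^esub> t (src \<Lambda> \<kappa>) \<otimes>\<^bsub>B\<^esub> adj B (t \<mu>)" by (simp add: t_mult_src)
  also have "\<dots> = unit \<kappa> \<mu> \<oplus>\<^bsub>B\<^esub> t \<kappa> \<otimes>\<^bsub>B\<^esub> (\<Oplus>\<^bsub>B\<^esub>\<nu>\<in>tails \<kappa>. tail_block \<kappa> \<nu>) \<otimes>\<^bsub>B\<^esub> adj B (t \<mu>)"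
    unfolding source_decomposition[OF G(1)] by (simp add: alg.distrib_left alg.distrib_right unit_def)
  also have "t \<kappa> \<otimes>\<^bsub>B\<^esub> (\<Oplus>\<^bsub>B\<^esub>\<nu>\<in>tails \<kappa>. tail_block \<kappa> \<nu>) \<otimes>\<^bsub>B\<^esub> adj B (t \<mu>) =
      (\<Oplus>\<^bsub>B\<^esub>\<nu>\<in>tails \<kappa>. t \<kappa> \<otimes>\<^bsub>B\<^esub> tail_block \<kappa> \<nu> \<otimes>\<^bsub>B\<^esub> adj B (t \<mu>))"
    using W finite_tails[OF G(1)] by (simp add: alg.finsum_mult_left alg.finsum_mult_right Pi_iff)
  also have "\<dots> = (\<Oplus>\<^bsub>B\<^esub>\<nu>\<in>tails \<kappa>. unit (\<kappa> \<cdot> \<nu>) (\<mu> \<cdot> \<nu>))"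
  proof (rule alg.M.finsum_cong')
    fix \<nu> assume \<nu>: "\<nu> \<in> tails \<kappa>"
    note d = tailsD[OF G(1) \<nu>]
    have c: "src \<Lambda> \<mu> = rng \<Lambda> \<nu>" using d(2) G(4) by simp
    have "t \<kappa> \<otimes>\<^bsub>B\<^esub> tail_block \<kappa> \<nu> \<otimes>\<^bsub>B\<^esub> adj B (t \<mu>) =
      (t \<kappa> \<otimes>\<^bsub>B\<^esub> t \<nu>) \<otimes>\<^bsub>B\<^esub> gap (\<kappa> \<cdot> \<nu>) \<otimes>\<^bsub>B\<^esub> (adj B (t \<nu>) \<otimes>\<^bsub>B\<^esub> adj B (t \<mu>))"
      using d(1) gap_closed[OF d(3)] by (simp add: tail_block_def alg.mult_assoc)
    then show "t \<kappa> \<otimes>\<^bsub>B\<^esub> tail_block \<kappa> \<nu> \<otimes>\<^bsub>B\<^esub> adj B (t \<mu>) = unit (\<kappa> \<cdot> \<nu>) (\<mu> \<cdot> \<nu>)"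
      using d(1,2) c by (simp add: t_cmp star_cmp unit_def)
  qed (use unit_closed pair_tail[OF pr] in auto)
  finally show ?thesis .
qed

text \<open>
  The decomposition is triangular with respect to the level, so the units and the elements
  \<open>t \<kappa> \<otimes> adj (t \<mu>)\<close> have the same linear span.
\<close>

lemma unit_in_subspace:
  assumes S: "star_subspace B S" and gen: "\<And>\<kappa> \<mu>. (\<kappa>, \<mu>) \<in> pairs \<Longrightarrow> t \<kappa> \<otimes>\<^bsub>B\<^esub> adj B (t \<mu>) \<in> S"
    and pr: "(\<kappa>, \<mu>) \<in> pairs"
  shows "unit \<kappa> \<mu> \<in> S"
  using pr
proof (induction "level \<kappa>" arbitrary: \<kappa> \<mu> rule: less_induct)
  case less
  have \<kappa>: "\<kappa> \<in> G" using less.prems by (auto simp: pairs_def)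
  let ?R = "\<Oplus>\<^bsub>B\<^esub>\<nu>\<in>tails \<kappa>. unit (\<kappa> \<cdot> \<nu>) (\<mu> \<cdot> \<nu>)"
  have "?R \<in> S"
    using less.hyps level_tail[OF \<kappa>] pair_tail[OF less.prems] by (intro alg.star_subspace_finsum[OF S]) auto
  moreover have "?R \<in> carrier B" using calculation alg.star_subspaceD(1)[OF S] by blast
  moreover have "unit \<kappa> \<mu> = (unit \<kappa> \<mu> \<oplus>\<^bsub>B\<^esub> ?R) \<ominus>\<^bsub>B\<^esub> ?R"
    using calculation unit_closed[OF less.prems]
    by (simp add: alg.minus_eq_scale alg.M.a_assoc) (simp add: alg.minus_eq_scale[symmetric])
  ultimately show ?case
    using gen[OF less.prems] alg.star_subspace_minus[OF S] by (metis generator_decomposition[OF less.prems])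
qed

end

section \<open>The finite-dimensional subalgebras attached to finite sets of paths\<close>

lemma (in toeplitz_family) closed_set_Pi_closure:
  assumes "finite E" "E \<subseteq> paths \<Lambda>"
  shows "toeplitz_closed_set \<Lambda> B t (Pi_closure \<Lambda> E)"
proof unfold_locales
  show "finite (Pi_closure \<Lambda> E)" using finite_Pi_closure[OF fa assms(2,1)] .
  show "\<kappa> \<in> paths \<Lambda>" if "\<kappa> \<in> Pi_closure \<Lambda> E" for \<kappa> using Pi_closure_paths[OF assms(2)] that by blast
qed (rule Pi_closure.ext)

lemma (in toeplitz_closed_set) Theta_eq_unit:
  assumes G: "G = Pi_closure \<Lambda> E" and pr: "(\<kappa>, \<mu>) \<in> pairs"
  shows "Theta \<Lambda> B t E \<kappa> \<mu> = unit \<kappa> \<mu>"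
proof -
  have p: "\<kappa> \<in> G" "\<mu> \<in> G" "src \<Lambda> \<kappa> = src \<Lambda> \<mu>" using pr by (auto simp: pairs_def)
  have tails: "{\<nu> \<in> paths_into \<Lambda> (src \<Lambda> \<kappa>). \<kappa> \<cdot> \<nu> \<in> Pi_closure \<Lambda> E - {\<kappa>}} = tails \<kappa>"
    by (simp add: tails_def G[symmetric])
  have "prod_act B (\<lambda>\<nu>. t (src \<Lambda> \<kappa>) \<ominus>\<^bsub>B\<^esub> range_proj \<nu>) (tails \<kappa>) (adj B (t \<mu>)) = gap \<kappa> \<otimes>\<^bsub>B\<^esub> adj B (t \<mu>)"
    using src_mult_star[OF G_paths[OF p(2)]] G_paths[OF p(2)] p(3) by (intro gap_prod_act[OF p(1)]) simp_all
  then have "Theta \<Lambda> B t E \<kappa> \<mu> = t \<kappa> \<otimes>\<^bsub>B\<^esub> (gap \<kappa> \<otimes>\<^bsub>B\<^esub> adj B (t \<mu>))"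
    by (simp only: Theta_def tails range_proj_def)
  then show ?thesis using G_paths[OF p(1)] G_paths[OF p(2)] gap_closed[OF p(1)]
    by (simp add: unit_def alg.mult_assoc)
qed

lemma Pi_closure_mono: "E \<subseteq> E' \<Longrightarrow> Pi_closure \<Lambda> E \<subseteq> Pi_closure \<Lambda> E'"
proof
  fix \<kappa> assume E: "E \<subseteq> E'" and "\<kappa> \<in> Pi_closure \<Lambda> E"
  from this(2) show "\<kappa> \<in> Pi_closure \<Lambda> E'"
    by induction (use E in \<open>auto intro: Pi_closure.intros\<close>)
qed

definition Theta_span :: "('p, 'k::finite) kgraph \<Rightarrow> 'a cstar \<Rightarrow> ('p \<Rightarrow> 'a) \<Rightarrow> 'p set \<Rightarrow> 'a set" where
  "Theta_span \<Lambda> B t E = family_span B (\<lambda>(\<kappa>, \<mu>). Theta \<Lambda> B t E \<kappa> \<mu>) (Pi_pairs \<Lambda> E)"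

context toeplitz_family
begin

context
  fixes E assumes E: "finite E" "E \<subseteq> paths \<Lambda>"
begin

interpretation G: toeplitz_closed_set \<Lambda> B t "Pi_closure \<Lambda> E" by (rule closed_set_Pi_closure[OF E])

lemma pairs_eq: "G.pairs = Pi_pairs \<Lambda> E" by (simp add: G.pairs_def Pi_pairs_def)

lemma matrix_units_Theta: "matrix_units B (Pi_pairs \<Lambda> E) (Theta \<Lambda> B t E)"
proof -
  interpret M: matrix_units B "Pi_pairs \<Lambda> E" G.unit
    using G.matrix_units_pairs by (simp add: pairs_eq)
  have eq: "Theta \<Lambda> B t E \<kappa> \<mu> = G.unit \<kappa> \<mu>" if "(\<kappa>, \<mu>) \<in> Pi_pairs \<Lambda> E" for \<kappa> \<mu>
    using G.Theta_eq_unit[OF refl] that by (simp add: pairs_eq)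
  show ?thesis
  proof unfold_locales
    show "finite (Pi_pairs \<Lambda> E)" by (rule M.finite_R)
    show "(\<mu>, \<kappa>) \<in> Pi_pairs \<Lambda> E" if "(\<kappa>, \<mu>) \<in> Pi_pairs \<Lambda> E" for \<kappa> \<mu> using that by (rule M.sym_R)
    show "(\<kappa>, \<nu>) \<in> Pi_pairs \<Lambda> E" if "(\<kappa>, \<mu>) \<in> Pi_pairs \<Lambda> E" "(\<mu>, \<nu>) \<in> Pi_pairs \<Lambda> E" for \<kappa> \<mu> \<nu>
      using that by (rule M.trans_R)
    show "Theta \<Lambda> B t E \<kappa> \<mu> \<in> carrier B" if "(\<kappa>, \<mu>) \<in> Pi_pairs \<Lambda> E" for \<kappa> \<mu>
      using M.unit_closed[OF that] eq[OF that] by simp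
    show "adj B (Theta \<Lambda> B t E \<kappa> \<mu>) = Theta \<Lambda> B t E \<mu> \<kappa>" if "(\<kappa>, \<mu>) \<in> Pi_pairs \<Lambda> E" for \<kappa> \<mu>
      using M.unit_adj[OF that] eq[OF that] eq[OF M.sym_R[OF that]] by simp
    show "Theta \<Lambda> B t E \<kappa> \<mu> \<otimes>\<^bsub>B\<^esub> Theta \<Lambda> B t E \<nu> \<rho> = (if \<mu> = \<nu> then Theta \<Lambda> B t E \<kappa> \<rho> else \<zero>\<^bsub>B\<^esub>)"
      if "(\<kappa>, \<mu>) \<in> Pi_pairs \<Lambda> E" "(\<nu>, \<rho>) \<in> Pi_pairs \<Lambda> E" for \<kappa> \<mu> \<nu> \<rho>
    proof (cases "\<mu> = \<nu>")
      case True
      then have "(\<kappa>, \<rho>) \<in> Pi_pairs \<Lambda> E" using M.trans_R that by blast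
      then show ?thesis using M.unit_mult[OF that] True eq that by simp
    qed (use M.unit_mult[OF that] eq that in simp)
  qed
qed

interpretation T: matrix_units B "Pi_pairs \<Lambda> E" "Theta \<Lambda> B t E" by (rule matrix_units_Theta)

lemma Theta_span_eq: "Theta_span \<Lambda> B t E = T.unit_span"
  by (simp add: Theta_span_def T.unit_span_def)

lemma
  shows star_subspace_Theta_span: "star_subspace B (Theta_span \<Lambda> B t E)"
    and cstar_subalgebra_Theta_span: "cstar_subalgebra (Theta_span \<Lambda> B t E) B"
    and finite_dimensional_Theta_span: "finite_dimensional (B\<lparr>carrier := Theta_span \<Lambda> B t E\<rparr>)"
    and Theta_in_span: "(\<kappa>, \<mu>) \<in> Pi_pairs \<Lambda> E \<Longrightarrow> Theta \<Lambda> B t E \<kappa> \<mu> \<in> Theta_span \<Lambda> B t E"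
  unfolding Theta_span_eq
  using T.star_subspace_unit_span T.cstar_subalgebra_unit_span T.finite_dimensional_unit_span T.unit_in_span
  by auto

lemma generator_in_Theta_span:
  assumes "(\<kappa>, \<mu>) \<in> Pi_pairs \<Lambda> E"
  shows "t \<kappa> \<otimes>\<^bsub>B\<^esub> adj B (t \<mu>) \<in> Theta_span \<Lambda> B t E"
proof -
  have pr: "(\<kappa>, \<mu>) \<in> G.pairs" using assms by (simp add: pairs_eq)
  have "G.unit \<nu> \<rho> \<in> Theta_span \<Lambda> B t E" if "(\<nu>, \<rho>) \<in> G.pairs" for \<nu> \<rho>
    using Theta_in_span[of \<nu> \<rho>] G.Theta_eq_unit[OF refl that] that by (simp add: pairs_eq)
  then show ?thesis
    unfolding G.generator_decomposition[OF pr]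
    by (intro alg.star_subspaceD(3)[OF star_subspace_Theta_span]
        alg.star_subspace_finsum[OF star_subspace_Theta_span] Pi_I) (auto intro: pr G.pair_tail)
qed

text \<open>
  Although the \<open>\<Theta>\<close> are products, a linear subspace that contains the \<open>t\<^sub>\<kappa> t\<^sub>\<mu>\<^sup>*\<close> contains them, by
  the triangular decomposition. Monotonicity in \<open>E\<close> follows, since the generators, unlike the \<open>\<Theta>\<close>,
  do not change when \<open>E\<close> grows.
\<close>

lemma Theta_span_least:
  assumes S: "star_subspace B S" and gen: "\<And>\<kappa> \<mu>. (\<kappa>, \<mu>) \<in> Pi_pairs \<Lambda> E \<Longrightarrow> t \<kappa> \<otimes>\<^bsub>B\<^esub> adj B (t \<mu>) \<in> S"
  shows "Theta_span \<Lambda> B t E \<subseteq> S"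
  unfolding Theta_span_def
proof (rule alg.family_span_least[OF T.finite_R])
  show "(\<lambda>(\<kappa>, \<mu>). Theta \<Lambda> B t E \<kappa> \<mu>) \<in> Pi_pairs \<Lambda> E \<rightarrow> S"
  proof (rule Pi_I, clarify)
    fix \<kappa> \<mu> assume "(\<kappa>, \<mu>) \<in> Pi_pairs \<Lambda> E"
    then have pr: "(\<kappa>, \<mu>) \<in> G.pairs" by (simp add: pairs_eq)
    have "G.unit \<kappa> \<mu> \<in> S" by (rule G.unit_in_subspace[OF S _ pr]) (simp add: gen pairs_eq)
    then show "Theta \<Lambda> B t E \<kappa> \<mu> \<in> S" using G.Theta_eq_unit[OF refl pr] by simp
  qed
qed (use alg.star_subspaceD[OF S] in auto)

lemma hom_Theta:
  assumes \<phi>: "cstar_morphism B C \<phi>" and u: "\<And>\<mu>. \<mu> \<in> paths \<Lambda> \<Longrightarrow> \<phi> (t \<mu>) = u \<mu>"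
    and pr: "(\<kappa>, \<mu>) \<in> Pi_pairs \<Lambda> E"
  shows "\<phi> (Theta \<Lambda> B t E \<kappa> \<mu>) = Theta \<Lambda> C u E \<kappa> \<mu>"
proof -
  interpret \<phi>: cstar_morphism B C \<phi> by (rule \<phi>)
  have G: "\<kappa> \<in> Pi_closure \<Lambda> E" "\<mu> \<in> Pi_closure \<Lambda> E" using pr by (auto simp: Pi_pairs_def)
  note p = G.G_paths[OF G(1)] G.G_paths[OF G(2)]
  interpret c: commuting_projections B "t (src \<Lambda> \<kappa>)" range_proj "G.tails \<kappa>"
    by (rule G.commuting_tails[OF G(1)])
  let ?f = "\<lambda>\<nu>. t (src \<Lambda> \<kappa>) \<ominus>\<^bsub>B\<^esub> range_proj \<nu>"
  have T: "{\<nu> \<in> paths_into \<Lambda> (src \<Lambda> \<kappa>). \<kappa> \<cdot> \<nu> \<in> Pi_closure \<Lambda> E - {\<kappa>}} = G.tails \<kappa>"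
    by (simp add: G.tails_def)
  have cl: "prod_act B ?f (G.tails \<kappa>) (adj B (t \<mu>)) \<in> carrier B"
    using p(2) by (intro alg.prod_act_closed G.finite_tails[OF G(1)] c.factor_closed c.factor_comm) auto
  have "Theta \<Lambda> B t E \<kappa> \<mu> = t \<kappa> \<otimes>\<^bsub>B\<^esub> prod_act B ?f (G.tails \<kappa>) (adj B (t \<mu>))"
    by (simp only: Theta_def T range_proj_def)
  then have "\<phi> (Theta \<Lambda> B t E \<kappa> \<mu>) = u \<kappa> \<otimes>\<^bsub>C\<^esub> \<phi> (prod_act B ?f (G.tails \<kappa>) (adj B (t \<mu>)))"
    using cl p u by (simp add: \<phi>.hom_mult)
  also have "\<phi> (prod_act B ?f (G.tails \<kappa>) (adj B (t \<mu>))) =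
      prod_act C (\<lambda>\<nu>. \<phi> (?f \<nu>)) (G.tails \<kappa>) (\<phi> (adj B (t \<mu>)))"
    using p(2) by (intro \<phi>.hom_prod_act G.finite_tails[OF G(1)] c.factor_closed c.factor_comm) auto
  also have "\<phi> (adj B (t \<mu>)) = adj C (u \<mu>)" using p u by (simp add: \<phi>.hom_adj)
  also have "prod_act C (\<lambda>\<nu>. \<phi> (?f \<nu>)) (G.tails \<kappa>) (adj C (u \<mu>)) =
     prod_act C (\<lambda>\<nu>. u (src \<Lambda> \<kappa>) \<ominus>\<^bsub>C\<^esub> u \<nu> \<otimes>\<^bsub>C\<^esub> adj C (u \<nu>)) (G.tails \<kappa>) (adj C (u \<mu>))"
  proof (rule prod_act_cong)
    fix \<nu> assume "\<nu> \<in> G.tails \<kappa>"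
    then have n: "\<nu> \<in> paths \<Lambda>" by (rule G.tailsD[OF G(1)])
    then show "\<phi> (?f \<nu>) = u (src \<Lambda> \<kappa>) \<ominus>\<^bsub>C\<^esub> u \<nu> \<otimes>\<^bsub>C\<^esub> adj C (u \<nu>)"
      using u src_closed[OF p(1)] by (simp add: range_proj_def \<phi>.hom_minus \<phi>.hom_mult \<phi>.hom_adj)
  qed
  finally show ?thesis by (simp only: Theta_def T)
qed

end

lemma Pi_pairs_mono: "E \<subseteq> E' \<Longrightarrow> Pi_pairs \<Lambda> E \<subseteq> Pi_pairs \<Lambda> E'"
  using Pi_closure_mono[of E E' \<Lambda>] by (auto simp: Pi_pairs_def)

lemma Theta_span_mono:
  assumes "E \<subseteq> E'" "finite E'" "E' \<subseteq> paths \<Lambda>"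
  shows "Theta_span \<Lambda> B t E \<subseteq> Theta_span \<Lambda> B t E'"
proof (rule Theta_span_least)
  show "t \<kappa> \<otimes>\<^bsub>B\<^esub> adj B (t \<mu>) \<in> Theta_span \<Lambda> B t E'" if "(\<kappa>, \<mu>) \<in> Pi_pairs \<Lambda> E" for \<kappa> \<mu>
    using generator_in_Theta_span[OF assms(2,3)] Pi_pairs_mono[OF assms(1)] that by blast
qed (use assms finite_subset star_subspace_Theta_span[OF assms(2,3)] in auto)

end

section \<open>Linear spans\<close>

inductive_set lin_span :: "'a cstar \<Rightarrow> 'a set \<Rightarrow> 'a set" for A :: "'a cstar" and X :: "'a set" where
  zero: "\<zero>\<^bsub>A\<^esub> \<in> lin_span A X"
| step: "\<lbrakk>x \<in> lin_span A X; d \<in> X\<rbrakk> \<Longrightarrow> c \<odot>\<^bsub>A\<^esub> d \<oplus>\<^bsub>A\<^esub> x \<in> lin_span A X"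

context cstar_algebra
begin

lemma lin_span_least:
  assumes S: "star_subspace A S" "X \<subseteq> S" shows "lin_span A X \<subseteq> S"
proof
  fix x assume "x \<in> lin_span A X"
  then show "x \<in> S" by induction (use S star_subspaceD[OF S(1)] in auto)
qed

context
  fixes X assumes X: "X \<subseteq> carrier A"
begin

lemma lin_span_closed: "lin_span A X \<subseteq> carrier A"
proof
  fix x assume "x \<in> lin_span A X"
  then show "x \<in> carrier A" by induction (use X in auto)
qed

lemma lin_span_gen: "d \<in> X \<Longrightarrow> d \<in> lin_span A X"
  using lin_span.step[OF lin_span.zero, of d X A 1] X by (auto simp: subset_iff)

lemma lin_span_add: "\<lbrakk>x \<in> lin_span A X; y \<in> lin_span A X\<rbrakk> \<Longrightarrow> x \<oplus> y \<in> lin_span A X"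
proof (induction rule: lin_span.induct)
  case zero
  then show ?case using lin_span_closed by (auto simp: subset_iff)
next
  case (step x d c)
  have "c \<odot> d \<in> carrier A" "x \<in> carrier A" "y \<in> carrier A"
    using step lin_span_closed X by auto
  then have "c \<odot> d \<oplus> x \<oplus> y = c \<odot> d \<oplus> (x \<oplus> y)" by (rule M.a_assoc)
  then show ?case using step by (auto intro: lin_span.step)
qed

lemma lin_span_smult: "x \<in> lin_span A X \<Longrightarrow> c \<odot> x \<in> lin_span A X"
proof (induction rule: lin_span.induct)
  case (step x d k)
  have "d \<in> carrier A" "x \<in> carrier A" using step lin_span_closed X by auto
  then have "c \<odot> (k \<odot> d \<oplus> x) = (c * k) \<odot> d \<oplus> c \<odot> x" by (simp add: scale_simps)
  then show ?case using step by (auto intro: lin_span.step)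
qed (auto intro: lin_span.zero)

lemma star_subspace_lin_span:
  assumes adj: "\<And>d. d \<in> X \<Longrightarrow> adj A d \<in> lin_span A X" shows "star_subspace A (lin_span A X)"
proof -
  have "adj A x \<in> lin_span A X" if "x \<in> lin_span A X" for x
    using that
  proof induction
    case (step x d c)
    have "d \<in> carrier A" "x \<in> carrier A" using step lin_span_closed X by auto
    then show ?case using step adj by (simp add: adj_add adj_smult lin_span_add lin_span_smult)
  qed (auto intro: lin_span.zero)
  then show ?thesis unfolding star_subspace_def
    using lin_span_closed lin_span_add lin_span_smult lin_span.zero by blast
qed

lemma mult_closed_lin_span:
  assumes mult: "\<And>d e. \<lbrakk>d \<in> X; e \<in> X\<rbrakk> \<Longrightarrow> d \<otimes> e \<in> lin_span A X" shows "mult_closed_set A (lin_span A X)"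
proof -
  have 1: "d \<otimes> y \<in> lin_span A X" if d: "d \<in> X" and "y \<in> lin_span A X" for d y
    using that(2)
  proof induction
    case (step x e c)
    have "d \<in> carrier A" "e \<in> carrier A" "x \<in> carrier A" using d step lin_span_closed X by auto
    then show ?case using step mult d by (simp add: distrib_left smult_mult_right lin_span_add lin_span_smult)
  next
    case zero
    have "d \<in> carrier A" using d X by auto
    then show ?case by (simp add: lin_span.zero)
  qed
  have "x \<otimes> y \<in> lin_span A X" if "x \<in> lin_span A X" and y: "y \<in> lin_span A X" for x y
    using that(1)
  proof induction
    case (step x d c)
    have "y \<in> carrier A" "d \<in> carrier A" "x \<in> carrier A" using y step lin_span_closed X by auto
    then show ?case using step 1 y by (simp add: distrib_right smult_mult_left lin_span_add lin_span_smult)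
  next
    case zero
    have "y \<in> carrier A" using y lin_span_closed by auto
    then show ?case by (simp add: lin_span.zero)
  qed
  then show ?thesis by (simp add: mult_closed_set_def)
qed

end

end

section \<open>The gauge action and its fixed-point algebra\<close>

definition torus_char :: "('k::finite \<Rightarrow> complex) \<Rightarrow> ('k \<Rightarrow> nat) \<Rightarrow> complex" where
  "torus_char z m = (\<Prod>i\<in>UNIV. z i ^ m i)"

lemma torus_char_add: "torus_char z (m + n) = torus_char z m * torus_char z n"
  by (simp add: torus_char_def power_add prod.distrib)

lemma torus_char_zero [simp]: "torus_char z 0 = 1"
  by (simp add: torus_char_def)

lemma torus_char_unimodular:
  assumes "z \<in> torus" shows "cmod (torus_char z m) = 1"
  using assms by (simp add: torus_char_def torus_def prod_norm[symmetric] norm_power)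

lemma torus_char_cnj:
  assumes "z \<in> torus"
  shows "torus_char z m * cnj (torus_char z m) = 1" "cnj (torus_char z m) * torus_char z m = 1"
  using complex_norm_square[of "torus_char z m"] torus_char_unimodular[OF assms, of m] by (auto simp: mult.commute)

text \<open>
  Let all coordinates of \<open>z\<close> be \<open>1\<close> except one where \<open>m\<close> and \<open>n\<close> differ; its angle is \<open>\<pi>\<close> divided by the difference.
\<close>

lemma torus_char_separates:
  assumes "m \<noteq> n" shows "\<exists>z\<in>torus. torus_char z m * cnj (torus_char z n) = -1"
proof -
  obtain i where i: "m i \<noteq> n i" using assms by auto
  define \<theta> where "\<theta> = pi / (real (m i) - real (n i))"
  define z where "z = (\<lambda>j. if j = i then cis \<theta> else 1)"
  have "torus_char z l = cis (real (l i) * \<theta>)" for l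
  proof -
    have "torus_char z l = (\<Prod>j\<in>UNIV. if j = i then cis \<theta> ^ l j else 1)"
      unfolding torus_char_def by (intro prod.cong) (auto simp: z_def)
    also have "\<dots> = cis \<theta> ^ l i" by simp
    finally show ?thesis by (simp only: Complex.DeMoivre)
  qed
  then have "torus_char z m * cnj (torus_char z n) = cis (real (m i) * \<theta> - real (n i) * \<theta>)"
    by (simp add: cis_cnj cis_mult)
  also have "real (m i) * \<theta> - real (n i) * \<theta> = (real (m i) - real (n i)) * \<theta>"
    by (rule left_diff_distrib[symmetric])
  also have "\<dots> = pi" using i by (simp add: \<theta>_def)
  finally show ?thesis by (intro bexI[of _ z]) (auto simp: torus_def z_def)
qed

locale universal_family = k_graph \<Lambda> for \<Lambda> :: "('p, 'k::finite) kgraph" (structure) +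
  fixes \<E> :: "'p set set" and A :: "'a cstar" and s :: "'p \<Rightarrow> 'a"
  assumes aligned: "finitely_aligned \<Lambda>" and \<E>: "\<E> \<subseteq> FE \<Lambda>"
    and universal: "universal_CK_algebra \<Lambda> \<E> A s"
begin

sublocale toeplitz_family \<Lambda> A s
proof -
  have "cstar_algebra A" "rel_CK_family \<Lambda> \<E> A s"
    using universal by (simp_all add: universal_CK_algebra_def)
  then show "toeplitz_family \<Lambda> A s"
    by (intro toeplitz_family_if_rel_CK[OF k_graph_axioms aligned])
qed

lemma CK: "rel_CK_family \<Lambda> \<E> A s" using universal by (simp add: universal_CK_algebra_def)

lemma CK_hom:
  fixes B :: "'a cstar"
  assumes "cstar_algebra B" "rel_CK_family \<Lambda> \<E> B t"
  shows "cstar_morphism A B (CK_hom \<Lambda> A s B t)" "\<mu> \<in> paths \<Lambda> \<Longrightarrow> CK_hom \<Lambda> A s B t (s \<mu>) = t \<mu>"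
proof -
  have "\<exists>!\<phi>. \<phi> \<in> cstar_hom A B \<and> (\<forall>\<mu>\<in>paths \<Lambda>. \<phi> (s \<mu>) = t \<mu>)"
    using universal assms unfolding universal_CK_algebra_def by simp
  then have *: "CK_hom \<Lambda> A s B t \<in> cstar_hom A B \<and> (\<forall>\<mu>\<in>paths \<Lambda>. CK_hom \<Lambda> A s B t (s \<mu>) = t \<mu>)"
    unfolding CK_hom_def by (rule theI')
  then show "\<mu> \<in> paths \<Lambda> \<Longrightarrow> CK_hom \<Lambda> A s B t (s \<mu>) = t \<mu>" by blast
  show "cstar_morphism A B (CK_hom \<Lambda> A s B t)"
    using * assms(1) alg.cstar_algebra_axioms by (simp add: cstar_morphism_def cstar_morphism_axioms_def)
qed

text \<open>
  An exhaustive set is nonempty, because it has a common extension with the vertex itself. So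
  the description in \<^const>\<open>rng_set\<close> denotes that vertex.
\<close>

lemma rng_set_vertex:
  assumes "E \<in> \<E>" shows "rng_set \<Lambda> E \<in> vertices \<Lambda>" "E \<subseteq> paths \<Lambda>"
proof -
  have "E \<in> FE \<Lambda>" using assms \<E> by blast
  then obtain v where "v \<in> vertices \<Lambda>" "E \<in> {E. E \<subseteq> paths_into \<Lambda> v - {v} \<and> finite E \<and> exhaustive \<Lambda> v E}"
    unfolding FE_def by (rule UN_E)
  then have v: "v \<in> vertices \<Lambda>" "E \<subseteq> paths_into \<Lambda> v" "exhaustive \<Lambda> v E" by auto
  then have "v \<in> paths_into \<Lambda> v" using deg_zero_id[of v] by (simp add: vertices_def paths_into_def)
  then obtain \<mu> where \<mu>: "\<mu> \<in> E" using v(3) by (auto simp: exhaustive_def Ext_def)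
  then have "rng_set \<Lambda> E = v"
    unfolding rng_set_def using v by (intro the_equality) (auto simp: paths_into_def)
  then show "rng_set \<Lambda> E \<in> vertices \<Lambda>" "E \<subseteq> paths \<Lambda>" using v by (auto simp: paths_into_def)
qed

text \<open>
  If \<open>\<mu> \<cdot> \<alpha> = \<nu> \<cdot> \<beta>\<close>, then the degrees of both sides agree and the scalars on the two sides of \<open>t_star\<close>
  are equal. Range projections, and with them the relations for \<open>\<E>\<close>, are unaffected by unimodular scalars.
\<close>

lemma rel_CK_family_gauge:
  assumes z: "z \<in> torus" shows "rel_CK_family \<Lambda> \<E> A (\<lambda>\<mu>. torus_char z (deg \<Lambda> \<mu>) \<odot>\<^bsub>A\<^esub> s \<mu>)"
proof -
  let ?c = "\<lambda>\<mu>. torus_char z (deg \<Lambda> \<mu>)"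
  let ?t = "\<lambda>\<mu>. ?c \<mu> \<odot>\<^bsub>A\<^esub> s \<mu>"
  have vert: "?t v = s v" if "v \<in> vertices \<Lambda>" for v using that by (simp add: vertices_def)
  have proj: "?t \<mu> \<otimes>\<^bsub>A\<^esub> adj A (?t \<mu>) = s \<mu> \<otimes>\<^bsub>A\<^esub> adj A (s \<mu>)" if "\<mu> \<in> paths \<Lambda>" for \<mu>
    using that by (simp add: alg.adj_smult alg.smult_mult_left alg.smult_mult_right alg.scale_simps(3)
        torus_char_cnj[OF z])
  note CK = CK[unfolded rel_CK_family_def]
  show ?thesis
    unfolding rel_CK_family_def
  proof (intro conjI ballI impI)
    fix \<mu> assume \<mu>: "\<mu> \<in> paths \<Lambda>"
    have "s \<mu> \<otimes>\<^bsub>A\<^esub> adj A (s \<mu>) \<otimes>\<^bsub>A\<^esub> s \<mu> = s \<mu>" using range_proj_mult_t[OF \<mu>] by (simp add: range_proj_def)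
    then show "partial_isometry A (?t \<mu>)"
      unfolding partial_isometry_def proj[OF \<mu>] using \<mu> by (simp add: alg.smult_mult_right)
  next
    fix v assume "v \<in> vertices \<Lambda>" then show "projection A (?t v)" using t_vertex vert by simp
  next
    fix v w assume "v \<in> vertices \<Lambda>" "w \<in> vertices \<Lambda>" "v \<noteq> w"
    then show "?t v \<otimes>\<^bsub>A\<^esub> ?t w = \<zero>\<^bsub>A\<^esub>" using t_orthogonal vert by simp
  next
    fix \<mu> \<nu> assume "\<mu> \<in> paths \<Lambda>" "\<nu> \<in> paths \<Lambda>" "src \<Lambda> \<mu> = rng \<Lambda> \<nu>"
    then show "?t \<mu> \<otimes>\<^bsub>A\<^esub> ?t \<nu> = ?t (\<mu> \<cdot> \<nu>)"
      by (simp add: alg.smult_mult_left alg.smult_mult_right alg.scale_simps(3) t_cmp deg_cmp cmp_closed torus_char_add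
          mult.commute)
  next
    fix \<mu> \<nu> assume p: "\<mu> \<in> paths \<Lambda>" "\<nu> \<in> paths \<Lambda>"
    let ?L = "Lambda_min \<Lambda> \<mu> \<nu>"
    have L: "fst q \<in> paths \<Lambda>" "snd q \<in> paths \<Lambda>" "?c \<mu> * ?c (fst q) = ?c \<nu> * ?c (snd q)" if "q \<in> ?L" for q
    proof -
      have *: "fst q \<in> paths \<Lambda>" "snd q \<in> paths \<Lambda>" "src \<Lambda> \<mu> = rng \<Lambda> (fst q)" "src \<Lambda> \<nu> = rng \<Lambda> (snd q)"
        "\<mu> \<cdot> fst q = \<nu> \<cdot> snd q"
        using that Lambda_min_iff[OF p, of "fst q" "snd q"] by simp_all
      then have "deg \<Lambda> \<mu> + deg \<Lambda> (fst q) = deg \<Lambda> \<nu> + deg \<Lambda> (snd q)"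
        using deg_cmp[OF p(1) *(1,3)] deg_cmp[OF p(2) *(2,4)] by simp
      then show "fst q \<in> paths \<Lambda>" "snd q \<in> paths \<Lambda>" "?c \<mu> * ?c (fst q) = ?c \<nu> * ?c (snd q)"
        using * by (simp_all add: torus_char_add[symmetric])
    qed
    have coef: "cnj (?c \<mu>) * ?c \<nu> = ?c (fst q) * cnj (?c (snd q))" if "q \<in> ?L" for q
    proof -
      have "cnj (?c \<mu>) * ?c \<nu> = cnj (?c \<mu>) * (?c \<nu> * ?c (snd q)) * cnj (?c (snd q))"
        using torus_char_cnj(1)[OF z, of "deg \<Lambda> (snd q)"] by (simp add: mult.assoc)
      also have "\<dots> = cnj (?c \<mu>) * ?c \<mu> * ?c (fst q) * cnj (?c (snd q))"
        using L(3)[OF that] by (simp add: mult.assoc)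
      finally show ?thesis by (simp add: torus_char_cnj(2)[OF z])
    qed
    have "adj A (?t \<mu>) \<otimes>\<^bsub>A\<^esub> ?t \<nu> = (cnj (?c \<mu>) * ?c \<nu>) \<odot>\<^bsub>A\<^esub> (adj A (s \<mu>) \<otimes>\<^bsub>A\<^esub> s \<nu>)"
      using p by (simp add: alg.adj_smult alg.smult_mult_left alg.smult_mult_right alg.scale_simps(3) mult.commute)
    also have "\<dots> = (\<Oplus>\<^bsub>A\<^esub>q\<in>?L. (cnj (?c \<mu>) * ?c \<nu>) \<odot>\<^bsub>A\<^esub> (s (fst q) \<otimes>\<^bsub>A\<^esub> adj A (s (snd q))))"
      unfolding t_star[OF p] using L finite_Lambda_min[OF fa p] by (intro alg.finsum_smult) auto
    also have "\<dots> = (\<Oplus>\<^bsub>A\<^esub>q\<in>?L. ?t (fst q) \<otimes>\<^bsub>A\<^esub> adj A (?t (snd q)))"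
    proof (rule alg.M.finsum_cong')
      fix q assume q: "q \<in> ?L"
      show "(cnj (?c \<mu>) * ?c \<nu>) \<odot>\<^bsub>A\<^esub> (s (fst q) \<otimes>\<^bsub>A\<^esub> adj A (s (snd q))) = ?t (fst q) \<otimes>\<^bsub>A\<^esub> adj A (?t (snd q))"
        unfolding coef[OF q] using L(1,2)[OF q]
        by (simp add: alg.adj_smult alg.smult_mult_left alg.smult_mult_right alg.scale_simps(3) mult.commute)
    next
      show "(\<lambda>q. ?t (fst q) \<otimes>\<^bsub>A\<^esub> adj A (?t (snd q))) \<in> ?L \<rightarrow> carrier A" using L by simp
    qed simp
    finally show "adj A (?t \<mu>) \<otimes>\<^bsub>A\<^esub> ?t \<nu> = (\<Oplus>\<^bsub>A\<^esub>q\<in>?L. ?t (fst q) \<otimes>\<^bsub>A\<^esub> adj A (?t (snd q)))" .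
  next
    fix E assume E: "E \<in> \<E>"
    note r = rng_set_vertex[OF E]
    have "prod_act A (\<lambda>\<mu>. ?t (rng_set \<Lambda> E) \<ominus>\<^bsub>A\<^esub> ?t \<mu> \<otimes>\<^bsub>A\<^esub> adj A (?t \<mu>)) E (?t (rng_set \<Lambda> E)) =
       prod_act A (\<lambda>\<mu>. s (rng_set \<Lambda> E) \<ominus>\<^bsub>A\<^esub> s \<mu> \<otimes>\<^bsub>A\<^esub> adj A (s \<mu>)) E (s (rng_set \<Lambda> E))"
      unfolding vert[OF r(1)]
    proof (rule prod_act_cong)
      fix \<mu> assume "\<mu> \<in> E"
      then show "s (rng_set \<Lambda> E) \<ominus>\<^bsub>A\<^esub> ?t \<mu> \<otimes>\<^bsub>A\<^esub> adj A (?t \<mu>) = s (rng_set \<Lambda> E) \<ominus>\<^bsub>A\<^esub> s \<mu> \<otimes>\<^bsub>A\<^esub> adj A (s \<mu>)"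
        using r(2) proj by auto
    qed
    also have "\<dots> = \<zero>\<^bsub>A\<^esub>"
      using CK[THEN conjunct2, THEN conjunct2, THEN conjunct2, THEN conjunct2, THEN conjunct2] E by simp
    finally show "prod_act A (\<lambda>\<mu>. ?t (rng_set \<Lambda> E) \<ominus>\<^bsub>A\<^esub> ?t \<mu> \<otimes>\<^bsub>A\<^esub> adj A (?t \<mu>)) E (?t (rng_set \<Lambda> E)) = \<zero>\<^bsub>A\<^esub>" .
  qed
qed

definition \<gamma> where "\<gamma> z = gauge_action \<Lambda> A s z"

lemma
  assumes "z \<in> torus"
  shows gauge_morphism: "cstar_morphism A A (\<gamma> z)"
    and gauge_generator: "\<mu> \<in> paths \<Lambda> \<Longrightarrow> \<gamma> z (s \<mu>) = torus_char z (deg \<Lambda> \<mu>) \<odot>\<^bsub>A\<^esub> s \<mu>"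
  unfolding \<gamma>_def gauge_action_def torus_char_def[symmetric]
  using CK_hom[OF alg.cstar_algebra_axioms rel_CK_family_gauge[OF assms]] by blast+

definition monomials :: "'a set" where
  "monomials = {s \<kappa> \<otimes>\<^bsub>A\<^esub> adj A (s \<mu>) |\<kappa> \<mu>. \<kappa> \<in> paths \<Lambda> \<and> \<mu> \<in> paths \<Lambda> \<and> src \<Lambda> \<kappa> = src \<Lambda> \<mu>}"

definition core_monomials :: "'a set" where
  "core_monomials = {s \<kappa> \<otimes>\<^bsub>A\<^esub> adj A (s \<mu>) |\<kappa> \<mu>. \<kappa> \<in> paths \<Lambda> \<and> \<mu> \<in> paths \<Lambda> \<and> src \<Lambda> \<kappa> = src \<Lambda> \<mu> \<and>
     deg \<Lambda> \<kappa> = deg \<Lambda> \<mu>}"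

lemma monomials_closed: "monomials \<subseteq> carrier A" by (auto simp: monomials_def)

lemma core_monomials_closed: "core_monomials \<subseteq> carrier A" by (auto simp: core_monomials_def)

lemma gauge_monomial:
  assumes z: "z \<in> torus" and p: "\<kappa> \<in> paths \<Lambda>" "\<mu> \<in> paths \<Lambda>"
  shows "\<gamma> z (s \<kappa> \<otimes>\<^bsub>A\<^esub> adj A (s \<mu>)) =
    (torus_char z (deg \<Lambda> \<kappa>) * cnj (torus_char z (deg \<Lambda> \<mu>))) \<odot>\<^bsub>A\<^esub> (s \<kappa> \<otimes>\<^bsub>A\<^esub> adj A (s \<mu>))"
proof -
  interpret \<gamma>: cstar_morphism A A "\<gamma> z" by (rule gauge_morphism[OF z])
  show ?thesis using p
    by (simp add: \<gamma>.hom_mult \<gamma>.hom_adj gauge_generator[OF z] alg.adj_smult alg.smult_mult_left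
        alg.smult_mult_right alg.scale_simps(3) mult.commute)
qed

text \<open>
  The span of the monomials is a star-algebra by \<open>product_expansion\<close>. Its closure is therefore a C*-subalgebra
  containing the generators.
\<close>

lemma monomials_dense: "norm_closure A (lin_span A monomials) = carrier A"
proof
  let ?S = "lin_span A monomials"
  note sub = alg.lin_span_closed[OF monomials_closed]
  have adj: "adj A d \<in> ?S" if d: "d \<in> monomials" for d
  proof -
    obtain \<kappa> \<mu> where *: "d = s \<kappa> \<otimes>\<^bsub>A\<^esub> adj A (s \<mu>)" "\<kappa> \<in> paths \<Lambda>" "\<mu> \<in> paths \<Lambda>" "src \<Lambda> \<kappa> = src \<Lambda> \<mu>"
      using d unfolding monomials_def by blast
    then have "adj A d = s \<mu> \<otimes>\<^bsub>A\<^esub> adj A (s \<kappa>)" by (simp add: alg.adj_mult alg.adj_adj)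
    then have "adj A d \<in> monomials" using * unfolding monomials_def by (metis (mono_tags, lifting) mem_Collect_eq)
    then show ?thesis by (rule alg.lin_span_gen[OF monomials_closed])
  qed
  note S = alg.star_subspace_lin_span[OF monomials_closed adj]
  have "d \<otimes>\<^bsub>A\<^esub> e \<in> ?S" if de: "d \<in> monomials" "e \<in> monomials" for d e
  proof -
    obtain \<kappa> \<mu> where d: "d = s \<kappa> \<otimes>\<^bsub>A\<^esub> adj A (s \<mu>)" "\<kappa> \<in> paths \<Lambda>" "\<mu> \<in> paths \<Lambda>" "src \<Lambda> \<kappa> = src \<Lambda> \<mu>"
      using de(1) unfolding monomials_def by blast
    obtain \<nu> \<rho> where e: "e = s \<nu> \<otimes>\<^bsub>A\<^esub> adj A (s \<rho>)" "\<nu> \<in> paths \<Lambda>" "\<rho> \<in> paths \<Lambda>" "src \<Lambda> \<nu> = src \<Lambda> \<rho>"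
      using de(2) unfolding monomials_def by blast
    have "s (\<kappa> \<cdot> fst q) \<otimes>\<^bsub>A\<^esub> adj A (s (\<rho> \<cdot> snd q)) \<in> ?S" if q: "q \<in> Lambda_min \<Lambda> \<mu> \<nu>" for q
    proof -
      have l: "fst q \<in> paths \<Lambda>" "snd q \<in> paths \<Lambda>" "src \<Lambda> \<mu> = rng \<Lambda> (fst q)" "src \<Lambda> \<nu> = rng \<Lambda> (snd q)"
        "\<mu> \<cdot> fst q = \<nu> \<cdot> snd q"
        using q Lambda_min_iff[OF d(3) e(2), of "fst q" "snd q"] by simp_all
      have "src \<Lambda> (fst q) = src \<Lambda> (snd q)"
        using src_cmp[OF d(3) l(1,3)] src_cmp[OF e(2) l(2,4)] l(5) by simp
      then have "src \<Lambda> (\<kappa> \<cdot> fst q) = src \<Lambda> (\<rho> \<cdot> snd q)"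
        using src_cmp[OF d(2) l(1)] src_cmp[OF e(3) l(2)] l(3,4) d(4) e(4) by simp
      then have "s (\<kappa> \<cdot> fst q) \<otimes>\<^bsub>A\<^esub> adj A (s (\<rho> \<cdot> snd q)) \<in> monomials"
        unfolding monomials_def using cmp_closed[OF d(2) l(1)] cmp_closed[OF e(3) l(2)] l(3,4) d(4) e(4) by auto
      then show ?thesis by (rule alg.lin_span_gen[OF monomials_closed])
    qed
    then show ?thesis
      unfolding d(1) e(1) product_expansion[OF d(2,3) e(2,3) d(4) e(4)]
      by (intro alg.star_subspace_finsum[OF S]) auto
  qed
  note m = alg.mult_closed_lin_span[OF monomials_closed this]
  have cs: "cstar_subalgebra (norm_closure A ?S) A"
    by (rule alg.closed_star_subalgebra[OF alg.star_subspace_closure[OF S] alg.mult_closed_closure[OF S m]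
          alg.norm_closed_norm_closure[OF sub]])
  have "s \<mu> \<in> norm_closure A ?S" if \<mu>: "\<mu> \<in> paths \<Lambda>" for \<mu>
  proof -
    have "s \<mu> = s \<mu> \<otimes>\<^bsub>A\<^esub> adj A (s (src \<Lambda> \<mu>))" using \<mu> t_src[OF \<mu>] t_mult_src[OF \<mu>] by simp
    moreover have "s \<mu> \<otimes>\<^bsub>A\<^esub> adj A (s (src \<Lambda> \<mu>)) \<in> monomials"
      unfolding monomials_def using \<mu> src_closed[OF \<mu>] src_src[OF \<mu>]
      by (intro CollectI exI[of _ \<mu>] exI[of _ "src \<Lambda> \<mu>"]) simp
    ultimately have "s \<mu> \<in> ?S" using alg.lin_span_gen[OF monomials_closed] by simp
    then show ?thesis using alg.norm_closure_subset[OF sub] by blast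
  qed
  then have "cstar_generated A (s ` paths \<Lambda>) \<subseteq> norm_closure A ?S"
    unfolding cstar_generated_def using cs by blast
  then show "carrier A \<subseteq> norm_closure A ?S"
    using universal by (simp add: universal_CK_algebra_def)
qed (auto dest: alg.norm_closureD)

definition fixed :: "'a set" where "fixed = {a \<in> carrier A. \<forall>z\<in>torus. \<gamma> z a = a}"

lemma core_eq: "core \<Lambda> A s = A\<lparr>carrier := fixed\<rparr>"
  by (simp add: core_def fixed_def \<gamma>_def)

lemma gauge_operations:
  assumes "z \<in> torus"
  shows "\<gamma> z \<zero>\<^bsub>A\<^esub> = \<zero>\<^bsub>A\<^esub>"
    "\<lbrakk>x \<in> carrier A; y \<in> carrier A\<rbrakk> \<Longrightarrow> \<gamma> z (x \<oplus>\<^bsub>A\<^esub> y) = \<gamma> z x \<oplus>\<^bsub>A\<^esub> \<gamma> z y"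
    "x \<in> carrier A \<Longrightarrow> \<gamma> z (c \<odot>\<^bsub>A\<^esub> x) = c \<odot>\<^bsub>A\<^esub> \<gamma> z x"
    "\<lbrakk>x \<in> carrier A; y \<in> carrier A\<rbrakk> \<Longrightarrow> \<gamma> z (x \<otimes>\<^bsub>A\<^esub> y) = \<gamma> z x \<otimes>\<^bsub>A\<^esub> \<gamma> z y"
    "x \<in> carrier A \<Longrightarrow> \<gamma> z (adj A x) = adj A (\<gamma> z x)"
proof -
  interpret \<gamma>: cstar_morphism A A "\<gamma> z" by (rule gauge_morphism[OF assms])
  show "\<gamma> z \<zero>\<^bsub>A\<^esub> = \<zero>\<^bsub>A\<^esub>"
    "\<lbrakk>x \<in> carrier A; y \<in> carrier A\<rbrakk> \<Longrightarrow> \<gamma> z (x \<oplus>\<^bsub>A\<^esub> y) = \<gamma> z x \<oplus>\<^bsub>A\<^esub> \<gamma> z y"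
    "x \<in> carrier A \<Longrightarrow> \<gamma> z (c \<odot>\<^bsub>A\<^esub> x) = c \<odot>\<^bsub>A\<^esub> \<gamma> z x"
    "\<lbrakk>x \<in> carrier A; y \<in> carrier A\<rbrakk> \<Longrightarrow> \<gamma> z (x \<otimes>\<^bsub>A\<^esub> y) = \<gamma> z x \<otimes>\<^bsub>A\<^esub> \<gamma> z y"
    "x \<in> carrier A \<Longrightarrow> \<gamma> z (adj A x) = adj A (\<gamma> z x)"
    by (simp_all add: \<gamma>.hom_add \<gamma>.hom_smult \<gamma>.hom_mult \<gamma>.hom_adj)
qed

lemma star_subspace_fixed: "star_subspace A fixed"
  unfolding star_subspace_def fixed_def by (auto simp: gauge_operations)

lemma mult_closed_fixed: "mult_closed_set A fixed"
  unfolding mult_closed_set_def fixed_def by (auto simp: gauge_operations)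

lemma gauge_limit:
  assumes z: "z \<in> torus" and lim: "norm_limit A \<sigma> x"
  shows "norm_limit A (\<lambda>n. \<gamma> z (\<sigma> n)) (\<gamma> z x)"
proof -
  interpret \<gamma>: cstar_morphism A A "\<gamma> z" by (rule gauge_morphism[OF z])
  note [simp] = alg.norm_limitD(1,2)[OF lim]
  show ?thesis
    by (rule alg.norm_limitI_bound[OF _ _ _ alg.norm_limitD(3)[OF lim]])
       (simp_all add: \<gamma>.hom_minus[symmetric] \<gamma>.hom_contractive)
qed

lemma norm_closed_fixed: "norm_closed A fixed"
  unfolding norm_closed_def
proof (intro conjI allI impI)
  fix \<sigma> x assume \<sigma>: "range \<sigma> \<subseteq> fixed" and lim: "norm_limit A \<sigma> x"
  have "\<gamma> z x = x" if z: "z \<in> torus" for z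
  proof -
    have "\<gamma> z (\<sigma> n) = \<sigma> n" for n using \<sigma> z by (auto simp: fixed_def)
    then have "norm_limit A \<sigma> (\<gamma> z x)" using gauge_limit[OF z lim] by simp
    then show ?thesis using lim by (rule alg.norm_limit_unique)
  qed
  then show "x \<in> fixed" using alg.norm_limitD(2)[OF lim] by (simp add: fixed_def)
qed (auto simp: fixed_def)

lemma core_monomials_fixed: "core_monomials \<subseteq> fixed"
proof
  fix d assume "d \<in> core_monomials"
  then obtain \<kappa> \<mu> where *: "d = s \<kappa> \<otimes>\<^bsub>A\<^esub> adj A (s \<mu>)" "\<kappa> \<in> paths \<Lambda>" "\<mu> \<in> paths \<Lambda>" "deg \<Lambda> \<kappa> = deg \<Lambda> \<mu>"
    unfolding core_monomials_def by blast
  then show "d \<in> fixed" by (simp add: fixed_def gauge_monomial torus_char_cnj)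
qed

text \<open>
  Finite compositions of the maps \<open>x \<mapsto> (x + \<gamma>\<^sub>z x) / 2\<close>.
\<close>

inductive averaging :: "('a \<Rightarrow> 'a) \<Rightarrow> bool" where
  id: "averaging (\<lambda>x. x)"
| mean: "\<lbrakk>averaging T; z \<in> torus\<rbrakk> \<Longrightarrow> averaging (\<lambda>x. (1/2) \<odot>\<^bsub>A\<^esub> (T x \<oplus>\<^bsub>A\<^esub> \<gamma> z (T x)))"

lemma averaging_props:
  assumes "averaging T"
  shows "(\<forall>x\<in>carrier A. T x \<in> carrier A \<and> nrm A (T x) \<le> nrm A x) \<and>
    (\<forall>x\<in>carrier A. \<forall>y\<in>carrier A. \<forall>c. T (c \<odot>\<^bsub>A\<^esub> x \<oplus>\<^bsub>A\<^esub> y) = c \<odot>\<^bsub>A\<^esub> T x \<oplus>\<^bsub>A\<^esub> T y) \<and>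
    (\<forall>a\<in>fixed. T a = a) \<and> (\<forall>d\<in>monomials. \<exists>c. T d = c \<odot>\<^bsub>A\<^esub> d)"
  using assms
proof induction
  case id
  have "\<exists>c. d = c \<odot>\<^bsub>A\<^esub> d" if "d \<in> monomials" for d
    using monomials_closed that by (intro exI[of _ 1]) auto
  then show ?case by simp
next
  case (mean T z)
  interpret \<gamma>: cstar_morphism A A "\<gamma> z" by (rule gauge_morphism[OF mean(2)])
  let ?P = "\<lambda>x. (1/2) \<odot>\<^bsub>A\<^esub> (T x \<oplus>\<^bsub>A\<^esub> \<gamma> z (T x))"
  have T: "T x \<in> carrier A" "nrm A (T x) \<le> nrm A x" if "x \<in> carrier A" for x using mean.IH that by auto
  show ?case
  proof (intro conjI ballI allI)
    fix x assume x: "x \<in> carrier A"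
    show "?P x \<in> carrier A" using T[OF x] by simp
    have "nrm A (?P x) \<le> (1/2) * (nrm A (T x) + nrm A (\<gamma> z (T x)))"
      using T[OF x] alg.nrm_add[of "T x" "\<gamma> z (T x)"] by (simp add: alg.nrm_smult)
    also have "\<dots> \<le> nrm A x" using T[OF x] \<gamma>.hom_contractive[OF T(1)[OF x]] by simp
    finally show "nrm A (?P x) \<le> nrm A x" .
  next
    fix x y c assume xy: "x \<in> carrier A" "y \<in> carrier A"
    then have "T (c \<odot>\<^bsub>A\<^esub> x \<oplus>\<^bsub>A\<^esub> y) = c \<odot>\<^bsub>A\<^esub> T x \<oplus>\<^bsub>A\<^esub> T y" using mean.IH by blast
    then show "?P (c \<odot>\<^bsub>A\<^esub> x \<oplus>\<^bsub>A\<^esub> y) = c \<odot>\<^bsub>A\<^esub> ?P x \<oplus>\<^bsub>A\<^esub> ?P y"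
      using T(1)[OF xy(1)] T(1)[OF xy(2)]
      by (simp add: \<gamma>.hom_add \<gamma>.hom_smult alg.scale_simps alg.M.a_ac mult.commute)
  next
    fix a assume a: "a \<in> fixed"
    then have "?P a = (1/2) \<odot>\<^bsub>A\<^esub> (a \<oplus>\<^bsub>A\<^esub> a)" using mean by (simp add: fixed_def)
    also have "\<dots> = (1/2 + 1/2) \<odot>\<^bsub>A\<^esub> a" using a by (subst alg.scale_simps(1)) (auto simp: fixed_def alg.scale_simps(2))
    finally show "?P a = a" using a by (simp add: fixed_def)
  next
    fix d assume d: "d \<in> monomials"
    then obtain c where c: "T d = c \<odot>\<^bsub>A\<^esub> d" using mean.IH by blast
    obtain \<kappa> \<mu> where p: "d = s \<kappa> \<otimes>\<^bsub>A\<^esub> adj A (s \<mu>)" "\<kappa> \<in> paths \<Lambda>" "\<mu> \<in> paths \<Lambda>"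
      using d unfolding monomials_def by blast
    have dc: "d \<in> carrier A" using d monomials_closed by auto
    obtain k where k: "\<gamma> z d = k \<odot>\<^bsub>A\<^esub> d" using gauge_monomial[OF mean(2) p(2,3)] p(1) by blast
    have "?P d = ((1/2) * (c + c * k)) \<odot>\<^bsub>A\<^esub> d"
      using dc by (simp add: c k \<gamma>.hom_smult alg.scale_simps ring_distribs)
    then show "\<exists>c. ?P d = c \<odot>\<^bsub>A\<^esub> d" by blast
  qed
qed

lemma
  assumes "averaging T"
  shows averaging_closed: "x \<in> carrier A \<Longrightarrow> T x \<in> carrier A"
    and averaging_contractive: "x \<in> carrier A \<Longrightarrow> nrm A (T x) \<le> nrm A x"
    and averaging_linear: "\<lbrakk>x \<in> carrier A; y \<in> carrier A\<rbrakk> \<Longrightarrow> T (c \<odot>\<^bsub>A\<^esub> x \<oplus>\<^bsub>A\<^esub> y) = c \<odot>\<^bsub>A\<^esub> T x \<oplus>\<^bsub>A\<^esub> T y"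
    and averaging_fixed: "a \<in> fixed \<Longrightarrow> T a = a"
    and averaging_monomial: "d \<in> monomials \<Longrightarrow> \<exists>c. T d = c \<odot>\<^bsub>A\<^esub> d"
  using averaging_props[OF assms] by simp_all

text \<open>
  A monomial of nonzero degree is an eigenvector of every \<open>\<gamma> z\<close>, for some \<open>z\<close> with eigenvalue \<open>-1\<close>.
  Averaging over \<open>1\<close> and this \<open>z\<close> kills it and rescales the other monomials, so
  finitely many averages of this kind remove the monomials of nonzero degree in a linear combination one by one.
  They play the part of the conditional expectation given by integration over the torus.
\<close>

lemma averaging_into_core_span:
  assumes "x \<in> lin_span A monomials"
  shows "\<exists>T. averaging T \<and> T x \<in> lin_span A core_monomials"
  using assms
proof induction
  case zero
  show ?case by (intro exI[of _ "\<lambda>x. x"]) (simp add: averaging.id lin_span.zero)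
next
  case (step x d c)
  then obtain T where T: "averaging T" "T x \<in> lin_span A core_monomials" by blast
  have cl: "d \<in> carrier A" "x \<in> carrier A"
    using step monomials_closed alg.lin_span_closed[OF monomials_closed] by auto
  have Tdx: "T (c \<odot>\<^bsub>A\<^esub> d \<oplus>\<^bsub>A\<^esub> x) = c \<odot>\<^bsub>A\<^esub> T d \<oplus>\<^bsub>A\<^esub> T x" using averaging_linear[OF T(1) cl] .
  obtain k where k: "T d = k \<odot>\<^bsub>A\<^esub> d" using averaging_monomial[OF T(1) step(2)] by blast
  obtain \<kappa> \<mu> where p: "d = s \<kappa> \<otimes>\<^bsub>A\<^esub> adj A (s \<mu>)" "\<kappa> \<in> paths \<Lambda>" "\<mu> \<in> paths \<Lambda>" "src \<Lambda> \<kappa> = src \<Lambda> \<mu>"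
    using step(2) unfolding monomials_def by blast
  have eq: "T (c \<odot>\<^bsub>A\<^esub> d \<oplus>\<^bsub>A\<^esub> x) = (c * k) \<odot>\<^bsub>A\<^esub> d \<oplus>\<^bsub>A\<^esub> T x"
    using Tdx cl by (simp add: k alg.scale_simps)
  show ?case
  proof (cases "deg \<Lambda> \<kappa> = deg \<Lambda> \<mu>")
    case True
    then have "d \<in> core_monomials" using p unfolding core_monomials_def by blast
    then show ?thesis using T eq by (intro exI[of _ T]) (simp add: lin_span.step)
  next
    case False
    then obtain z where z: "z \<in> torus" "torus_char z (deg \<Lambda> \<kappa>) * cnj (torus_char z (deg \<Lambda> \<mu>)) = -1"
      using torus_char_separates by blast
    interpret \<gamma>: cstar_morphism A A "\<gamma> z" by (rule gauge_morphism[OF z(1)])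
    have gd: "\<gamma> z d = (-1) \<odot>\<^bsub>A\<^esub> d" using gauge_monomial[OF z(1) p(2,3)] p(1) z(2) by simp
    have Tx: "T x \<in> carrier A" using averaging_closed[OF T(1) cl(2)] .
    have "T x \<in> fixed"
      using T(2) alg.lin_span_least[OF star_subspace_fixed core_monomials_fixed] by blast
    then have gx: "\<gamma> z (T x) = T x" using z(1) by (simp add: fixed_def)
    let ?y = "T (c \<odot>\<^bsub>A\<^esub> d \<oplus>\<^bsub>A\<^esub> x)"
    have "?y \<oplus>\<^bsub>A\<^esub> \<gamma> z ?y = ((c * k) \<odot>\<^bsub>A\<^esub> d \<oplus>\<^bsub>A\<^esub> (-(c * k)) \<odot>\<^bsub>A\<^esub> d) \<oplus>\<^bsub>A\<^esub> (T x \<oplus>\<^bsub>A\<^esub> T x)"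
      unfolding eq using cl Tx by (simp add: \<gamma>.hom_add \<gamma>.hom_smult gd gx alg.scale_simps alg.M.a_ac)
    also have "(c * k) \<odot>\<^bsub>A\<^esub> d \<oplus>\<^bsub>A\<^esub> (-(c * k)) \<odot>\<^bsub>A\<^esub> d = \<zero>\<^bsub>A\<^esub>"
      using alg.scale_simps(1)[OF cl(1), of "c * k" "-(c * k)"] cl by simp
    finally have "(1/2) \<odot>\<^bsub>A\<^esub> (?y \<oplus>\<^bsub>A\<^esub> \<gamma> z ?y) = (1/2) \<odot>\<^bsub>A\<^esub> (T x \<oplus>\<^bsub>A\<^esub> T x)" using Tx by simp
    also have "\<dots> = (1/2 + 1/2) \<odot>\<^bsub>A\<^esub> T x" using Tx by (subst alg.scale_simps(1)) (simp_all add: alg.scale_simps(2))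
    also have "\<dots> = T x" using Tx by simp
    finally show ?thesis using T(2) averaging.mean[OF T(1) z(1)]
      by (intro exI[of _ "\<lambda>x. (1/2) \<odot>\<^bsub>A\<^esub> (T x \<oplus>\<^bsub>A\<^esub> \<gamma> z (T x))"]) simp
  qed
qed

text \<open>
  Averages of an approximant \<open>x\<close> of a fixed element \<open>a\<close> are no farther from \<open>a\<close> than \<open>x\<close> is, because
  averaging is contractive and fixes \<open>a\<close>.
\<close>

lemma fixed_eq_closure: "fixed = norm_closure A (lin_span A core_monomials)"
proof
  show "norm_closure A (lin_span A core_monomials) \<subseteq> fixed"
  proof
    fix x assume "x \<in> norm_closure A (lin_span A core_monomials)"
    then obtain \<sigma> where "range \<sigma> \<subseteq> lin_span A core_monomials" "norm_limit A \<sigma> x"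
      using alg.norm_closure_limit[OF alg.lin_span_closed[OF core_monomials_closed]] by blast
    then show "x \<in> fixed"
      using norm_closed_fixed alg.lin_span_least[OF star_subspace_fixed core_monomials_fixed]
      unfolding norm_closed_def by (meson order_trans)
  qed
  show "fixed \<subseteq> norm_closure A (lin_span A core_monomials)"
  proof
    fix a assume a: "a \<in> fixed"
    then have ac: "a \<in> carrier A" by (simp add: fixed_def)
    show "a \<in> norm_closure A (lin_span A core_monomials)"
      unfolding norm_closure_def
    proof (intro CollectI conjI allI impI)
      fix \<epsilon> :: real assume "\<epsilon> > 0"
      then obtain x where x: "x \<in> lin_span A monomials" "nrm A (x \<ominus>\<^bsub>A\<^esub> a) < \<epsilon>"
        using monomials_dense ac unfolding norm_closure_def by blast
      obtain T where T: "averaging T" "T x \<in> lin_span A core_monomials"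
        using averaging_into_core_span[OF x(1)] by blast
      have xc: "x \<in> carrier A" using x alg.lin_span_closed[OF monomials_closed] by auto
      have "T ((-1) \<odot>\<^bsub>A\<^esub> a \<oplus>\<^bsub>A\<^esub> x) = (-1) \<odot>\<^bsub>A\<^esub> a \<oplus>\<^bsub>A\<^esub> T x"
        using averaging_linear[OF T(1) ac xc] averaging_fixed[OF T(1) a] by simp
      then have "T (x \<ominus>\<^bsub>A\<^esub> a) = T x \<ominus>\<^bsub>A\<^esub> a"
        using ac xc averaging_closed[OF T(1) xc] by (simp add: alg.minus_eq_scale alg.M.a_comm)
      then have "nrm A (T x \<ominus>\<^bsub>A\<^esub> a) < \<epsilon>"
        using averaging_contractive[OF T(1), of "x \<ominus>\<^bsub>A\<^esub> a"] x(2) ac xc by simp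
      then show "\<exists>y\<in>lin_span A core_monomials. nrm A (y \<ominus>\<^bsub>A\<^esub> a) < \<epsilon>" using T(2) by blast
    qed (rule ac)
  qed
qed

section \<open>Finite-dimensional approximation and injectivity\<close>

definition first_paths :: "nat \<Rightarrow> 'p set" where
  "first_paths n = {\<mu> \<in> paths \<Lambda>. to_nat_on (paths \<Lambda>) \<mu> < n}"

lemma first_paths: "finite (first_paths n)" "first_paths n \<subseteq> paths \<Lambda>"
proof -
  show "first_paths n \<subseteq> paths \<Lambda>" by (auto simp: first_paths_def)
  show "finite (first_paths n)"
  proof (rule inj_on_finite)
    show "inj_on (to_nat_on (paths \<Lambda>)) (first_paths n)"
      using inj_on_to_nat_on[OF countable_paths] by (rule inj_on_subset) (auto simp: first_paths_def)
    show "to_nat_on (paths \<Lambda>) ` first_paths n \<subseteq> {..<n}" by (auto simp: first_paths_def)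
  qed simp
qed

lemma first_paths_mono: "m \<le> n \<Longrightarrow> first_paths m \<subseteq> first_paths n"
  by (auto simp: first_paths_def)

abbreviation layer :: "nat \<Rightarrow> 'a set" where "layer n \<equiv> Theta_span \<Lambda> A s (first_paths n)"

lemma layer_mono: "m \<le> n \<Longrightarrow> layer m \<subseteq> layer n"
  by (rule Theta_span_mono[OF first_paths_mono first_paths])

lemma Theta_span_fixed:
  assumes E: "finite E" "E \<subseteq> paths \<Lambda>" shows "Theta_span \<Lambda> A s E \<subseteq> fixed"
proof (rule Theta_span_least[OF E star_subspace_fixed])
  fix \<kappa> \<mu> assume "(\<kappa>, \<mu>) \<in> Pi_pairs \<Lambda> E"
  then have "s \<kappa> \<otimes>\<^bsub>A\<^esub> adj A (s \<mu>) \<in> core_monomials"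
    unfolding core_monomials_def Pi_pairs_def using Pi_closure_paths[OF E(2)] by blast
  then show "s \<kappa> \<otimes>\<^bsub>A\<^esub> adj A (s \<mu>) \<in> fixed" using core_monomials_fixed by blast
qed

lemma core_span_in_layers: "lin_span A core_monomials \<subseteq> (\<Union>n. layer n)"
proof
  fix x assume "x \<in> lin_span A core_monomials"
  then show "x \<in> (\<Union>n. layer n)"
  proof induction
    case zero
    show ?case using alg.star_subspaceD(2)[OF star_subspace_Theta_span[OF first_paths]] by blast
  next
    case (step x d c)
    then obtain m where m: "x \<in> layer m" by blast
    obtain \<kappa> \<mu> where p: "d = s \<kappa> \<otimes>\<^bsub>A\<^esub> adj A (s \<mu>)" "\<kappa> \<in> paths \<Lambda>" "\<mu> \<in> paths \<Lambda>" "src \<Lambda> \<kappa> = src \<Lambda> \<mu>"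
      "deg \<Lambda> \<kappa> = deg \<Lambda> \<mu>" using step(2) unfolding core_monomials_def by blast
    define n where "n = max m (Suc (max (to_nat_on (paths \<Lambda>) \<kappa>) (to_nat_on (paths \<Lambda>) \<mu>)))"
    have "\<kappa> \<in> first_paths n" "\<mu> \<in> first_paths n" using p by (auto simp: first_paths_def n_def)
    then have "(\<kappa>, \<mu>) \<in> Pi_pairs \<Lambda> (first_paths n)" using p by (auto simp: Pi_pairs_def intro: Pi_closure.base)
    then have d: "d \<in> layer n" using generator_in_Theta_span[OF first_paths] p(1) by simp
    have x: "x \<in> layer n" using m layer_mono[of m n] by (auto simp: n_def)
    have "c \<odot>\<^bsub>A\<^esub> d \<oplus>\<^bsub>A\<^esub> x \<in> layer n"
      using d x alg.star_subspaceD(3,4)[OF star_subspace_Theta_span[OF first_paths]] by blast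
    then show ?case by blast
  qed
qed

lemma approximate_in_layer:
  assumes "a \<in> fixed" "\<epsilon> > 0" shows "\<exists>n. \<exists>y\<in>layer n. nrm A (y \<ominus>\<^bsub>A\<^esub> a) < \<epsilon>"
proof -
  obtain y where y: "y \<in> lin_span A core_monomials" "nrm A (y \<ominus>\<^bsub>A\<^esub> a) < \<epsilon>"
    using assms unfolding fixed_eq_closure norm_closure_def by blast
  then show ?thesis using core_span_in_layers by blast
qed

lemma cstar_subalgebra_fixed: "cstar_subalgebra fixed A"
  by (rule alg.closed_star_subalgebra[OF star_subspace_fixed mult_closed_fixed norm_closed_fixed])

theorem AF_core: "AF_algebra (core \<Lambda> A s)"
  unfolding AF_algebra_def core_eq
proof (intro conjI exI[of _ "\<lambda>n. layer n"] allI)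
  show core: "cstar_algebra (A\<lparr>carrier := fixed\<rparr>)" using cstar_subalgebra_fixed by (simp add: cstar_subalgebra_def)
  fix n
  have "layer n \<subseteq> fixed" by (rule Theta_span_fixed[OF first_paths])
  then show "cstar_subalgebra (layer n) (A\<lparr>carrier := fixed\<rparr>)"
    using cstar_subalgebra_Theta_span[OF first_paths] by (simp add: cstar_subalgebra_def)
  show "finite_dimensional (A\<lparr>carrier := fixed\<rparr>\<lparr>carrier := layer n\<rparr>)"
    using finite_dimensional_Theta_span[OF first_paths] by simp
  show "layer n \<subseteq> layer (Suc n)" by (rule layer_mono) simp
next
  let ?C = "A\<lparr>carrier := fixed\<rparr>"
  have ms: "Metric_space fixed (cstar_dist ?C)"
    using cstar_algebra.metric_space[of ?C] cstar_subalgebra_fixed by (simp add: cstar_subalgebra_def)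
  have dist: "cstar_dist ?C a y = nrm A (y \<ominus>\<^bsub>A\<^esub> a)" if "a \<in> fixed" "y \<in> fixed" for a y
  proof -
    have "a \<in> carrier A" "y \<in> carrier A" using that by (auto simp: fixed_def)
    then show ?thesis using that alg.sub_minus[OF star_subspace_fixed that] alg.nrm_minus_commute[of a y]
      by (simp add: cstar_dist_def)
  qed
  have "\<exists>y\<in>\<Union>n. layer n. y \<in> Metric_space.mball fixed (cstar_dist ?C) a r" if a: "a \<in> fixed" and r: "r > 0" for a r
  proof -
    obtain n y where y: "y \<in> layer n" "nrm A (y \<ominus>\<^bsub>A\<^esub> a) < r" using approximate_in_layer[OF a r] by blast
    then have "y \<in> fixed" using Theta_span_fixed[OF first_paths] by blast
    then have "y \<in> Metric_space.mball fixed (cstar_dist ?C) a r"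
      using y a dist by (simp add: Metric_space.in_mball[OF ms])
    then show ?thesis using y by blast
  qed
  then show "Metric_space.mtopology (carrier ?C) (cstar_dist ?C) closure_of (\<Union>n. layer n) = carrier ?C"
    using Metric_space.metric_closure_of[OF ms, of "\<Union>n. layer n"] by auto
qed

text \<open>
  A homomorphism that kills no nonzero \<open>Theta\<close> is isometric on each layer. It is contractive, so
  being isometric passes to limits of elements of the layers, and these exhaust the core.
\<close>

theorem CK_hom_inj_on_core_iff:
  fixes B :: "'a cstar"
  assumes B: "cstar_algebra B" and t: "rel_CK_family \<Lambda> \<E> B t"
  shows "inj_on (CK_hom \<Lambda> A s B t) fixed \<longleftrightarrow>
    (\<forall>E. finite E \<and> E \<subseteq> paths \<Lambda> \<longrightarrow> (\<forall>(\<kappa>, \<mu>) \<in> Pi_pairs \<Lambda> E.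
       Theta \<Lambda> A s E \<kappa> \<mu> \<noteq> \<zero>\<^bsub>A\<^esub> \<longrightarrow> Theta \<Lambda> B t E \<kappa> \<mu> \<noteq> \<zero>\<^bsub>B\<^esub>))" (is "?inj \<longleftrightarrow> ?nz")
proof
  let ?\<phi> = "CK_hom \<Lambda> A s B t"
  note mor = CK_hom(1)[OF B t]
  interpret \<phi>: cstar_morphism A B ?\<phi> by (rule mor)
  have Th: "?\<phi> (Theta \<Lambda> A s E \<kappa> \<mu>) = Theta \<Lambda> B t E \<kappa> \<mu>"
    if "finite E" "E \<subseteq> paths \<Lambda>" "(\<kappa>, \<mu>) \<in> Pi_pairs \<Lambda> E" for E \<kappa> \<mu>
    using hom_Theta[OF that(1,2) mor CK_hom(2)[OF B t] that(3)] by blast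
  {
    assume inj: ?inj
    show ?nz
    proof (intro allI impI ballI, clarify)
      fix E \<kappa> \<mu> assume E: "finite E" "E \<subseteq> paths \<Lambda>" and pr: "(\<kappa>, \<mu>) \<in> Pi_pairs \<Lambda> E"
        and nz: "Theta \<Lambda> A s E \<kappa> \<mu> \<noteq> \<zero>\<^bsub>A\<^esub>" and z: "Theta \<Lambda> B t E \<kappa> \<mu> = \<zero>\<^bsub>B\<^esub>"
      have "Theta \<Lambda> A s E \<kappa> \<mu> \<in> fixed" using Theta_in_span[OF E pr] Theta_span_fixed[OF E] by blast
      moreover have "\<zero>\<^bsub>A\<^esub> \<in> fixed" by (rule alg.star_subspaceD(2)[OF star_subspace_fixed])
      moreover have "?\<phi> (Theta \<Lambda> A s E \<kappa> \<mu>) = ?\<phi> \<zero>\<^bsub>A\<^esub>" using Th[OF E pr] z by simp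
      ultimately show False using inj nz by (meson inj_onD)
    qed
  next
    assume nz: ?nz
    have iso: "nrm B (?\<phi> y) = nrm A y" if y: "y \<in> layer n" for y n
    proof (rule matrix_units.hom_isometric_on_unit_span[OF matrix_units_Theta[OF first_paths] mor])
      show "?\<phi> (Theta \<Lambda> A s (first_paths n) \<kappa> \<mu>) \<noteq> \<zero>\<^bsub>B\<^esub>"
        if "(\<kappa>, \<mu>) \<in> Pi_pairs \<Lambda> (first_paths n)" "Theta \<Lambda> A s (first_paths n) \<kappa> \<mu> \<noteq> \<zero>\<^bsub>A\<^esub>" for \<kappa> \<mu>
        using that nz Th[OF first_paths that(1)] first_paths[of n] by fastforce
      show "y \<in> matrix_units.unit_span A (Pi_pairs \<Lambda> (first_paths n)) (Theta \<Lambda> A s (first_paths n))"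
        using y Theta_span_eq[OF first_paths, of n] by simp
    qed
    have ker: "x = \<zero>\<^bsub>A\<^esub>" if x: "x \<in> fixed" "?\<phi> x = \<zero>\<^bsub>B\<^esub>" for x
    proof -
      have xc: "x \<in> carrier A" using x by (simp add: fixed_def)
      have "nrm A x \<le> 0"
      proof (rule field_le_epsilon)
        fix \<epsilon> :: real assume "\<epsilon> > 0"
        then obtain n y where y: "y \<in> layer n" "nrm A (y \<ominus>\<^bsub>A\<^esub> x) < \<epsilon> / 2"
          using approximate_in_layer[OF x(1), of "\<epsilon> / 2"] by auto
        have yc: "y \<in> carrier A" using y(1) Theta_span_fixed[OF first_paths] by (auto simp: fixed_def)
        have "nrm A y = nrm B (?\<phi> (y \<ominus>\<^bsub>A\<^esub> x))" using iso[OF y(1)] x(2) xc yc by (simp add: \<phi>.hom_minus)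
        also have "\<dots> \<le> nrm A (y \<ominus>\<^bsub>A\<^esub> x)" using xc yc by (intro \<phi>.hom_contractive) simp
        finally show "nrm A x \<le> 0 + \<epsilon>" using alg.nrm_triangle'[OF xc yc] y(2) by simp
      qed
      then show ?thesis using alg.nrm_nonneg[OF xc] alg.nrm_eq_0[OF xc] by simp
    qed
    show ?inj
    proof (rule inj_onI)
      fix x y assume xy: "x \<in> fixed" "y \<in> fixed" "?\<phi> x = ?\<phi> y"
      then have c: "x \<in> carrier A" "y \<in> carrier A" by (auto simp: fixed_def)
      then have "?\<phi> (x \<ominus>\<^bsub>A\<^esub> y) = \<zero>\<^bsub>B\<^esub>" using xy(3) by (simp add: \<phi>.hom_minus)
      then have "x \<ominus>\<^bsub>A\<^esub> y = \<zero>\<^bsub>A\<^esub>" using ker alg.star_subspace_minus[OF star_subspace_fixed xy(1,2)] by blast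
      then show "x = y" using c by (simp add: alg.minus_eq_zero_iff)
    qed
  }
qed

end

theorem proposition3p5:
  fixes \<Lambda> :: "('p, 'k::finite) kgraph"
    and \<E> :: "'p set set"
    and A :: "'a cstar"
    and s :: "'p \<Rightarrow> 'a"
  assumes "k_graph \<Lambda>"
    and "finitely_aligned \<Lambda>"
    and "\<E> \<subseteq> FE \<Lambda>"
    and "universal_CK_algebra \<Lambda> \<E> A s"
  shows "AF_algebra (core \<Lambda> A s) \<and>
    (\<forall>(B :: 'a cstar) (t :: 'p \<Rightarrow> 'a). cstar_algebra B \<and> rel_CK_family \<Lambda> \<E> B t \<longrightarrow>
       (inj_on (CK_hom \<Lambda> A s B t) (carrier (core \<Lambda> A s)) \<longleftrightarrow>
        (\<forall>E. finite E \<and> E \<subseteq> paths \<Lambda> \<longrightarrow>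
           (\<forall>(\<kappa>, \<mu>) \<in> Pi_pairs \<Lambda> E.
              Theta \<Lambda> A s E \<kappa> \<mu> \<noteq> \<zero>\<^bsub>A\<^esub> \<longrightarrow> Theta \<Lambda> B t E \<kappa> \<mu> \<noteq> \<zero>\<^bsub>B\<^esub>))))"
proof -
  interpret universal_family \<Lambda> \<E> A s
    using assms by (simp add: universal_family_def universal_family_axioms_def)
  show ?thesis
    using AF_core CK_hom_inj_on_core_iff by (simp add: core_eq)
qed

end
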